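(* Let $\mathfrak{a}=\mathfrak a_0\oplus\mathfrak a_1$ be a Lie antialgebra over $\mathbb K$ such that the odd part $\mathfrak{a}_1$ spans the even part $\mathfrak{a}_0$ (i.e. $\mathfrak{a}_0$ is the linear span of the products $ab$ with $a,b\in\mathfrak{a}_1$). Let $\mathfrak{g}:=\mathfrak{g}_{\mathfrak{a}}$ be the adjoint Lie superalgebra associated to $\mathfrak{a}$. Then there is a two-sided ideal $\mathcal{I}_{\mathfrak{a}}$ of $\mathcal{U}(\mathfrak{g})$ such that $$\mathcal{U}(\mathfrak{a})\simeq\mathcal{U}(\mathfrak{g})/\mathcal{I}_{\mathfrak{a}}$$ as associative algebras.
   Context: $\mathbb{K}=\mathbb{R}$ or $\mathbb{C}$. A superalgebra is a (not necessarily associative) $\mathbb{Z}_2$-graded algebra $\mathfrak{a}=\mathfrak{a}_0\oplus\mathfrak{a}_1$; it is supercommutative if $a\cdot b=(-1)^{\bar a\bar b}b\cdot a$ for homogeneous $a,b$. A Lie antialgebra is a supercommutative superalgebra $\mathfrak{a}=\mathfrak{a}_0\oplus\mathfrak{a}_1$ such that, for all $x,x_i\in\mathfrak{a}_0$ and $y,y_i\in\mathfrak{a}_1$: (LA0) $x_1(x_2x_3)=(x_1x_2)x_3$; (LA1) $x_1(x_2y)=\frac12(x_1x_2)y$; (LA2) $x(y_1y_2)=(xy_1)y_2+y_1(xy_2)$; (LA3) $y_1(y_2y_3)+y_2(y_3y_1)+y_3(y_1y_2)=0$. Enveloping algebra of a Lie antialgebra: $\mathcal{U}(\mathfrak{a}):=\mathcal{T}(\mathfrak{a})/\langle\mathcal{P}\rangle$,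 where $\mathcal{T}(\mathfrak{a})=\bigoplus_{n\ge0}\mathfrak a^{\otimes n}$ is the (unital) tensor algebra and $\langle\mathcal{P}\rangle$ is the two-sided ideal generated by $\frac12(a\otimes b-b\otimes a)-ab$, $\ \frac12(a\otimes x+x\otimes a)-ax$, $\ x\otimes y-xy$, for $a,b\in\mathfrak{a}_1$, $x,y\in\mathfrak{a}_0$. Adjoint Lie superalgebra: $(\mathfrak{g}_{\mathfrak{a}})_1:=\mathfrak{a}_1$, $(\mathfrak{g}_{\mathfrak{a}})_0:=(\mathfrak{a}_1\otimes\mathfrak{a}_1)/\mathcal{S}$, where $\mathcal{S}$ is the linear subspace spanned by $\{a\otimes b-b\otimes a,\ ax\otimes b-a\otimes bx : a,b\in\mathfrak{a}_1,\ x\in\mathfrak{a}_0\}$; $a\odot b$ is the class of $a\otimes b$. The bracket is $[a,b]=a\odot b$, $[a\odot b,c]=-[c,a\odot b]=a(bc)+b(ac)$, $[a\odot b,c\odot d]=2a(bc)\odot d+2b(ad)\odot c$, for $a,b,c,d\in\mathfrak{a}_1$; this is a Lie superalgebra. Enveloping algebra of a Lie superalgebra (normalization used here): $\mathcal{U}(\mathfrak{g})$ is the quotient of the unital tensor algebra $\mathcal T(\mathfrak{g})$ by the two-sided ideal generated by $\frac12\big(x\otimes y-(-1)^{\bar x\bar y}y\otimes x\big)-[x,y]$ for homogeneous $x,y\in\mathfrak{g}$. *)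

theory Defs
  imports Complex_Main "HOL-Algebra.Algebra" "HOL-Algebra.Algebraic_Closure_Type"
    "HOL-Library.Poly_Mapping" "HOL-Library.Z2"
begin

section \<open>Linear algebra over a field given as a type\<close>

text \<open>
  The ground field is a type \<open>'k\<close> of class \<^class>\<open>field\<close>. Vector spaces and
  (possibly non-associative) algebras over it are \<^typ>\<open>('k, 'a) module\<close> records; the
  components \<^const>\<open>monoid.mult\<close> and \<^const>\<open>monoid.one\<close> of a record that only serves as a vector
  space, and \<^const>\<open>monoid.one\<close> of a non-unital algebra, are irrelevant.
\<close>

definition lin_span :: "('k::field, 'a, 'm) module_scheme \<Rightarrow> 'a set \<Rightarrow> 'a set" where
  "lin_span M S = \<Inter>{H. submodule H (ring_of_type_algebra :: 'k ring) M \<and> S \<subseteq> H}"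

text \<open>Quotient of a vector space by a subspace, and of an algebra by a two-sided ideal.\<close>

definition quot_alg ::
    "('k, 'a, 'm) module_scheme \<Rightarrow> 'a set \<Rightarrow> ('k, 'a set) module" where
  "quot_alg M N =
     ring.extend (M Quot N) (module.fields (\<lambda>c C. \<Union>x\<in>C. N +>\<^bsub>M\<^esub> (c \<odot>\<^bsub>M\<^esub> x)))"

definition alg_iso ::
    "('k, 'a, 'm) module_scheme \<Rightarrow> ('k, 'b, 'n) module_scheme \<Rightarrow> ('a \<Rightarrow> 'b) set" where
  "alg_iso A B = {h \<in> ring_iso A B. \<forall>c. \<forall>x\<in>carrier A. h (c \<odot>\<^bsub>A\<^esub> x) = c \<odot>\<^bsub>B\<^esub> h x}"

definition free_module :: "'x set \<Rightarrow> ('k::field, 'x \<Rightarrow>\<^sub>0 'k) module" where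
  "free_module B =
     \<lparr>carrier = {p. Poly_Mapping.keys p \<subseteq> B}, monoid.mult = undefined, monoid.one = undefined,
      ring.zero = 0, ring.add = (+), module.smult = (\<lambda>c. Poly_Mapping.map ((*) c))\<rparr>"

text \<open>The linear extension to the free module of a map \<open>f\<close> given on the basis.\<close>

definition lin_ext ::
    "('k::field, 'a, 'm) module_scheme \<Rightarrow> ('x \<Rightarrow> 'a) \<Rightarrow> ('x \<Rightarrow>\<^sub>0 'k) \<Rightarrow> 'a" where
  "lin_ext M f p =
     (\<Oplus>\<^bsub>M\<^esub>x\<in>Poly_Mapping.keys p. Poly_Mapping.lookup p x \<odot>\<^bsub>M\<^esub> f x)"


section \<open>Tensor products\<close>

definition bilinear_relations ::
    "('k::field, 'v, 'm) module_scheme \<Rightarrow> ('k, 'w, 'n) module_scheme \<Rightarrow> ('v \<times> 'w \<Rightarrow>\<^sub>0 'k) set"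
  where
  "bilinear_relations V W =
     (let e = (\<lambda>v w c. Poly_Mapping.single (v, w) c) in
      {e (v \<oplus>\<^bsub>V\<^esub> v') w 1 - e v w 1 - e v' w 1 | v v' w.
         v \<in> carrier V \<and> v' \<in> carrier V \<and> w \<in> carrier W} \<union>
      {e v (w \<oplus>\<^bsub>W\<^esub> w') 1 - e v w 1 - e v w' 1 | v w w'.
         v \<in> carrier V \<and> w \<in> carrier W \<and> w' \<in> carrier W} \<union>
      {e (c \<odot>\<^bsub>V\<^esub> v) w 1 - e v w c | c v w. v \<in> carrier V \<and> w \<in> carrier W} \<union>
      {e v (c \<odot>\<^bsub>W\<^esub> w) 1 - e v w c | c v w. v \<in> carrier V \<and> w \<in> carrier W})"

definition bilinear_span ::
    "('k::field, 'v, 'm) module_scheme \<Rightarrow> ('k, 'w, 'n) module_scheme \<Rightarrow> ('v \<times> 'w \<Rightarrow>\<^sub>0 'k) set"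
  where
  "bilinear_span V W = lin_span (free_module (carrier V \<times> carrier W)) (bilinear_relations V W)"

definition tensor_product ::
    "('k::field, 'v, 'm) module_scheme \<Rightarrow> ('k, 'w, 'n) module_scheme
      \<Rightarrow> ('k, ('v \<times> 'w \<Rightarrow>\<^sub>0 'k) set) module" where
  "tensor_product V W = quot_alg (free_module (carrier V \<times> carrier W)) (bilinear_span V W)"

definition pure_tensor ::
    "('k::field, 'v, 'm) module_scheme \<Rightarrow> ('k, 'w, 'n) module_scheme
      \<Rightarrow> 'v \<Rightarrow> 'w \<Rightarrow> ('v \<times> 'w \<Rightarrow>\<^sub>0 'k) set" where
  "pure_tensor V W v w =
     bilinear_span V W +>\<^bsub>free_module (carrier V \<times> carrier W)\<^esub> Poly_Mapping.single (v, w) 1"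


section \<open>Tensor algebra\<close>

text \<open>
  Lists wrapped as an additively written monoid under concatenation, so that the monoid
  algebra structure on finitely supported functions applies.
\<close>

datatype 'v fmonoid = Word (letters: "'v list")

instantiation fmonoid :: (type) monoid_add
begin

definition zero_fmonoid :: "'a fmonoid" where
  "0 = Word []"

definition plus_fmonoid :: "'a fmonoid \<Rightarrow> 'a fmonoid \<Rightarrow> 'a fmonoid" where
  "u + v = Word (letters u @ letters v)"

instance
  by standard (simp_all add: zero_fmonoid_def plus_fmonoid_def)

end

definition free_algebra ::
    "('k::field, 'v, 'm) module_scheme \<Rightarrow> ('k, 'v fmonoid \<Rightarrow>\<^sub>0 'k) module" where
  "free_algebra V =
     \<lparr>carrier = {p. \<forall>w\<in>Poly_Mapping.keys p. set (letters w) \<subseteq> carrier V},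
      monoid.mult = (*), monoid.one = 1, ring.zero = 0, ring.add = (+), module.smult = (\<lambda>c. Poly_Mapping.map ((*) c))\<rparr>"

text \<open>
  The words of length \<open>n\<close> modulo multilinearity in the letters span the \<open>n\<close>-th tensor power
  of \<open>V\<close>. All relations are homogeneous in the length, so dividing out the span of all of
  them at once yields the direct sum of the tensor powers, with concatenation as product.
\<close>

definition multilinear_relations ::
    "('k::field, 'v, 'm) module_scheme \<Rightarrow> ('v fmonoid \<Rightarrow>\<^sub>0 'k) set" where
  "multilinear_relations V =
     (let e = (\<lambda>u x v c. Poly_Mapping.single (Word (u @ [x] @ v)) c) in
      {e u (x \<oplus>\<^bsub>V\<^esub> y) v 1 - e u x v 1 - e u y v 1 | u x y v.
         x \<in> carrier V \<and> y \<in> carrier V \<and> set u \<subseteq> carrier V \<and> set v \<subseteq> carrier V} \<union>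
      {e u (c \<odot>\<^bsub>V\<^esub> x) v 1 - e u x v c | c u x v.
         x \<in> carrier V \<and> set u \<subseteq> carrier V \<and> set v \<subseteq> carrier V})"

definition multilinear_span ::
    "('k::field, 'v, 'm) module_scheme \<Rightarrow> ('v fmonoid \<Rightarrow>\<^sub>0 'k) set" where
  "multilinear_span V = lin_span (free_algebra V) (multilinear_relations V)"

definition tensor_algebra ::
    "('k::field, 'v, 'm) module_scheme \<Rightarrow> ('k, ('v fmonoid \<Rightarrow>\<^sub>0 'k) set) module" where
  "tensor_algebra V = quot_alg (free_algebra V) (multilinear_span V)"

definition tensor_emb ::
    "('k::field, 'v, 'm) module_scheme \<Rightarrow> 'v \<Rightarrow> ('v fmonoid \<Rightarrow>\<^sub>0 'k) set" where
  "tensor_emb V x = multilinear_span V +>\<^bsub>free_algebra V\<^esub> Poly_Mapping.single (Word [x]) 1"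


section \<open>Superalgebras and Lie antialgebras\<close>

record ('k, 'a) superalgebra = "('k, 'a) module" +
  grade :: "bit \<Rightarrow> 'a set"

definition koszul_sign :: "bit \<Rightarrow> bit \<Rightarrow> 'k::field" where
  "koszul_sign i j = (if i * j = 1 then -1 else 1)"

locale superalgebra = module "ring_of_type_algebra :: 'k ring" A
  for A :: "('k::field, 'a, 'm) superalgebra_scheme" (structure) +
  assumes mult_closed: "\<lbrakk>x \<in> carrier A; y \<in> carrier A\<rbrakk> \<Longrightarrow> x \<otimes> y \<in> carrier A"
    and mult_add_left: "\<lbrakk>x \<in> carrier A; y \<in> carrier A; z \<in> carrier A\<rbrakk> \<Longrightarrow>
          (x \<oplus> y) \<otimes> z = x \<otimes> z \<oplus> y \<otimes> z"
    and mult_add_right: "\<lbrakk>x \<in> carrier A; y \<in> carrier A; z \<in> carrier A\<rbrakk> \<Longrightarrow>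
          z \<otimes> (x \<oplus> y) = z \<otimes> x \<oplus> z \<otimes> y"
    and mult_smult_left: "\<lbrakk>x \<in> carrier A; y \<in> carrier A\<rbrakk> \<Longrightarrow>
          (c \<odot> x) \<otimes> y = c \<odot> (x \<otimes> y)"
    and mult_smult_right: "\<lbrakk>x \<in> carrier A; y \<in> carrier A\<rbrakk> \<Longrightarrow>
          x \<otimes> (c \<odot> y) = c \<odot> (x \<otimes> y)"
    and grade_submodule: "submodule (grade A i) (ring_of_type_algebra :: 'k ring) A"
    and grade_sum: "x \<in> carrier A \<Longrightarrow> \<exists>x\<^sub>0\<in>grade A 0. \<exists>x\<^sub>1\<in>grade A 1. x = x\<^sub>0 \<oplus> x\<^sub>1"
    and grade_disjoint: "grade A 0 \<inter> grade A 1 = {\<zero>}"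
    and grade_mult: "\<lbrakk>x \<in> grade A i; y \<in> grade A j\<rbrakk> \<Longrightarrow> x \<otimes> y \<in> grade A (i + j)"

locale supercommutative_superalgebra = superalgebra +
  assumes supercommute: "\<lbrakk>x \<in> grade A i; y \<in> grade A j\<rbrakk> \<Longrightarrow>
    x \<otimes> y = koszul_sign i j \<odot> (y \<otimes> x)"

locale lie_antialgebra = supercommutative_superalgebra +
  assumes LA0: "\<lbrakk>x\<^sub>1 \<in> grade A 0; x\<^sub>2 \<in> grade A 0; x\<^sub>3 \<in> grade A 0\<rbrakk> \<Longrightarrow>
          x\<^sub>1 \<otimes> (x\<^sub>2 \<otimes> x\<^sub>3) = (x\<^sub>1 \<otimes> x\<^sub>2) \<otimes> x\<^sub>3"
    and LA1: "\<lbrakk>x\<^sub>1 \<in> grade A 0; x\<^sub>2 \<in> grade A 0; y \<in> grade A 1\<rbrakk> \<Longrightarrow>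
          x\<^sub>1 \<otimes> (x\<^sub>2 \<otimes> y) = (1/2) \<odot> ((x\<^sub>1 \<otimes> x\<^sub>2) \<otimes> y)"
    and LA2: "\<lbrakk>x \<in> grade A 0; y\<^sub>1 \<in> grade A 1; y\<^sub>2 \<in> grade A 1\<rbrakk> \<Longrightarrow>
          x \<otimes> (y\<^sub>1 \<otimes> y\<^sub>2) = (x \<otimes> y\<^sub>1) \<otimes> y\<^sub>2 \<oplus> y\<^sub>1 \<otimes> (x \<otimes> y\<^sub>2)"
    and LA3: "\<lbrakk>y\<^sub>1 \<in> grade A 1; y\<^sub>2 \<in> grade A 1; y\<^sub>3 \<in> grade A 1\<rbrakk> \<Longrightarrow>
          y\<^sub>1 \<otimes> (y\<^sub>2 \<otimes> y\<^sub>3) \<oplus> y\<^sub>2 \<otimes> (y\<^sub>3 \<otimes> y\<^sub>1) \<oplus> y\<^sub>3 \<otimes> (y\<^sub>1 \<otimes> y\<^sub>2) = \<zero>"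


section \<open>Enveloping algebras\<close>

definition antialgebra_relations ::
    "('k::field, 'a, 'm) superalgebra_scheme \<Rightarrow> ('a fmonoid \<Rightarrow>\<^sub>0 'k) set set" where
  "antialgebra_relations A =
     (let T = tensor_algebra A; \<iota> = tensor_emb A in
      {(1/2) \<odot>\<^bsub>T\<^esub> (\<iota> a \<otimes>\<^bsub>T\<^esub> \<iota> b \<ominus>\<^bsub>T\<^esub> \<iota> b \<otimes>\<^bsub>T\<^esub> \<iota> a) \<ominus>\<^bsub>T\<^esub> \<iota> (a \<otimes>\<^bsub>A\<^esub> b) | a b.
         a \<in> grade A 1 \<and> b \<in> grade A 1} \<union>
      {(1/2) \<odot>\<^bsub>T\<^esub> (\<iota> a \<otimes>\<^bsub>T\<^esub> \<iota> x \<oplus>\<^bsub>T\<^esub> \<iota> x \<otimes>\<^bsub>T\<^esub> \<iota> a) \<ominus>\<^bsub>T\<^esub> \<iota> (a \<otimes>\<^bsub>A\<^esub> x) | a x.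
         a \<in> grade A 1 \<and> x \<in> grade A 0} \<union>
      {\<iota> x \<otimes>\<^bsub>T\<^esub> \<iota> y \<ominus>\<^bsub>T\<^esub> \<iota> (x \<otimes>\<^bsub>A\<^esub> y) | x y. x \<in> grade A 0 \<and> y \<in> grade A 0})"

definition antialgebra_enveloping ::
    "('k::field, 'a, 'm) superalgebra_scheme
      \<Rightarrow> ('k, ('a fmonoid \<Rightarrow>\<^sub>0 'k) set set) module" where
  "antialgebra_enveloping A =
     quot_alg (tensor_algebra A) (genideal (tensor_algebra A) (antialgebra_relations A))"

text \<open>For a Lie superalgebra \<open>G\<close>, the product of the record is the bracket.\<close>

definition lie_relations ::
    "('k::field, 'a, 'm) superalgebra_scheme \<Rightarrow> ('a fmonoid \<Rightarrow>\<^sub>0 'k) set set" where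
  "lie_relations G =
     (let T = tensor_algebra G; \<iota> = tensor_emb G in
      {(1/2) \<odot>\<^bsub>T\<^esub> (\<iota> x \<otimes>\<^bsub>T\<^esub> \<iota> y \<ominus>\<^bsub>T\<^esub> koszul_sign i j \<odot>\<^bsub>T\<^esub> (\<iota> y \<otimes>\<^bsub>T\<^esub> \<iota> x))
         \<ominus>\<^bsub>T\<^esub> \<iota> (x \<otimes>\<^bsub>G\<^esub> y) | x y i j. x \<in> grade G i \<and> y \<in> grade G j})"

definition lie_enveloping ::
    "('k::field, 'a, 'm) superalgebra_scheme
      \<Rightarrow> ('k, ('a fmonoid \<Rightarrow>\<^sub>0 'k) set set) module" where
  "lie_enveloping G =
     quot_alg (tensor_algebra G) (genideal (tensor_algebra G) (lie_relations G))"


section \<open>The adjoint Lie superalgebra\<close>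

definition odd_part ::
    "('k, 'a, 'm) superalgebra_scheme \<Rightarrow> ('k, 'a, 'm) superalgebra_scheme" where
  "odd_part A = A\<lparr>carrier := grade A 1\<rparr>"

definition odd_square ::
    "('k::field, 'a, 'm) superalgebra_scheme \<Rightarrow> ('k, ('a \<times> 'a \<Rightarrow>\<^sub>0 'k) set) module" where
  "odd_square A = tensor_product (odd_part A) (odd_part A)"

definition adjoint_relations ::
    "('k::field, 'a, 'm) superalgebra_scheme \<Rightarrow> ('a \<times> 'a \<Rightarrow>\<^sub>0 'k) set set" where
  "adjoint_relations A =
     (let t = pure_tensor (odd_part A) (odd_part A) in
      {t a b \<ominus>\<^bsub>odd_square A\<^esub> t b a | a b. a \<in> grade A 1 \<and> b \<in> grade A 1} \<union>
      {t (a \<otimes>\<^bsub>A\<^esub> x) b \<ominus>\<^bsub>odd_square A\<^esub> t a (b \<otimes>\<^bsub>A\<^esub> x) | a b x.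
         a \<in> grade A 1 \<and> b \<in> grade A 1 \<and> x \<in> grade A 0})"

definition adjoint_span ::
    "('k::field, 'a, 'm) superalgebra_scheme \<Rightarrow> ('a \<times> 'a \<Rightarrow>\<^sub>0 'k) set set" where
  "adjoint_span A = lin_span (odd_square A) (adjoint_relations A)"

definition adjoint_even ::
    "('k::field, 'a, 'm) superalgebra_scheme
      \<Rightarrow> ('k, ('a \<times> 'a \<Rightarrow>\<^sub>0 'k) set set) module" where
  "adjoint_even A = quot_alg (odd_square A) (adjoint_span A)"

definition odot ::
    "('k::field, 'a, 'm) superalgebra_scheme
      \<Rightarrow> 'a \<Rightarrow> 'a \<Rightarrow> ('a \<times> 'a \<Rightarrow>\<^sub>0 'k) set set" where
  "odot A a b = adjoint_span A +>\<^bsub>odd_square A\<^esub> pure_tensor (odd_part A) (odd_part A) a b"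

text \<open>
  An element \<open>\<alpha>\<close> of the even part is a coset of cosets, and \<open>\<Union>\<alpha>\<close> consists of the formal
  combinations \<open>p\<close> of pairs \<open>(a, b)\<close> that represent it, i.e. for which \<open>\<alpha>\<close> is the
  corresponding combination of the classes \<^term>\<open>odot A a b\<close>. The brackets below are the
  (bi)linear extensions of the formulas on these classes; for a Lie antialgebra, the axioms
  imply that the values do not depend on the representative chosen here.
\<close>

definition adjoint_rep :: "('a \<times> 'a \<Rightarrow>\<^sub>0 'k::zero) set set \<Rightarrow> ('a \<times> 'a \<Rightarrow>\<^sub>0 'k)" where
  "adjoint_rep \<alpha> = (SOME p. p \<in> \<Union>\<alpha>)"

definition bracket_even_odd ::
    "('k::field, 'a, 'm) superalgebra_scheme
      \<Rightarrow> ('a \<times> 'a \<Rightarrow>\<^sub>0 'k) set set \<Rightarrow> 'a \<Rightarrow> 'a" where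
  "bracket_even_odd A \<alpha> c =
     lin_ext A (\<lambda>(a, b). a \<otimes>\<^bsub>A\<^esub> (b \<otimes>\<^bsub>A\<^esub> c) \<oplus>\<^bsub>A\<^esub> b \<otimes>\<^bsub>A\<^esub> (a \<otimes>\<^bsub>A\<^esub> c)) (adjoint_rep \<alpha>)"

definition bracket_even_even ::
    "('k::field, 'a, 'm) superalgebra_scheme
      \<Rightarrow> ('a \<times> 'a \<Rightarrow>\<^sub>0 'k) set set \<Rightarrow> ('a \<times> 'a \<Rightarrow>\<^sub>0 'k) set set
      \<Rightarrow> ('a \<times> 'a \<Rightarrow>\<^sub>0 'k) set set" where
  "bracket_even_even A \<alpha> \<beta> =
     (let E = adjoint_even A in
      lin_ext E (\<lambda>(a, b).
        lin_ext E (\<lambda>(c, d).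
            2 \<odot>\<^bsub>E\<^esub> odot A (a \<otimes>\<^bsub>A\<^esub> (b \<otimes>\<^bsub>A\<^esub> c)) d
              \<oplus>\<^bsub>E\<^esub> 2 \<odot>\<^bsub>E\<^esub> odot A (b \<otimes>\<^bsub>A\<^esub> (a \<otimes>\<^bsub>A\<^esub> d)) c)
          (adjoint_rep \<beta>))
        (adjoint_rep \<alpha>))"

text \<open>The pair \<open>(\<alpha>, a)\<close> is the sum of the even element \<open>\<alpha>\<close> and the odd element \<open>a\<close>.\<close>

definition adjoint ::
    "('k::field, 'a, 'm) superalgebra_scheme
      \<Rightarrow> ('k, ('a \<times> 'a \<Rightarrow>\<^sub>0 'k) set set \<times> 'a) superalgebra" where
  "adjoint A =
     (let E = adjoint_even A in
      \<lparr>carrier = carrier E \<times> grade A 1,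
       monoid.mult = (\<lambda>(\<alpha>, a) (\<beta>, b).
         (bracket_even_even A \<alpha> \<beta> \<oplus>\<^bsub>E\<^esub> odot A a b,
          bracket_even_odd A \<alpha> b \<ominus>\<^bsub>A\<^esub> bracket_even_odd A \<beta> a)),
       monoid.one = undefined,
       ring.zero = (\<zero>\<^bsub>E\<^esub>, \<zero>\<^bsub>A\<^esub>),
       ring.add = (\<lambda>(\<alpha>, a) (\<beta>, b). (\<alpha> \<oplus>\<^bsub>E\<^esub> \<beta>, a \<oplus>\<^bsub>A\<^esub> b)),
       module.smult = (\<lambda>c (\<alpha>, a). (c \<odot>\<^bsub>E\<^esub> \<alpha>, c \<odot>\<^bsub>A\<^esub> a)),
       grade = (\<lambda>i. if i = 0 then carrier E \<times> {\<zero>\<^bsub>A\<^esub>} else {\<zero>\<^bsub>E\<^esub>} \<times> grade A 1)\<rparr>)"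

end

theory Submission
  imports Defs
begin

text \<open>
  In the enveloping algebra of a Lie antialgebra the commutator of two odd elements
  \<open>a, b\<close> is, up to the factor \<open>1/2\<close>, their product, while the anticommutator is not constrained.
  Sending \<open>a\<close> to itself and \<open>a \<odot> b\<close> to half the anticommutator of \<open>a\<close> and \<open>b\<close> is compatible with
  the defining relations of the adjoint Lie superalgebra: the balancing relation says that
  an even element commutes with the even element \<open>ab\<close>, the bracket of an even and an odd element
  is the identity \<open>[{a, b}, c] = {a, [b, c]} + {b, [a, c]}\<close>, and the bracket of two even elements
  follows since \<open>[{a, b}, _]\<close> is a derivation, using (LA3) to bring it into the stated form.
  The resulting homomorphism of enveloping algebras hits all odd elements, hence also their
  commutators, which span the even part; so it is surjective, and the ideal is its kernel.
\<close>

section \<open>Vector spaces and associative algebras\<close>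

text \<open>The image of \<open>odot A a b\<close> is forced: the relation for two odd elements
  equates this class with half of ab + ba. Each product taken in A and each such class thus costs
  one factor 1/2. The noncommutative identities are therefore proved in a plain ring with both sides
  multiplied by 2 or 4, and the factor is cancelled afterwards, which is where 2 must be invertible.
  The obstacle is that the brackets with an even argument are defined through a chosen
  representative \<open>adjoint_rep\<close>. Their independence of the choice is not established by
  itself. Instead, the lift g of the half-anticommutator to the even part is shown to be computable
  as a linear extension at the very same representative. The image of a bracket then becomes a
  half-commutator involving g of its even arguments, and the representative has disappeared. Only
  images under g and under the canonical map of the antialgebra ever have to be compared.\<close>

lemma ring_of_type_algebra_simps [simp]:
  "carrier (ring_of_type_algebra :: 'k::field ring) = UNIV"
  "x \<otimes>\<^bsub>(ring_of_type_algebra :: 'k ring)\<^esub> y = x * y"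
  "x \<oplus>\<^bsub>(ring_of_type_algebra :: 'k ring)\<^esub> y = x + y"
  "\<one>\<^bsub>(ring_of_type_algebra :: 'k ring)\<^esub> = 1"
  "\<zero>\<^bsub>(ring_of_type_algebra :: 'k ring)\<^esub> = 0"
  by (simp_all add: ring_of_type_algebra_def)

text \<open>The module laws are restated below with the operations of the type class, so that
  scalars obey the field arithmetic of the type rather than that of a record.\<close>

locale kspace = module "ring_of_type_algebra :: 'k ring" M
  for M :: "('k::field, 'a, 'm) module_scheme" (structure)
begin

lemma sm_closed [simp, intro]: "x \<in> carrier M \<Longrightarrow> c \<odot> x \<in> carrier M"
  using smult_closed by simp

lemma sm_add_left: "x \<in> carrier M \<Longrightarrow> (a + b) \<odot> x = a \<odot> x \<oplus> b \<odot> x"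
  using smult_l_distr[of a b x] by simp

lemma sm_add_right: "x \<in> carrier M \<Longrightarrow> y \<in> carrier M \<Longrightarrow> a \<odot> (x \<oplus> y) = a \<odot> x \<oplus> a \<odot> y"
  using smult_r_distr[of a x y] by simp

lemma sm_assoc: "x \<in> carrier M \<Longrightarrow> a \<odot> (b \<odot> x) = (a * b) \<odot> x"
  using smult_assoc1[of a b x] by simp

lemma sm_one [simp]: "x \<in> carrier M \<Longrightarrow> 1 \<odot> x = x"
  using smult_one[of x] by simp

lemma sm_zero_left [simp]: "x \<in> carrier M \<Longrightarrow> 0 \<odot> x = \<zero>"
  using smult_l_null[of x] by simp

lemma sm_zero_right [simp]: "c \<odot> \<zero> = \<zero>"
  using smult_r_null[of c] by simp

lemma sm_minus_right: "x \<in> carrier M \<Longrightarrow> c \<odot> (\<ominus> x) = \<ominus> (c \<odot> x)"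
  using smult_r_minus[of c x] by simp

lemma sm_neg_one: "x \<in> carrier M \<Longrightarrow> (- 1) \<odot> x = \<ominus> x"
  using sm_add_left[of x "-1" 1] by (simp add: M.minus_equality)

lemma sm_diff_right:
  "x \<in> carrier M \<Longrightarrow> y \<in> carrier M \<Longrightarrow> c \<odot> (x \<ominus> y) = c \<odot> x \<ominus> c \<odot> y"
  by (simp add: M.minus_eq sm_add_right sm_minus_right)

lemma diff_eq_zero:
  assumes "x \<in> carrier M" "y \<in> carrier M" "x \<ominus> y = \<zero>"
  shows "x = y"
  using M.minus_equality[of x "\<ominus> y"] assms by (simp add: M.minus_eq)

text \<open>Linear maps turn the additivity relations of tensor products and tensor algebras into
  this shape.\<close>

lemma add_diff_diff:
  assumes "x \<in> carrier M" "y \<in> carrier M"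
  shows "x \<oplus> y \<ominus> x \<ominus> y = \<zero>"
proof -
  have "x \<oplus> y \<ominus> x = y"
    using assms by (simp add: M.minus_eq M.a_comm[of x y] M.a_assoc M.r_neg)
  then show ?thesis using assms by (simp add: M.minus_eq M.r_neg)
qed

lemma double: "x \<in> carrier M \<Longrightarrow> x \<oplus> x = 2 \<odot> x"
  using sm_add_left[of x 1 1] by simp

lemma half_double:
  "(2::'k) \<noteq> 0 \<Longrightarrow> x \<in> carrier M \<Longrightarrow> (1/2) \<odot> x \<oplus> (1/2) \<odot> x = x"
  by (simp add: double sm_assoc)

text \<open>The ring identities further down are stated with sums x + x, so that no scalars occur in
  them; this lemma removes the doubling.\<close>

lemma double_cancel:
  assumes "(2::'k) \<noteq> 0" "x \<in> carrier M" "y \<in> carrier M" "x \<oplus> x = y \<oplus> y"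
  shows "x = y"
proof -
  have "(1/2) \<odot> (2 \<odot> x) = (1/2) \<odot> (2 \<odot> y)"
    using assms by (simp add: double)
  then show ?thesis using assms by (simp add: sm_assoc)
qed

lemma submoduleI':
  assumes "H \<subseteq> carrier M" "\<zero> \<in> H" "\<And>x y. x \<in> H \<Longrightarrow> y \<in> H \<Longrightarrow> x \<oplus> y \<in> H"
    "\<And>c x. x \<in> H \<Longrightarrow> c \<odot> x \<in> H"
  shows "submodule H (ring_of_type_algebra :: 'k ring) M"
proof (rule submoduleI)
  fix a assume "a \<in> H"
  then show "\<ominus> a \<in> H"
    using assms(4)[of a "-1"] assms(1) by (simp add: sm_neg_one subset_iff)
qed (use assms in auto)

end

lemma kspaceI:
  fixes M :: "('k::field, 'a, 'm) module_scheme" (structure)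
  assumes "abelian_group M"
    and "\<And>c x. x \<in> carrier M \<Longrightarrow> c \<odot> x \<in> carrier M"
    and "\<And>a b x. x \<in> carrier M \<Longrightarrow> (a + b) \<odot> x = a \<odot> x \<oplus> b \<odot> x"
    and "\<And>a x y. x \<in> carrier M \<Longrightarrow> y \<in> carrier M \<Longrightarrow> a \<odot> (x \<oplus> y) = a \<odot> x \<oplus> a \<odot> y"
    and "\<And>a b x. x \<in> carrier M \<Longrightarrow> a \<odot> (b \<odot> x) = (a * b) \<odot> x"
    and "\<And>x. x \<in> carrier M \<Longrightarrow> 1 \<odot> x = x"
  shows "kspace M"
  unfolding kspace_def
  by (rule moduleI) (use assms in \<open>auto intro: cring_from_type_algebra\<close>)

locale assoc_alg = kspace M + ring M
  for M :: "('k::field, 'a, 'm) module_scheme" (structure) +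
  assumes sm_mult_left: "x \<in> carrier M \<Longrightarrow> y \<in> carrier M \<Longrightarrow> (c \<odot> x) \<otimes> y = c \<odot> (x \<otimes> y)"
    and sm_mult_right: "x \<in> carrier M \<Longrightarrow> y \<in> carrier M \<Longrightarrow> x \<otimes> (c \<odot> y) = c \<odot> (x \<otimes> y)"
begin

lemma ideal_submodule:
  assumes "ideal I M"
  shows "submodule I (ring_of_type_algebra :: 'k ring) M"
proof (rule submoduleI')
  interpret I: ideal I M by fact
  show "I \<subseteq> carrier M" by (rule I.a_subset)
  fix c x assume x: "x \<in> I"
  \<comment> \<open>Scaling by c is multiplication by the ring element c times one, which an ideal
    absorbs.\<close>
  then have "(c \<odot> \<one>) \<otimes> x \<in> I" by (intro I.I_l_closed) auto
  then show "c \<odot> x \<in> I" using x by (simp add: sm_mult_left)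
qed (use assms in \<open>auto simp: additive_subgroup.zero_closed additive_subgroup.a_closed ideal.axioms(1)\<close>)

end

definition linmap :: "('k, 'a, 'm) module_scheme \<Rightarrow> ('k, 'b, 'n) module_scheme \<Rightarrow> ('a \<Rightarrow> 'b) set" where
  "linmap M N = {f \<in> carrier M \<rightarrow> carrier N.
     (\<forall>x\<in>carrier M. \<forall>y\<in>carrier M. f (x \<oplus>\<^bsub>M\<^esub> y) = f x \<oplus>\<^bsub>N\<^esub> f y) \<and>
     (\<forall>c. \<forall>x\<in>carrier M. f (c \<odot>\<^bsub>M\<^esub> x) = c \<odot>\<^bsub>N\<^esub> f x)}"

lemma linmapI:
  assumes "\<And>x. x \<in> carrier M \<Longrightarrow> f x \<in> carrier N"
    and "\<And>x y. x \<in> carrier M \<Longrightarrow> y \<in> carrier M \<Longrightarrow> f (x \<oplus>\<^bsub>M\<^esub> y) = f x \<oplus>\<^bsub>N\<^esub> f y"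
    and "\<And>c x. x \<in> carrier M \<Longrightarrow> f (c \<odot>\<^bsub>M\<^esub> x) = c \<odot>\<^bsub>N\<^esub> f x"
  shows "f \<in> linmap M N"
  using assms by (auto simp: linmap_def)

lemma linmapD:
  assumes "f \<in> linmap M N"
  shows "x \<in> carrier M \<Longrightarrow> f x \<in> carrier N"
    and "x \<in> carrier M \<Longrightarrow> y \<in> carrier M \<Longrightarrow> f (x \<oplus>\<^bsub>M\<^esub> y) = f x \<oplus>\<^bsub>N\<^esub> f y"
    and "x \<in> carrier M \<Longrightarrow> f (c \<odot>\<^bsub>M\<^esub> x) = c \<odot>\<^bsub>N\<^esub> f x"
  using assms by (auto simp: linmap_def)

lemma linmap_comp: "f \<in> linmap L M \<Longrightarrow> g \<in> linmap M N \<Longrightarrow> (\<lambda>x. g (f x)) \<in> linmap L N"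
  by (rule linmapI) (simp_all add: linmapD[of f L M] linmapD[of g M N])

lemma linmap_zero:
  assumes "kspace M" "kspace N" "f \<in> linmap M N"
  shows "f \<zero>\<^bsub>M\<^esub> = \<zero>\<^bsub>N\<^esub>"
proof -
  interpret M: kspace M by fact
  interpret N: kspace N by fact
  have "f (0 \<odot>\<^bsub>M\<^esub> \<zero>\<^bsub>M\<^esub>) = 0 \<odot>\<^bsub>N\<^esub> f \<zero>\<^bsub>M\<^esub>"
    by (rule linmapD(3)[OF assms(3)]) simp
  then show ?thesis using linmapD(1)[OF assms(3), of "\<zero>\<^bsub>M\<^esub>"] by simp
qed

lemma linmap_minus:
  assumes "kspace M" "kspace N" "f \<in> linmap M N" "x \<in> carrier M" "y \<in> carrier M"
  shows "f (x \<ominus>\<^bsub>M\<^esub> y) = f x \<ominus>\<^bsub>N\<^esub> f y"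
proof -
  interpret M: kspace M by fact
  interpret N: kspace N by fact
  have "f (x \<oplus>\<^bsub>M\<^esub> (-1) \<odot>\<^bsub>M\<^esub> y) = f x \<oplus>\<^bsub>N\<^esub> (-1) \<odot>\<^bsub>N\<^esub> f y"
    using assms(4,5) by (simp add: linmapD[OF assms(3)])
  then show ?thesis using assms
    by (simp add: M.sm_neg_one N.sm_neg_one linmapD[OF assms(3)] M.M.minus_eq N.M.minus_eq)
qed

lemma linmap_kernel_submodule:
  assumes "kspace M" "kspace N" "f \<in> linmap M N"
  shows "submodule {x \<in> carrier M. f x
      = \<zero>\<^bsub>N\<^esub>} (ring_of_type_algebra :: 'k::field ring) (M :: ('k, 'a, 'm) module_scheme)"
proof -
  interpret M: kspace M by fact
  interpret N: kspace N by fact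
  show ?thesis
    by (rule M.submoduleI') (auto simp: linmapD[OF assms(3)] linmap_zero[OF assms])
qed

section \<open>Quotients\<close>

lemma quot_alg_simps:
  "carrier (quot_alg M N) = A_RCOSETS M N"
  "\<zero>\<^bsub>quot_alg M N\<^esub> = N"
  "\<one>\<^bsub>quot_alg M N\<^esub> = (N +>\<^bsub>M\<^esub> \<one>\<^bsub>M\<^esub>)"
  "C \<oplus>\<^bsub>quot_alg M N\<^esub> D = set_add M C D"
  "C \<otimes>\<^bsub>quot_alg M N\<^esub> D = rcoset_mult M N C D"
  "c \<odot>\<^bsub>quot_alg M N\<^esub> C = (\<Union>x\<in>C. N +>\<^bsub>M\<^esub> (c \<odot>\<^bsub>M\<^esub> x))"
  by (simp_all add: quot_alg_def ring.extend_def module.fields_def FactRing_def)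

locale kquot = kspace M
  for M :: "('k::field, 'a, 'm) module_scheme" (structure) +
  fixes N :: "'a set"
  assumes N_submodule: "submodule N (ring_of_type_algebra :: 'k ring) M"

sublocale kquot \<subseteq> abelian_subgroup N M
  by (rule abelian_subgroupI3[OF _ M.abelian_group_axioms])
     (use N_submodule submodule.axioms(1) in \<open>auto intro: additive_subgroupI\<close>)

context kquot
begin

abbreviation "Q \<equiv> quot_alg M N"

lemma N_smult: "x \<in> N \<Longrightarrow> c \<odot> x \<in> N"
  using submoduleE(4)[OF N_submodule] by simp

lemma mem_coset_iff:
  "x \<in> carrier M \<Longrightarrow> y \<in> carrier M \<Longrightarrow> y \<in> N +> x \<longleftrightarrow> y \<ominus> x \<in> N"
  using a_rcos_module[of x y] by (simp add: M.minus_eq)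

lemma coset_eq_iff:
  assumes "x \<in> carrier M" "y \<in> carrier M"
  shows "N +> x = N +> y \<longleftrightarrow> x \<ominus> y \<in> N"
  using mem_coset_iff[OF assms(2,1)] a_repr_independence'[of x y] a_rcos_self[OF assms(1)] assms
  by auto

lemma quot_carrier: "carrier Q = {N +> x | x. x \<in> carrier M}"
  by (auto simp: quot_alg_simps A_RCOSETS_def')

lemma coset_closed [simp]: "x \<in> carrier M \<Longrightarrow> N +> x \<in> carrier Q"
  by (auto simp: quot_carrier)

lemma coset_add: "x \<in> carrier M \<Longrightarrow> y \<in> carrier M \<Longrightarrow> (N +> x) \<oplus>\<^bsub>Q\<^esub> (N +> y) = N +> (x \<oplus> y)"
  by (simp add: quot_alg_simps a_rcos_sum)

text \<open>The scalar action of \<open>quot_alg\<close> is a union over all members of the coset.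
  Scaling preserves N, so every member contributes the same coset and the union collapses.\<close>

lemma coset_smult:
  assumes "x \<in> carrier M"
  shows "c \<odot>\<^bsub>Q\<^esub> (N +> x) = N +> (c \<odot> x)"
proof -
  have "N +> (c \<odot> y) = N +> (c \<odot> x)" if y: "y \<in> N +> x" for y
  proof -
    have yc: "y \<in> carrier M" using a_elemrcos_carrier[OF assms y] .
    have "y \<ominus> x \<in> N" using y mem_coset_iff[OF assms yc] by simp
    then have "c \<odot> (y \<ominus> x) \<in> N" by (rule N_smult)
    then show ?thesis using yc assms by (simp add: coset_eq_iff sm_diff_right)
  qed
  then have "(\<Union>y\<in>N +> x. N +> (c \<odot> y)) = N +> (c \<odot> x)"
    using a_rcos_self[OF assms] by (intro SUP_eq_const) blast+
  then show ?thesis by (simp add: quot_alg_simps)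
qed

lemma coset_linmap: "(+>) N \<in> linmap M Q"
  by (rule linmapI) (simp_all add: coset_add coset_smult)

lemma quot_zero: "\<zero>\<^bsub>Q\<^esub> = N +> \<zero>"
  using a_coset_add_zero[OF a_subset] by (simp add: quot_alg_simps)

lemma quot_abelian_group: "abelian_group Q"
proof (rule abelian_groupI)
  fix C assume "C \<in> carrier Q"
  then obtain x where x: "x \<in> carrier M" "C = N +> x" by (auto simp: quot_carrier)
  then show "\<exists>D\<in>carrier Q. D \<oplus>\<^bsub>Q\<^esub> C = \<zero>\<^bsub>Q\<^esub>"
    by (intro bexI[of _ "N +> \<ominus> x"]) (simp_all add: quot_zero coset_add M.l_neg)
qed (auto simp: quot_carrier quot_zero coset_add M.a_ac)

lemma quot_kspace: "kspace Q"
  by (rule kspaceI[OF quot_abelian_group])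
     (auto simp: quot_carrier coset_add coset_smult sm_add_left sm_add_right sm_assoc)

text \<open>Needed for representatives picked by choice: whichever member was picked, it determines
  its coset.\<close>

lemma coset_rep:
  assumes "C \<in> carrier Q" "x \<in> C"
  shows "x \<in> carrier M" "C = N +> x"
proof -
  obtain y where y: "y \<in> carrier M" "C = N +> y" using assms by (auto simp: quot_carrier)
  show "x \<in> carrier M" using y assms a_elemrcos_carrier[OF y(1)] by simp
  show "C = N +> x" using y assms a_repr_independence'[OF _ y(1)] by simp
qed

lemma quot_nonempty: "C \<in> carrier Q \<Longrightarrow> C \<noteq> {}"
  using a_rcos_self by (auto simp: quot_carrier)

text \<open>The induced map evaluates f at a chosen member of the coset; two members differ by an
  element of N, where f vanishes.\<close>

lemma quot_lift:
  assumes "kspace B" "f \<in> linmap M B" "\<And>x. x \<in> N \<Longrightarrow> f x = \<zero>\<^bsub>B\<^esub>"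
  shows "\<exists>g\<in>linmap Q B. \<forall>x\<in>carrier M. g (N +> x) = f x"
proof
  interpret B: kspace B by fact
  define g where "g C = f (SOME x. x \<in> C)" for C
  have g: "g (N +> x) = f x" if x: "x \<in> carrier M" for x
  proof -
    define y where "y = (SOME y. y \<in> N +> x)"
    have "y \<in> N +> x" unfolding y_def using a_rcos_self[OF x] by (rule someI)
    then have y: "y \<in> carrier M" "y \<ominus> x \<in> N"
      using a_elemrcos_carrier[OF x] mem_coset_iff[OF x] by auto
    then have "f y \<ominus>\<^bsub>B\<^esub> f x = \<zero>\<^bsub>B\<^esub>"
      using linmap_minus[OF kspace_axioms assms(1,2) y(1) x] assms(3) by simp
    then have "f y = f x"
      by (rule B.diff_eq_zero[OF linmapD(1)[OF assms(2) y(1)] linmapD(1)[OF assms(2) x]])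
    then show ?thesis by (simp add: g_def y_def)
  qed
  then show "\<forall>x\<in>carrier M. g (N +> x) = f x" by blast
  show "g \<in> linmap Q B"
  proof (rule linmapI)
    fix C c assume "C \<in> carrier Q"
    then obtain x where x: "x \<in> carrier M" "C = N +> x" by (auto simp: quot_carrier)
    show "g C \<in> carrier B" using x linmapD(1)[OF assms(2) x(1)] by (simp add: g)
    show "g (c \<odot>\<^bsub>Q\<^esub> C) = c \<odot>\<^bsub>B\<^esub> g C"
      using x linmapD(3)[OF assms(2) x(1)] by (simp add: g coset_smult)
    fix D assume "D \<in> carrier Q"
    then obtain y where y: "y \<in> carrier M" "D = N +> y" by (auto simp: quot_carrier)
    show "g (C \<oplus>\<^bsub>Q\<^esub> D) = g C \<oplus>\<^bsub>B\<^esub> g D"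
      using x y linmapD(2)[OF assms(2) x(1) y(1)] by (simp add: g coset_add)
  qed
qed

end

section \<open>Algebra homomorphisms, kernels and the first isomorphism theorem\<close>

definition alg_hom ::
    "('k, 'a, 'm) module_scheme \<Rightarrow> ('k, 'b, 'n) module_scheme \<Rightarrow> ('a \<Rightarrow> 'b) set" where
  "alg_hom A B = {h \<in> ring_hom A B. \<forall>c. \<forall>x\<in>carrier A. h (c \<odot>\<^bsub>A\<^esub> x) = c \<odot>\<^bsub>B\<^esub> h x}"

lemma alg_hom_linmap: "h \<in> alg_hom A B \<Longrightarrow> h \<in> linmap A B"
  by (rule linmapI) (auto simp: alg_hom_def ring_hom_def)

lemma alg_homD:
  assumes "h \<in> alg_hom A B"
  shows "x \<in> carrier A \<Longrightarrow> y \<in> carrier A \<Longrightarrow> h (x \<otimes>\<^bsub>A\<^esub> y) = h x \<otimes>\<^bsub>B\<^esub> h y"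
    and "h \<one>\<^bsub>A\<^esub> = \<one>\<^bsub>B\<^esub>"
  using assms by (auto simp: alg_hom_def ring_hom_def)

lemma alg_homI:
  assumes "h \<in> linmap A B" "h \<one>\<^bsub>A\<^esub> = \<one>\<^bsub>B\<^esub>"
    and "\<And>x y. x \<in> carrier A \<Longrightarrow> y \<in> carrier A \<Longrightarrow> h (x \<otimes>\<^bsub>A\<^esub> y) = h x \<otimes>\<^bsub>B\<^esub> h y"
  shows "h \<in> alg_hom A B"
  using assms(2,3) linmapD[OF assms(1)] by (auto simp: alg_hom_def intro!: ring_hom_memI)

lemma alg_hom_kernel:
  assumes "assoc_alg A" "assoc_alg B" "h \<in> alg_hom A B"
  shows "ideal {x \<in> carrier A. h x = \<zero>\<^bsub>B\<^esub>} A"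
proof -
  interpret ring_hom_ring A B h
    using assoc_alg.axioms(2)[OF assms(1)] assoc_alg.axioms(2)[OF assms(2)]
  proof (rule ring_hom_ringI2)
    show "h \<in> ring_hom A B" using assms(3) by (simp add: alg_hom_def)
  qed
  have "a_kernel A B h = {x \<in> carrier A. h x = \<zero>\<^bsub>B\<^esub>}"
    unfolding a_kernel_def' ..
  then show ?thesis using kernel_is_ideal by metis
qed

text \<open>The kernel is an ideal, and the generated ideal is the smallest one containing S; so
  only generators have to be checked.\<close>

lemma alg_hom_genideal_zero:
  assumes "assoc_alg A" "assoc_alg B" "h \<in> alg_hom A B"
    and "S \<subseteq> carrier A" "\<And>x. x \<in> S \<Longrightarrow> h x = \<zero>\<^bsub>B\<^esub>" "x \<in> genideal A S"
  shows "h x = \<zero>\<^bsub>B\<^esub>"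
proof -
  interpret A: assoc_alg A by fact
  have "genideal A S \<subseteq> {x \<in> carrier A. h x = \<zero>\<^bsub>B\<^esub>}"
    by (rule A.genideal_minimal[OF alg_hom_kernel[OF assms(1-3)]]) (use assms(4,5) in auto)
  then show ?thesis using assms(6) by auto
qed

locale aquot = assoc_alg M + I: ideal N M
  for M :: "('k::field, 'a, 'm) module_scheme" (structure) and N

sublocale aquot \<subseteq> kquot M N
  by (intro kquot.intro kspace_axioms kquot_axioms.intro ideal_submodule I.ideal_axioms)

context aquot
begin

lemma coset_mult: "x \<in> carrier M \<Longrightarrow> y \<in> carrier M \<Longrightarrow> (N +> x) \<otimes>\<^bsub>Q\<^esub> (N +> y) = N +> (x \<otimes> y)"
  by (simp add: quot_alg_simps I.rcoset_mult_add)

lemma quot_one: "\<one>\<^bsub>Q\<^esub> = N +> \<one>"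
  by (simp add: quot_alg_simps)

lemma quot_assoc_alg: "assoc_alg Q"
proof (intro assoc_alg.intro quot_kspace assoc_alg_axioms.intro)
  show "ring Q"
  proof (rule ringI[OF quot_abelian_group])
    show "Group.monoid Q"
      by (rule monoidI) (auto simp: quot_carrier coset_mult quot_one m_assoc)
  qed (auto simp: quot_carrier coset_mult coset_add l_distr r_distr)
qed (auto simp: quot_carrier coset_mult coset_smult sm_mult_left sm_mult_right)

lemma coset_alg_hom: "(+>) N \<in> alg_hom M Q"
  by (rule alg_homI[OF coset_linmap]) (simp_all add: coset_mult quot_one)

lemma alg_quot_lift:
  assumes "assoc_alg B" "f \<in> alg_hom M B" "\<And>x. x \<in> N \<Longrightarrow> f x = \<zero>\<^bsub>B\<^esub>"
  shows "\<exists>g\<in>alg_hom Q B. \<forall>x\<in>carrier M. g (N +> x) = f x"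
proof -
  interpret B: assoc_alg B by fact
  obtain g where g: "g \<in> linmap Q B" "\<And>x. x \<in> carrier M \<Longrightarrow> g (N +> x) = f x"
    using quot_lift[OF B.kspace_axioms alg_hom_linmap[OF assms(2)] assms(3)] by blast
  have "g \<in> alg_hom Q B"
    by (rule alg_homI[OF g(1)])
       (auto simp: quot_one quot_carrier coset_mult g(2) alg_homD[OF assms(2)])
  then show ?thesis using g(2) by blast
qed

end

text \<open>Here I is the kernel. The isomorphism is wanted from B to the quotient, so the induced
  bijection from the quotient to B is inverted.\<close>

lemma alg_first_isomorphism:
  assumes "assoc_alg A" "assoc_alg B" "f \<in> alg_hom A B" "f ` carrier A = carrier B"
  shows "\<exists>I. ideal I A \<and> (\<exists>h. h \<in> alg_iso B (quot_alg A I))"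
proof -
  interpret A: assoc_alg A by fact
  interpret B: assoc_alg B by fact
  define I where "I = {x \<in> carrier A. f x = \<zero>\<^bsub>B\<^esub>}"
  have I: "ideal I A" unfolding I_def by (rule alg_hom_kernel[OF assms(1-3)])
  interpret aquot A I by (intro aquot.intro assms(1) I)
  have f: "f \<in> linmap A B" using assms(3) by (rule alg_hom_linmap)
  have z: "f x = \<zero>\<^bsub>B\<^esub>" if "x \<in> I" for x using that unfolding I_def by blast
  obtain g where g: "g \<in> alg_hom Q B" "\<And>x. x \<in> carrier A \<Longrightarrow> g (I +>\<^bsub>A\<^esub> x) = f x"
    using alg_quot_lift[OF assms(2,3) z] by blast
  have "inj_on g (carrier Q)"
  proof (rule inj_onI)
    fix C D assume CD: "C \<in> carrier Q" "D \<in> carrier Q" "g C = g D"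
    from CD(1) obtain x where x: "x \<in> carrier A" "C = I +>\<^bsub>A\<^esub> x" unfolding quot_carrier by blast
    from CD(2) obtain y where y: "y \<in> carrier A" "D = I +>\<^bsub>A\<^esub> y" unfolding quot_carrier by blast
    have fxy: "f x = f y" using CD(3) unfolding x(2) y(2) g(2)[OF x(1)] g(2)[OF y(1)] .
    have "f (x \<ominus>\<^bsub>A\<^esub> y) = f y \<oplus>\<^bsub>B\<^esub> \<ominus>\<^bsub>B\<^esub> f y"
      using linmap_minus[OF A.kspace_axioms B.kspace_axioms f x(1) y(1)]
      unfolding fxy B.M.minus_eq .
    also have "\<dots> = \<zero>\<^bsub>B\<^esub>" by (rule B.M.r_neg[OF linmapD(1)[OF f y(1)]])
    finally have "f (x \<ominus>\<^bsub>A\<^esub> y) = \<zero>\<^bsub>B\<^esub>" .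
    moreover have "x \<ominus>\<^bsub>A\<^esub> y \<in> carrier A" using x(1) y(1) by (rule A.M.minus_closed)
    ultimately have "x \<ominus>\<^bsub>A\<^esub> y \<in> I" unfolding I_def by blast
    then show "C = D" using coset_eq_iff[OF x(1) y(1)] x(2) y(2) by blast
  qed
  moreover have "g ` carrier Q = carrier B"
    unfolding assms(4)[symmetric] quot_carrier Setcompr_eq_image image_image
    by (rule image_cong[OF refl g(2)])
  ultimately have bij: "bij_betw g (carrier Q) (carrier B)" by (rule bij_betw_imageI)
  have Q: "ring Q" by (rule assoc_alg.axioms(2)[OF quot_assoc_alg])
  have "g \<in> ring_iso Q B" using g(1) bij by (simp only: ring_iso_def alg_hom_def mem_Collect_eq)
  then have iso: "inv_into (carrier Q) g \<in> ring_iso B Q" by (rule ring_iso_set_sym[OF Q])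
  \<comment> \<open>\<open>ring_iso\<close> does not speak about scalars, so their compatibility has
    to be carried to the inverse separately.\<close>
  have "inv_into (carrier Q) g (c \<odot>\<^bsub>B\<^esub> y) = c \<odot>\<^bsub>Q\<^esub> inv_into (carrier Q) g y" if "y \<in> carrier B" for c y
  proof -
    have "y \<in> g ` carrier Q" using that unfolding bij_betw_imp_surj_on[OF bij] .
    then obtain C where C: "C \<in> carrier Q" "y = g C" by blast
    have c: "c \<odot>\<^bsub>Q\<^esub> C \<in> carrier Q" by (rule kspace.sm_closed[OF quot_kspace C(1)])
    have "c \<odot>\<^bsub>B\<^esub> y = g (c \<odot>\<^bsub>Q\<^esub> C)"
      unfolding C(2) by (rule linmapD(3)[OF alg_hom_linmap[OF g(1)] C(1), symmetric])
    then show ?thesis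
      unfolding C(2) by (simp only: bij_betw_inv_into_left[OF bij c] bij_betw_inv_into_left[OF bij C(1)])
  qed
  then have "inv_into (carrier Q) g \<in> alg_iso B Q"
    using iso by (simp only: alg_iso_def mem_Collect_eq) simp
  with I show ?thesis by (intro exI[of _ I] conjI exI)
qed

text \<open>Together with \<open>alg_hom_image_mult\<close> this makes the image a subalgebra;
  surjectivity can then be tested on generators.\<close>

lemma alg_hom_image_submodule:
  assumes "assoc_alg C" "assoc_alg B" "h \<in> alg_hom C B"
  shows "submodule (h ` carrier C) (ring_of_type_algebra :: 'k::field ring) (B :: ('k, 'b, 'n) module_scheme)"
proof -
  interpret C: assoc_alg C by fact
  interpret B: assoc_alg B by fact
  note l = alg_hom_linmap[OF assms(3)]
  show ?thesis
  proof (rule B.submoduleI')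
    show "h ` carrier C \<subseteq> carrier B" using linmapD(1)[OF l] by blast
    show "\<zero>\<^bsub>B\<^esub> \<in> h ` carrier C"
      using linmap_zero[OF C.kspace_axioms B.kspace_axioms l] C.M.zero_closed by force
    show "p \<oplus>\<^bsub>B\<^esub> q \<in> h ` carrier C" if p: "p \<in> h ` carrier C" and q: "q \<in> h ` carrier C" for p q
    proof -
      obtain x y where "x \<in> carrier C" "y \<in> carrier C" "p = h x" "q = h y" using p q by blast
      then show ?thesis using linmapD(2)[OF l, of x y] C.M.a_closed[of x y] by (metis imageI)
    qed
    show "c \<odot>\<^bsub>B\<^esub> p \<in> h ` carrier C" if p: "p \<in> h ` carrier C" for c p
    proof -
      obtain x where "x \<in> carrier C" "p = h x" using p by blast
      then show ?thesis using linmapD(3)[OF l, of x c] C.sm_closed[of x c] by (metis imageI)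
    qed
  qed
qed

lemma alg_hom_image_mult:
  assumes "assoc_alg C" "h \<in> alg_hom C B" "p \<in> h ` carrier C" "q \<in> h ` carrier C"
  shows "p \<otimes>\<^bsub>B\<^esub> q \<in> h ` carrier C"
proof -
  interpret C: assoc_alg C by fact
  obtain x y where "x \<in> carrier C" "y \<in> carrier C" "p = h x" "q = h y" using assms(3,4) by blast
  then show ?thesis using alg_homD(1)[OF assms(2), of x y] C.m_closed[of x y] by (metis imageI)
qed

section \<open>Spans and linear extensions\<close>

lemma lin_span_incl: "S \<subseteq> lin_span M S"
  by (auto simp: lin_span_def)

lemma lin_span_minimal:
  "submodule H (ring_of_type_algebra :: 'k::field ring) M \<Longrightarrow> S \<subseteq> H \<Longrightarrow> lin_span M S \<subseteq> H"
  by (auto simp: lin_span_def)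

lemma submodule_zero: "submodule H R M \<Longrightarrow> \<zero>\<^bsub>M\<^esub> \<in> H"
  using subgroup.one_closed[OF submodule.axioms(1)] by fastforce

text \<open>Since S lies in the carrier, the carrier is one of the submodules intersected, which
  keeps the span inside it.\<close>

lemma (in kspace) lin_span_submodule:
  assumes "S \<subseteq> carrier M"
  shows "submodule (lin_span M S) (ring_of_type_algebra :: 'k ring) M"
proof (rule submoduleI')
  show "lin_span M S \<subseteq> carrier M"
    using lin_span_minimal[OF carrier_is_submodule assms] .
  show "\<zero> \<in> lin_span M S"
    by (auto simp: lin_span_def dest: submodule_zero)
qed (auto simp: lin_span_def submoduleE submodule.smult_closed)

lemma linmap_lin_span_zero:
  assumes "kspace M" "kspace N" "f \<in> linmap M N" "S \<subseteq> carrier M"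
    and "\<And>x. x \<in> S \<Longrightarrow> f x = \<zero>\<^bsub>N\<^esub>" "x \<in> lin_span M S"
  shows "f x = \<zero>\<^bsub>N\<^esub>"
  using lin_span_minimal[OF linmap_kernel_submodule[OF assms(1-3)], of S] assms(4-6) by auto

lemma lookup_scale [simp]:
  "Poly_Mapping.lookup (Poly_Mapping.map ((*) (c::'k::field)) p) k = c * Poly_Mapping.lookup p k"
  by (simp add: map.rep_eq when_def)

lemma keys_scale: "Poly_Mapping.keys (Poly_Mapping.map ((*) (c::'k::field)) p) \<subseteq> Poly_Mapping.keys p"
  by (auto simp: in_keys_iff)

lemma scale_poly_mapping:
  fixes c :: "'k::field"
  shows "Poly_Mapping.map ((*) (c + d)) p = Poly_Mapping.map ((*) c) p + Poly_Mapping.map ((*) d) p"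
    and "Poly_Mapping.map ((*) c) (p + q) = Poly_Mapping.map ((*) c) p + Poly_Mapping.map ((*) c) q"
    and "Poly_Mapping.map ((*) c) (Poly_Mapping.map ((*) d) p) = Poly_Mapping.map ((*) (c * d)) p"
    and "Poly_Mapping.map ((*) 1) p = p"
    and "Poly_Mapping.map ((*) c) (Poly_Mapping.single k d) = Poly_Mapping.single k (c * d)"
  by (auto intro!: poly_mapping_eqI simp: lookup_add algebra_simps lookup_single when_def)

text \<open>Reduces linear statements to single terms while all supports stay in S. The term added
  may share its key with p, so no freshness has to be tracked.\<close>

lemma poly_mapping_induct_on [consumes 1, case_names zero add]:
  fixes p :: "'x \<Rightarrow>\<^sub>0 'k::field"
  assumes "Poly_Mapping.keys p \<subseteq> S" and zero: "P 0"
    and add: "\<And>k c p. k \<in> S \<Longrightarrow> Poly_Mapping.keys p \<subseteq> S \<Longrightarrow> P p \<Longrightarrow> P (Poly_Mapping.single k c + p)"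
  shows "P p"
proof -
  \<comment> \<open>Induction on a superset F of the support: cancelling the coefficient at one
    point yields a q supported on the smaller set.\<close>
  have "P p" if "finite F" "Poly_Mapping.keys p \<subseteq> F" "F \<subseteq> S" for F
    using that
  proof (induction F arbitrary: p rule: finite_induct)
    case empty
    then show ?case using zero by (simp add: keys_eq_empty)
  next
    case (insert k F)
    define q where "q = p - Poly_Mapping.single k (Poly_Mapping.lookup p k)"
    have "Poly_Mapping.keys q \<subseteq> F"
      using insert.prems by (auto simp: q_def in_keys_iff lookup_minus lookup_single when_def split: if_splits)
    then have "P q" "Poly_Mapping.keys q \<subseteq> S" using insert by auto
    moreover have "p = Poly_Mapping.single k (Poly_Mapping.lookup p k) + q" by (simp add: q_def)
    ultimately show ?case using add insert.prems by (metis insert_subset)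
  qed
  from this[OF finite_keys subset_refl assms(1)] show ?thesis .
qed

context kspace
begin

text \<open>\<open>lin_ext\<close> sums over the support, which changes under addition and scaling.
  Indices outside the support contribute zero, so sums with different supports can be compared over
  a common finite set.\<close>

lemma lin_ext_superset:
  assumes "finite F" "Poly_Mapping.keys p \<subseteq> F" "f \<in> F \<rightarrow> carrier M"
  shows "lin_ext M f p = (\<Oplus>x\<in>F. Poly_Mapping.lookup p x \<odot> f x)"
  unfolding lin_ext_def
  by (rule M.add.finprod_mono_neutral_cong_left) (use assms in \<open>auto simp: in_keys_iff Pi_iff\<close>)

lemma lin_ext_closed: "f \<in> Poly_Mapping.keys p \<rightarrow> carrier M \<Longrightarrow> lin_ext M f p \<in> carrier M"
  unfolding lin_ext_def by (rule M.finsum_closed) auto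

lemma lin_ext_zero [simp]: "lin_ext M f 0 = \<zero>"
  by (simp add: lin_ext_def)

lemma lin_ext_single: "f k \<in> carrier M \<Longrightarrow> lin_ext M f (Poly_Mapping.single k c) = c \<odot> f k"
  using lin_ext_superset[of "{k}" "Poly_Mapping.single k c" f] by simp

lemma lin_ext_add:
  assumes "Poly_Mapping.keys p \<subseteq> S" "Poly_Mapping.keys q \<subseteq> S" "f \<in> S \<rightarrow> carrier M"
  shows "lin_ext M f (p + q) = lin_ext M f p \<oplus> lin_ext M f q"
proof -
  let ?F = "Poly_Mapping.keys p \<union> Poly_Mapping.keys q"
  have f: "f \<in> ?F \<rightarrow> carrier M" using assms by auto
  have "lin_ext M f (p + q) = (\<Oplus>x\<in>?F. Poly_Mapping.lookup p x \<odot> f x \<oplus> Poly_Mapping.lookup q x \<odot> f x)"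
  proof (subst lin_ext_superset[of ?F])
    show "(\<Oplus>x\<in>?F. Poly_Mapping.lookup (p + q) x \<odot> f x) =
        (\<Oplus>x\<in>?F. Poly_Mapping.lookup p x \<odot> f x \<oplus> Poly_Mapping.lookup q x \<odot> f x)"
      by (rule M.finsum_cong') (use f in \<open>auto simp: lookup_add sm_add_left Pi_iff\<close>)
  qed (use f keys_add[of p q] in auto)
  also have "\<dots> = lin_ext M f p \<oplus> lin_ext M f q"
    using f by (subst (1 2) lin_ext_superset[of ?F]) (auto simp: Pi_iff intro!: M.finsum_addf)
  finally show ?thesis .
qed

lemma lin_ext_smult:
  assumes "f \<in> Poly_Mapping.keys p \<rightarrow> carrier M"
  shows "lin_ext M f (Poly_Mapping.map ((*) c) p) = c \<odot> lin_ext M f p"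
proof -
  have "lin_ext M f (Poly_Mapping.map ((*) c) p)
      = (\<Oplus>x\<in>Poly_Mapping.keys p. c \<odot> (Poly_Mapping.lookup p x \<odot> f x))"
    using assms keys_scale[of c p]
    by (subst lin_ext_superset[of "Poly_Mapping.keys p"])
       (auto simp: sm_assoc Pi_iff intro!: M.finsum_cong')
  also have "\<dots> = c \<odot> lin_ext M f p"
    unfolding lin_ext_def using assms by (subst finsum_smult_ldistr) auto
  finally show ?thesis .
qed

lemma lin_ext_cong:
  assumes "\<And>x. x \<in> Poly_Mapping.keys p \<Longrightarrow> f x = g x" "g \<in> Poly_Mapping.keys p \<rightarrow> carrier M"
  shows "lin_ext M f p = lin_ext M g p"
  unfolding lin_ext_def using assms by (intro M.finsum_cong') auto

lemma lin_ext_in_submodule: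
  assumes "submodule H (ring_of_type_algebra :: 'k ring) M" "f \<in> Poly_Mapping.keys p \<rightarrow> H"
  shows "lin_ext M f p \<in> H"
proof -
  note H = submoduleE[OF assms(1)]
  have z: "\<zero> \<in> H" using assms(1) by (rule submodule_zero)
  have "Poly_Mapping.keys p \<subseteq> {x. f x \<in> H}" using assms(2) by auto
  then show ?thesis
  proof (induction p rule: poly_mapping_induct_on)
    case zero then show ?case using z by simp
  next
    case (add k c p)
    have fc: "f \<in> {x. f x \<in> H} \<rightarrow> carrier M" using H(1) by auto
    have "lin_ext M f (Poly_Mapping.single k c + p) = c \<odot> f k \<oplus> lin_ext M f p"
      using lin_ext_add[OF _ add(2) fc, of "Poly_Mapping.single k c"] add(1) H(1)
      by (auto simp: lin_ext_single)
    then show ?case using add H(4)[of c "f k"] H(5) by simp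
  qed
qed

end

text \<open>Moves linear maps in and out of the brackets, which are themselves linear extensions
  from pairs.\<close>

lemma linmap_lin_ext:
  assumes "kspace M" "kspace N" "T \<in> linmap M N" "f \<in> Poly_Mapping.keys p \<rightarrow> carrier M"
  shows "T (lin_ext M f p) = lin_ext N (\<lambda>x. T (f x)) p"
proof -
  interpret M: kspace M by fact
  interpret N: kspace N by fact
  let ?S = "{x. f x \<in> carrier M}"
  have f: "f \<in> ?S \<rightarrow> carrier M" "(\<lambda>x. T (f x)) \<in> ?S \<rightarrow> carrier N"
    using linmapD(1)[OF assms(3)] by auto
  have "Poly_Mapping.keys p \<subseteq> ?S" using assms(4) by auto
  then show ?thesis
  proof (induction p rule: poly_mapping_induct_on)
    case zero then show ?case by (simp add: linmap_zero[OF assms(1-3)])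
  next
    case (add k c p)
    have k: "f k \<in> carrier M" "T (f k) \<in> carrier N" "Poly_Mapping.keys (Poly_Mapping.single k c) \<subseteq> ?S"
      using add(1) f by auto
    have p: "lin_ext M f p \<in> carrier M" using add(2) by (intro M.lin_ext_closed) auto
    show ?case
      using k p add(3) by (simp add: M.lin_ext_add[OF k(3) add(2) f(1)] N.lin_ext_add[OF k(3) add(2) f(2)]
        M.lin_ext_single N.lin_ext_single linmapD[OF assms(3)])
  qed
qed

section \<open>Free modules and free algebras\<close>

text \<open>Shared by free modules, with pairs as basis, and free algebras, with words as basis, so
  that linear extension is treated once for both.\<close>

locale finsupp_space =
  fixes M :: "('k::field, 'x \<Rightarrow>\<^sub>0 'k, 'm) module_scheme" (structure) and B :: "'x set"
  assumes fs_carrier: "carrier M = {p. Poly_Mapping.keys p \<subseteq> B}"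
    and fs_zero: "\<zero> = 0"
    and fs_add: "p \<oplus> q = p + q"
    and fs_smult: "c \<odot> p = Poly_Mapping.map ((*) c) p"

sublocale finsupp_space \<subseteq> kspace M
proof (rule kspaceI)
  show "abelian_group M"
  proof (rule abelian_groupI)
    fix p assume "p \<in> carrier M"
    then show "\<exists>q\<in>carrier M. q \<oplus> p = \<zero>"
      by (intro bexI[of _ "- p"]) (simp_all add: fs_carrier fs_zero fs_add)
  next
    fix p q assume "p \<in> carrier M" "q \<in> carrier M"
    then show "p \<oplus> q \<in> carrier M"
      using keys_add[of p q] by (auto simp: fs_carrier fs_add)
  qed (simp_all add: fs_carrier fs_zero fs_add ac_simps)
  fix c p assume "p \<in> carrier M"
  then show "c \<odot> p \<in> carrier M"
    using keys_scale[of c p] by (auto simp: fs_carrier fs_smult)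
qed (simp_all only: fs_add fs_smult scale_poly_mapping)

context finsupp_space
begin

lemma single_closed: "k \<in> B \<Longrightarrow> Poly_Mapping.single k c \<in> carrier M"
  by (simp add: fs_carrier)

lemma fs_minus:
  assumes "p \<in> carrier M" "q \<in> carrier M"
  shows "p \<ominus> q = p - q"
proof -
  have "\<ominus> q = - q"
    using M.minus_equality[of "- q" q] assms by (simp add: fs_carrier fs_add fs_zero)
  then show ?thesis by (simp add: M.minus_eq fs_add)
qed

lemma diff_closed: "p \<in> carrier M \<Longrightarrow> q \<in> carrier M \<Longrightarrow> p - q \<in> carrier M"
  using fs_minus M.minus_closed by metis

lemma lin_ext_linmap:
  assumes "kspace N" "f \<in> B \<rightarrow> carrier N"
  shows "lin_ext N f \<in> linmap M N"
proof -
  interpret N: kspace N by fact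
  show ?thesis
  proof (rule linmapI)
    fix p assume p: "p \<in> carrier M"
    then have f: "f \<in> Poly_Mapping.keys p \<rightarrow> carrier N" using assms(2) by (auto simp: fs_carrier)
    show "lin_ext N f p \<in> carrier N" using f by (rule N.lin_ext_closed)
    show "lin_ext N f (c \<odot> p) = c \<odot>\<^bsub>N\<^esub> lin_ext N f p" for c
      using N.lin_ext_smult[OF f] by (simp add: fs_smult)
    fix q assume q: "q \<in> carrier M"
    show "lin_ext N f (p \<oplus> q) = lin_ext N f p \<oplus>\<^bsub>N\<^esub> lin_ext N f q"
      using N.lin_ext_add[OF _ _ assms(2)] p q by (simp add: fs_carrier fs_add)
  qed
qed

lemma lin_ext_diff:
  assumes "kspace N" "f \<in> B \<rightarrow> carrier N" "p \<in> carrier M" "q \<in> carrier M"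
  shows "lin_ext N f (p - q) = lin_ext N f p \<ominus>\<^bsub>N\<^esub> lin_ext N f q"
  using linmap_minus[OF kspace_axioms assms(1) lin_ext_linmap[OF assms(1,2)] assms(3,4)]
  by (simp only: fs_minus[OF assms(3,4)])

end

lemma free_module_finsupp: "finsupp_space (free_module B) B"
  by standard (simp_all add: free_module_def)

lemma free_algebra_finsupp: "finsupp_space (free_algebra V) {w. set (letters w) \<subseteq> carrier V}"
  by standard (auto simp: free_algebra_def)

text \<open>For words, 0 is the empty word and this monomial is the scalar c. Scaling by c is left
  multiplication by it, so its centrality lets scalars pass through products of noncommuting
  words.\<close>

lemma single_zero_central:
  fixes c :: "'k::field" and p :: "'x::monoid_add \<Rightarrow>\<^sub>0 'k"
  shows "p * Poly_Mapping.single 0 c = Poly_Mapping.single 0 c * p"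
proof -
  have "Poly_Mapping.keys p \<subseteq> UNIV" by simp
  then show ?thesis
    by (induction p rule: poly_mapping_induct_on)
       (simp_all add: distrib_left distrib_right mult_single mult.commute)
qed

lemma fmonoid_simps [simp]:
  "letters (u + v) = letters u @ letters v" "letters 0 = []"
  by (simp_all add: plus_fmonoid_def zero_fmonoid_def)

lemma free_algebra_simps:
  "p \<otimes>\<^bsub>free_algebra V\<^esub> q = p * q" "\<one>\<^bsub>free_algebra V\<^esub> = 1"
  by (simp_all add: free_algebra_def)

lemma free_algebra_assoc_alg: "assoc_alg (free_algebra V)"
proof -
  interpret finsupp_space "free_algebra V" "{w. set (letters w) \<subseteq> carrier V}"
    by (rule free_algebra_finsupp)
  have mult: "p * q \<in> carrier (free_algebra V)"
    if "p \<in> carrier (free_algebra V)" "q \<in> carrier (free_algebra V)" for p q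
    using that keys_mult[of p q] by (fastforce simp: fs_carrier)
  show ?thesis
  proof (intro assoc_alg.intro assoc_alg_axioms.intro kspace_axioms ringI M.abelian_group_axioms monoidI)
    show "\<one>\<^bsub>free_algebra V\<^esub> \<in> carrier (free_algebra V)"
      by (simp add: fs_carrier free_algebra_simps)
  qed (simp_all add: free_algebra_simps mult fs_add fs_smult mult.assoc distrib_left distrib_right
         mult_map_scale_conv_mult, metis mult.assoc single_zero_central)
qed

section \<open>Tensor algebras\<close>

locale tensor_alg = kspace V for V :: "('k::field, 'v, 'm) module_scheme" (structure)
begin

abbreviation "FA \<equiv> free_algebra V"
abbreviation "W \<equiv> {w. set (letters w) \<subseteq> carrier V}"
abbreviation "TA \<equiv> tensor_algebra V"
abbreviation "\<iota> \<equiv> tensor_emb V"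

sublocale F: finsupp_space FA W
  by (rule free_algebra_finsupp)

sublocale F: assoc_alg FA
  by (rule free_algebra_assoc_alg)

abbreviation sg :: "'v list \<Rightarrow> 'k \<Rightarrow> 'v fmonoid \<Rightarrow>\<^sub>0 'k" where
  "sg u c \<equiv> Poly_Mapping.single (Word u) c"

lemma sg_closed: "set u \<subseteq> carrier V \<Longrightarrow> sg u c \<in> carrier FA"
  by (rule F.single_closed) simp

lemma sg_mult: "sg u c * sg v d = sg (u @ v) (c * d)"
  by (simp add: mult_single plus_fmonoid_def)

lemma multilinear_relations_cases:
  assumes "r \<in> multilinear_relations V"
  obtains (add) u x y v where "x \<in> carrier V" "y \<in> carrier V" "set u \<subseteq> carrier V" "set v \<subseteq> carrier V"
      "r = sg (u @ [x \<oplus> y] @ v) 1 - sg (u @ [x] @ v) 1 - sg (u @ [y] @ v) 1"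
    | (smult) c u x v where "x \<in> carrier V" "set u \<subseteq> carrier V" "set v \<subseteq> carrier V"
      "r = sg (u @ [c \<odot> x] @ v) 1 - sg (u @ [x] @ v) c"
  using assms unfolding multilinear_relations_def Let_def by blast

lemma multilinear_relations_add:
  "x \<in> carrier V \<Longrightarrow> y \<in> carrier V \<Longrightarrow> set u \<subseteq> carrier V \<Longrightarrow> set v \<subseteq> carrier V \<Longrightarrow>
    sg (u @ [x \<oplus> y] @ v) 1 - sg (u @ [x] @ v) 1 - sg (u @ [y] @ v) 1 \<in> multilinear_relations V"
  unfolding multilinear_relations_def Let_def by blast

lemma multilinear_relations_smult:
  "x \<in> carrier V \<Longrightarrow> set u \<subseteq> carrier V \<Longrightarrow> set v \<subseteq> carrier V \<Longrightarrow>
    sg (u @ [c \<odot> x] @ v) 1 - sg (u @ [x] @ v) c \<in> multilinear_relations V"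
  unfolding multilinear_relations_def Let_def by blast

lemma multilinear_relations_closed: "multilinear_relations V \<subseteq> carrier FA"
proof
  fix r assume "r \<in> multilinear_relations V"
  then show "r \<in> carrier FA"
    by (cases rule: multilinear_relations_cases) (simp_all add: F.diff_closed sg_closed)
qed

text \<open>The word is absorbed into the context, in front of u or behind v, so the result is again
  one of the relations.\<close>

lemma multilinear_relations_mult:
  assumes "r \<in> multilinear_relations V" "set w \<subseteq> carrier V"
  shows "sg w 1 * r \<in> multilinear_relations V" "r * sg w 1 \<in> multilinear_relations V"
proof -
  from assms(1) have "sg w 1 * r \<in> multilinear_relations V \<and> r * sg w 1 \<in> multilinear_relations V"
  proof (cases rule: multilinear_relations_cases)
    case (add u x y v)
    then show ?thesis
      using multilinear_relations_add[of x y "w @ u" v] multilinear_relations_add[of x y u "v @ w"] assms(2)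
      by (simp add: right_diff_distrib left_diff_distrib sg_mult)
  next
    case (smult c u x v)
    then show ?thesis
      using multilinear_relations_smult[of x "w @ u" v c] multilinear_relations_smult[of x u "v @ w" c] assms(2)
      by (simp add: right_diff_distrib left_diff_distrib sg_mult)
  qed
  then show "sg w 1 * r \<in> multilinear_relations V" "r * sg w 1 \<in> multilinear_relations V" by auto
qed

lemma multilinear_span_submodule:
  "submodule (multilinear_span V) (ring_of_type_algebra :: 'k ring) FA"
  unfolding multilinear_span_def
  by (rule F.lin_span_submodule[OF multilinear_relations_closed])

lemmas mspan = F.submoduleE[OF multilinear_span_submodule, simplified]

text \<open>The elements whose products with w on both sides lie in the span form a subspace, and
  this subspace contains the relations.\<close>

lemma multilinear_span_mult_word:
  assumes "p \<in> multilinear_span V" "set w \<subseteq> carrier V"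
  shows "sg w 1 * p \<in> multilinear_span V" "p * sg w 1 \<in> multilinear_span V"
proof -
  let ?H = "{p \<in> carrier FA. sg w 1 * p \<in> multilinear_span V \<and> p * sg w 1 \<in> multilinear_span V}"
  have "submodule ?H (ring_of_type_algebra :: 'k ring) FA"
  proof (rule F.submoduleI')
    show "\<zero>\<^bsub>FA\<^esub> \<in> ?H"
      using submodule_zero[OF multilinear_span_submodule] F.M.zero_closed by (simp add: F.fs_zero)
    fix p q assume "p \<in> ?H" "q \<in> ?H"
    then show "p \<oplus>\<^bsub>FA\<^esub> q \<in> ?H"
      using mspan(5) F.M.a_closed[of p q] by (simp add: F.fs_add distrib_left distrib_right)
  next
    fix c p assume "p \<in> ?H"
    then show "c \<odot>\<^bsub>FA\<^esub> p \<in> ?H"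
      using mspan(4)[of _ c] F.sm_closed[of p c] F.sm_mult_left[of p "sg w 1" c] F.sm_mult_right[of "sg w 1" p c]
        sg_closed[OF assms(2)] by (simp add: free_algebra_simps)
  qed auto
  moreover have "multilinear_relations V \<subseteq> ?H"
    using multilinear_relations_closed multilinear_relations_mult[OF _ assms(2)]
      lin_span_incl[of "multilinear_relations V" FA] by (auto simp: multilinear_span_def)
  ultimately have "multilinear_span V \<subseteq> ?H"
    unfolding multilinear_span_def by (rule lin_span_minimal)
  then show "sg w 1 * p \<in> multilinear_span V" "p * sg w 1 \<in> multilinear_span V"
    using assms(1) by auto
qed

text \<open>The span is only a linear span by definition, whereas the product on the quotient
  requires an ideal. Closure under multiplication by words suffices, as every element is a
  combination of words.\<close>

lemma multilinear_span_ideal: "ideal (multilinear_span V) FA"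
proof (rule idealI)
  show "ring FA" by (rule assoc_alg.axioms(2)[OF free_algebra_assoc_alg])
  show "subgroup (multilinear_span V) (add_monoid FA)"
    by (rule submodule.axioms(1)[OF multilinear_span_submodule])
  fix p q assume p: "p \<in> multilinear_span V" and q: "q \<in> carrier FA"
  have z: "0 \<in> multilinear_span V"
    using submodule_zero[OF multilinear_span_submodule] by (simp add: F.fs_zero)
  have "Poly_Mapping.keys q \<subseteq> W" using q by (simp add: F.fs_carrier)
  then have "q * p \<in> multilinear_span V \<and> p * q \<in> multilinear_span V"
  proof (induction q rule: poly_mapping_induct_on)
    case zero then show ?case using z by simp
  next
    case (add k c q)
    obtain w where w: "k = Word w" by (cases k)
    have wV: "set w \<subseteq> carrier V" using add(1) w by simp
    have "Poly_Mapping.single k c * p = c \<odot>\<^bsub>FA\<^esub> (sg w 1 * p)"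
      by (simp add: w F.fs_smult mult_map_scale_conv_mult mult.assoc[symmetric] mult_single)
    moreover have "p * Poly_Mapping.single k c = c \<odot>\<^bsub>FA\<^esub> (p * sg w 1)"
      by (simp add: w F.fs_smult mult_map_scale_conv_mult mult.assoc[symmetric]
          single_zero_central[symmetric]) (simp add: mult.assoc mult_single)
    ultimately show ?case
      using add(3) mspan(4)[of _ c] mspan(5) multilinear_span_mult_word[OF p wV]
      by (simp add: distrib_left distrib_right F.fs_add)
  qed
  then show "q \<otimes>\<^bsub>FA\<^esub> p \<in> multilinear_span V" "p \<otimes>\<^bsub>FA\<^esub> q \<in> multilinear_span V"
    by (simp_all add: free_algebra_simps)
qed

sublocale T: aquot FA "multilinear_span V"
  by (rule aquot.intro[OF free_algebra_assoc_alg multilinear_span_ideal])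

abbreviation cs where "cs p \<equiv> multilinear_span V +>\<^bsub>FA\<^esub> p"

lemma tensor_assoc_alg: "assoc_alg TA"
  unfolding tensor_algebra_def by (rule T.quot_assoc_alg)

text \<open>Linearity is given by the multilinear relations with empty context, that is, with u and
  v both \<open>[]\<close>.\<close>

lemma tensor_emb_linmap: "\<iota> \<in> linmap V TA"
proof (rule linmapI)
  fix x c assume x: "x \<in> carrier V"
  have sx: "sg [z] d \<in> carrier FA" if "z \<in> carrier V" for z d using that by (simp add: sg_closed)
  show "\<iota> x \<in> carrier TA"
    using T.coset_closed[OF sx[OF x]] by (simp add: tensor_emb_def tensor_algebra_def)
  have "cs (sg [c \<odot> x] 1) = cs (c \<odot>\<^bsub>FA\<^esub> sg [x] 1)"
    using multilinear_relations_smult[OF x, of "[]" "[]" c] lin_span_incl[of "multilinear_relations V" FA] x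
    by (subst T.coset_eq_iff) (auto simp: sx F.fs_minus F.fs_smult scale_poly_mapping multilinear_span_def)
  then show "\<iota> (c \<odot> x) = c \<odot>\<^bsub>TA\<^esub> \<iota> x"
    using T.coset_smult[OF sx[OF x]] by (simp add: tensor_emb_def tensor_algebra_def)
  fix y assume y: "y \<in> carrier V"
  have sxy: "sg [x] 1 + sg [y] 1 \<in> carrier FA"
    using F.M.a_closed[OF sx[OF x] sx[OF y]] by (simp add: F.fs_add)
  have "cs (sg [x \<oplus> y] 1) = cs (sg [x] 1 \<oplus>\<^bsub>FA\<^esub> sg [y] 1)"
    using multilinear_relations_add[OF x y, of "[]" "[]"] lin_span_incl[of "multilinear_relations V" FA] x y
    by (subst T.coset_eq_iff) (auto simp: sx sxy F.fs_minus F.fs_add multilinear_span_def diff_diff_add)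
  then show "\<iota> (x \<oplus> y) = \<iota> x \<oplus>\<^bsub>TA\<^esub> \<iota> y"
    using T.coset_add[OF sx[OF x] sx[OF y]] by (simp add: tensor_emb_def tensor_algebra_def)
qed

text \<open>Expresses that V generates its tensor algebra: a word is the product of its letters. It
  carries the surjectivity argument from generators to the whole enveloping algebra.\<close>

lemma tensor_algebra_induct [consumes 1, case_names one emb add smult mult]:
  assumes "t \<in> carrier TA" and one: "P \<one>\<^bsub>TA\<^esub>" and emb: "\<And>x. x \<in> carrier V \<Longrightarrow> P (\<iota> x)"
    and add: "\<And>s t. s \<in> carrier TA \<Longrightarrow> t \<in> carrier TA \<Longrightarrow> P s \<Longrightarrow> P t \<Longrightarrow> P (s \<oplus>\<^bsub>TA\<^esub> t)"
    and smult: "\<And>c t. t \<in> carrier TA \<Longrightarrow> P t \<Longrightarrow> P (c \<odot>\<^bsub>TA\<^esub> t)"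
    and mult: "\<And>s t. s \<in> carrier TA \<Longrightarrow> t \<in> carrier TA \<Longrightarrow> P s \<Longrightarrow> P t \<Longrightarrow> P (s \<otimes>\<^bsub>TA\<^esub> t)"
  shows "P t"
proof -
  have cc: "cs p \<in> carrier TA" if "p \<in> carrier FA" for p
    using T.coset_closed[OF that] by (simp add: tensor_algebra_def)
  have word: "P (cs (sg w 1))" if "set w \<subseteq> carrier V" for w
    using that
  proof (induction w)
    case Nil
    have "cs (sg [] 1) = \<one>\<^bsub>TA\<^esub>"
      by (simp add: tensor_algebra_def T.quot_one free_algebra_simps zero_fmonoid_def[symmetric])
    then show ?case using one by simp
  next
    case (Cons x w)
    have c: "sg [x] 1 \<in> carrier FA" "sg w 1 \<in> carrier FA"
      using Cons.prems by (auto intro: sg_closed)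
    have "cs (sg (x # w) 1) = \<iota> x \<otimes>\<^bsub>TA\<^esub> cs (sg w 1)"
      using T.coset_mult[OF c] by (simp add: tensor_emb_def tensor_algebra_def free_algebra_simps sg_mult)
    then show ?case
      using mult[OF cc[OF c(1)] cc[OF c(2)]] emb[of x] Cons by (simp add: tensor_emb_def)
  qed
  have "P (cs p)" if "p \<in> carrier FA" for p
  proof -
    have "Poly_Mapping.keys p \<subseteq> W" using that by (simp add: F.fs_carrier)
    then show ?thesis
    proof (induction p rule: poly_mapping_induct_on)
      case zero
      \<comment> \<open>There is no induction case for zero, so it is reached as the zero multiple
        of the unit.\<close>
      have "cs 0 = 0 \<odot>\<^bsub>TA\<^esub> \<one>\<^bsub>TA\<^esub>"
        using T.coset_smult[OF F.one_closed, of 0] F.sm_zero_left[OF F.one_closed]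
        by (simp add: tensor_algebra_def T.quot_one F.fs_zero)
      then show ?case using smult one cc[OF F.one_closed]
        by (simp add: tensor_algebra_def T.quot_one)
    next
      case (add k c p)
      obtain w where w: "k = Word w" by (cases k)
      have wV: "set w \<subseteq> carrier V" using add(1) w by simp
      have c: "sg w 1 \<in> carrier FA" "sg w c \<in> carrier FA" "p \<in> carrier FA"
        using wV add(2) by (auto simp: sg_closed F.fs_carrier)
      have "cs (Poly_Mapping.single k c + p) = cs (sg w c) \<oplus>\<^bsub>TA\<^esub> cs p"
        using T.coset_add[OF c(2,3)] by (simp add: tensor_algebra_def w F.fs_add)
      moreover have "cs (sg w c) = c \<odot>\<^bsub>TA\<^esub> cs (sg w 1)"
        using T.coset_smult[OF c(1), of c] by (simp add: tensor_algebra_def F.fs_smult scale_poly_mapping)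
      ultimately show ?case
        using assms(4)[OF cc[OF c(2)] cc[OF c(3)] _ add(3)] smult[OF cc[OF c(1)] word[OF wV], of c] by simp
    qed
  qed
  then show ?thesis using assms(1) by (auto simp: tensor_algebra_def T.quot_carrier)
qed

section \<open>Universal property of the tensor algebra\<close>

definition wprod :: "('k, 'b, 'n) module_scheme \<Rightarrow> ('v \<Rightarrow> 'b) \<Rightarrow> 'v fmonoid \<Rightarrow> 'b" where
  "wprod B f w = foldr (\<lambda>x r. f x \<otimes>\<^bsub>B\<^esub> r) (letters w) \<one>\<^bsub>B\<^esub>"

lemma wprod_closed:
  assumes "assoc_alg B" "f \<in> carrier V \<rightarrow> carrier B"
  shows "wprod B f \<in> W \<rightarrow> carrier B"
proof -
  interpret B: assoc_alg B by fact
  have "foldr (\<lambda>x r. f x \<otimes>\<^bsub>B\<^esub> r) w \<one>\<^bsub>B\<^esub> \<in> carrier B" if "set w \<subseteq> carrier V" for w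
    using that assms(2) by (induction w) auto
  then show ?thesis by (simp add: wprod_def)
qed

lemma wprod_add:
  assumes "assoc_alg B" "f \<in> carrier V \<rightarrow> carrier B" "u \<in> W" "v \<in> W"
  shows "wprod B f (u + v) = wprod B f u \<otimes>\<^bsub>B\<^esub> wprod B f v"
proof -
  interpret B: assoc_alg B by fact
  have v: "wprod B f v \<in> carrier B" using wprod_closed[OF assms(1,2)] assms(4) by auto
  have "foldr (\<lambda>x r. f x \<otimes>\<^bsub>B\<^esub> r) w (wprod B f v) =
        foldr (\<lambda>x r. f x \<otimes>\<^bsub>B\<^esub> r) w \<one>\<^bsub>B\<^esub> \<otimes>\<^bsub>B\<^esub> wprod B f v" if "set w \<subseteq> carrier V" for w
    using that
  proof (induction w)
    case (Cons x w)
    have "foldr (\<lambda>x r. f x \<otimes>\<^bsub>B\<^esub> r) w \<one>\<^bsub>B\<^esub> \<in> carrier B"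
      using wprod_closed[OF assms(1,2)] Cons.prems by (auto simp: wprod_def dest!: funcset_mem[of _ _ _ "Word w"])
    moreover have "f x \<in> carrier B" using assms(2) Cons.prems by auto
    ultimately show ?case using Cons v by (simp add: B.m_assoc)
  qed (simp add: v)
  then show ?thesis using assms(3) by (simp add: wprod_def)
qed

text \<open>The map h extends the word products linearly. It is multiplicative because
  \<open>wprod\<close> turns concatenation into products, and it kills the multilinear relations
  because f is linear in each single letter.\<close>

lemma tensor_lift:
  assumes B: "assoc_alg B" and f: "f \<in> linmap V B"
  shows "\<exists>h\<in>alg_hom TA B. \<forall>x\<in>carrier V. h (\<iota> x) = f x"
proof -
  interpret B: assoc_alg B by fact
  have fc: "f \<in> carrier V \<rightarrow> carrier B" using linmapD(1)[OF f] by auto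
  note wc = wprod_closed[OF B fc]
  note wa = wprod_add[OF B fc]
  define h where "h = lin_ext B (wprod B f)"
  have lin: "h \<in> linmap FA B"
    unfolding h_def by (rule F.lin_ext_linmap[OF B.kspace_axioms wc])
  have single: "h (Poly_Mapping.single w c) = c \<odot>\<^bsub>B\<^esub> wprod B f w" if "w \<in> W" for w c
    unfolding h_def using wc that by (intro B.lin_ext_single) auto
  have hadd: "h (p + q) = h p \<oplus>\<^bsub>B\<^esub> h q" if "p \<in> carrier FA" "q \<in> carrier FA" for p q
    using linmapD(2)[OF lin that] by (simp add: F.fs_add)
  have hz: "h 0 = \<zero>\<^bsub>B\<^esub>" unfolding h_def by simp
  \<comment> \<open>Multiplicativity is bilinear in the two factors: the right factor is built up
    first against a fixed monomial, then the left one.\<close>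
  have sing_mult: "h (Poly_Mapping.single u c * q) = h (Poly_Mapping.single u c) \<otimes>\<^bsub>B\<^esub> h q"
    if u: "u \<in> W" and q: "Poly_Mapping.keys q \<subseteq> W" for u c q
    using q
  proof (induction q rule: poly_mapping_induct_on)
    case zero
    have "h (Poly_Mapping.single u c) \<in> carrier B" by (rule linmapD(1)[OF lin F.single_closed[OF u]])
    then show ?case by (simp add: hz)
  next
    case (add v d q)
    have uv: "u + v \<in> W" using u add(1) by simp
    have c: "Poly_Mapping.single u c \<in> carrier FA" "Poly_Mapping.single v d \<in> carrier FA" "q \<in> carrier FA"
      using u add(1,2) by (auto simp: F.single_closed F.fs_carrier)
    note c' = F.m_closed[OF c(1) c(3)] F.m_closed[OF c(1) c(2)]
    have w: "wprod B f u \<in> carrier B" "wprod B f v \<in> carrier B" using wc u add(1) by auto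
    have "h (Poly_Mapping.single u c * Poly_Mapping.single v d)
        = h (Poly_Mapping.single u c) \<otimes>\<^bsub>B\<^esub> h (Poly_Mapping.single v d)"
      using w by (simp add: mult_single single[OF uv] single[OF u] single[OF add(1)] wa[OF u add(1)]
          B.sm_mult_left B.sm_mult_right B.sm_assoc mult.commute)
    then show ?case
      using add(3) c c' linmapD(1)[OF lin c(1)] linmapD(1)[OF lin c(2)] linmapD(1)[OF lin c(3)]
      by (simp add: distrib_left hadd free_algebra_simps B.r_distr)
  qed
  have hmult: "h (p * q) = h p \<otimes>\<^bsub>B\<^esub> h q" if p: "Poly_Mapping.keys p \<subseteq> W" and q: "Poly_Mapping.keys q \<subseteq> W" for p q
    using p
  proof (induction p rule: poly_mapping_induct_on)
    case zero
    have "h q \<in> carrier B" using q by (intro linmapD(1)[OF lin]) (simp add: F.fs_carrier)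
    then show ?case by (simp add: hz)
  next
    case (add u c p)
    have c: "Poly_Mapping.single u c \<in> carrier FA" "q \<in> carrier FA" "p \<in> carrier FA"
      using q add(1,2) by (auto simp: F.single_closed F.fs_carrier)
    note c' = F.m_closed[OF c(1) c(2)] F.m_closed[OF c(3) c(2)]
    show ?case
      using add(3) c c' linmapD(1)[OF lin c(1)] linmapD(1)[OF lin c(2)] linmapD(1)[OF lin c(3)]
      by (simp add: distrib_right hadd free_algebra_simps B.l_distr sing_mult[OF add(1) q])
  qed
  have "h (Poly_Mapping.single 0 1) = \<one>\<^bsub>B\<^esub>"
    using single[of 0 1] by (simp add: wprod_def)
  then have hom: "h \<in> alg_hom FA B"
    by (intro alg_homI[OF lin]) (simp_all add: free_algebra_simps F.fs_carrier hmult)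
  \<comment> \<open>Isolates the factor f x between the contexts u and v, so that linearity of f
    applies at the very place where the relations differ.\<close>
  have word: "h (sg (u @ [x] @ v) c) = c \<odot>\<^bsub>B\<^esub> (wprod B f (Word u) \<otimes>\<^bsub>B\<^esub> (f x \<otimes>\<^bsub>B\<^esub> wprod B f (Word v)))"
    if "set u \<subseteq> carrier V" "set v \<subseteq> carrier V" "x \<in> carrier V" for u v x c
  proof -
    have "Word (u @ [x] @ v) = Word u + Word (x # v)" by (simp add: plus_fmonoid_def)
    moreover have "wprod B f (Word (x # v)) = f x \<otimes>\<^bsub>B\<^esub> wprod B f (Word v)" by (simp add: wprod_def)
    ultimately show ?thesis using that single[of "Word u + Word (x # v)" c] wa[of "Word u" "Word (x # v)"] by simp
  qed
  have hdiff: "h (p - q) = h p \<ominus>\<^bsub>B\<^esub> h q" if "p \<in> carrier FA" "q \<in> carrier FA" for p q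
    using linmap_minus[OF F.kspace_axioms B.kspace_axioms lin that] by (simp add: F.fs_minus that)
  have rel: "h r = \<zero>\<^bsub>B\<^esub>" if "r \<in> multilinear_relations V" for r
    using that
  proof (cases rule: multilinear_relations_cases)
    case (add u x y v)
    have w: "wprod B f (Word u) \<in> carrier B" "wprod B f (Word v) \<in> carrier B" "f x \<in> carrier B" "f y \<in> carrier B"
      using funcset_mem[OF wc, of "Word u"] funcset_mem[OF wc, of "Word v"] add fc by auto
    have s: "sg (u @ [x] @ v) 1 \<in> carrier FA" "sg (u @ [y] @ v) 1 \<in> carrier FA" "sg (u @ [x \<oplus> y] @ v) 1 \<in> carrier FA"
      using add by (auto intro!: sg_closed)
    have xy: "x \<oplus> y \<in> carrier V" using add by simp
    show ?thesis unfolding add(5) hdiff[OF F.diff_closed[OF s(3,1)] s(2)] hdiff[OF s(3,1)]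
        word[OF add(3,4,1)] word[OF add(3,4,2)] word[OF add(3,4) xy] linmapD(2)[OF f add(1,2)]
      using w by (simp add: B.l_distr B.r_distr B.add_diff_diff)
  next
    case (smult c u x v)
    have w: "wprod B f (Word u) \<in> carrier B" "wprod B f (Word v) \<in> carrier B" "f x \<in> carrier B"
      using funcset_mem[OF wc, of "Word u"] funcset_mem[OF wc, of "Word v"] smult fc by auto
    have s: "sg (u @ [x] @ v) c \<in> carrier FA" "sg (u @ [c \<odot> x] @ v) 1 \<in> carrier FA"
      using smult by (auto intro!: sg_closed)
    have xy: "c \<odot> x \<in> carrier V" using smult by simp
    show ?thesis unfolding smult(4) hdiff[OF s(2,1)]
        word[OF smult(2,3,1)] word[OF smult(2,3) xy] linmapD(3)[OF f smult(1)]
      using w by (simp add: B.sm_mult_left B.sm_mult_right B.M.minus_eq B.M.r_neg)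
  qed
  have "h p = \<zero>\<^bsub>B\<^esub>" if "p \<in> multilinear_span V" for p
    using that linmap_lin_span_zero[OF F.kspace_axioms B.kspace_axioms lin multilinear_relations_closed rel]
    unfolding multilinear_span_def by blast
  from T.alg_quot_lift[OF B hom this] obtain g
    where g: "g \<in> alg_hom TA B" "\<And>p. p \<in> carrier FA \<Longrightarrow> g (cs p) = h p"
    unfolding tensor_algebra_def by blast
  have "g (\<iota> x) = f x" if x: "x \<in> carrier V" for x
    unfolding tensor_emb_def
    using g(2)[of "sg [x] 1"] word[of "[]" "[]" x 1] x linmapD(1)[OF f x] by (simp add: sg_closed wprod_def)
  with g(1) show ?thesis by blast
qed

end

section \<open>Algebras presented by generators and relations\<close>

context tensor_alg
begin

lemma genideal_aquot: "R \<subseteq> carrier TA \<Longrightarrow> aquot TA (genideal TA R)"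
  using tensor_assoc_alg assoc_alg.axioms(2)[OF tensor_assoc_alg]
  by (intro aquot.intro ring.genideal_ideal)

text \<open>The last assumption ranges over every h extending f because the extension is known only
  through an existence statement.\<close>

lemma genideal_quot_lift:
  assumes "R \<subseteq> carrier TA" "assoc_alg B" "f \<in> linmap V B"
    and "\<forall>h\<in>alg_hom TA B. (\<forall>x\<in>carrier V. h (\<iota> x) = f x) \<longrightarrow> (\<forall>r\<in>R. h r = \<zero>\<^bsub>B\<^esub>)"
  shows "\<exists>g\<in>alg_hom (quot_alg TA (genideal TA R)) B.
           \<forall>x\<in>carrier V. g (genideal TA R +>\<^bsub>TA\<^esub> \<iota> x) = f x"
proof -
  interpret Q: aquot TA "genideal TA R" by (rule genideal_aquot[OF assms(1)])
  obtain h where h: "h \<in> alg_hom TA B" "\<And>x. x \<in> carrier V \<Longrightarrow> h (\<iota> x) = f x"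
    using tensor_lift[OF assms(2,3)] by blast
  have "h r = \<zero>\<^bsub>B\<^esub>" if "r \<in> R" for r using assms(4) h that by blast
  then have "h t = \<zero>\<^bsub>B\<^esub>" if "t \<in> genideal TA R" for t
    by (rule alg_hom_genideal_zero[OF tensor_assoc_alg assms(2) h(1) assms(1) _ that])
  from Q.alg_quot_lift[OF assms(2) h(1) this] obtain g
    where g: "g \<in> alg_hom (quot_alg TA (genideal TA R)) B"
      "\<And>t. t \<in> carrier TA \<Longrightarrow> g (genideal TA R +>\<^bsub>TA\<^esub> t) = h t" by blast
  have "g (genideal TA R +>\<^bsub>TA\<^esub> \<iota> x) = f x" if "x \<in> carrier V" for x
    unfolding g(2)[OF linmapD(1)[OF tensor_emb_linmap that]] by (rule h(2)[OF that])
  with g(1) show ?thesis by blast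
qed

end

section \<open>Tensor products\<close>

locale tensor_prod = V: kspace V + W: kspace W
  for V :: "('k::field, 'v, 'm) module_scheme" and W :: "('k, 'w, 'n) module_scheme"
begin

abbreviation "FM \<equiv> free_module (carrier V \<times> carrier W) :: ('k, 'v \<times> 'w \<Rightarrow>\<^sub>0 'k) module"

sublocale F: finsupp_space FM "carrier V \<times> carrier W"
  by (rule free_module_finsupp)

abbreviation e where "e v w c \<equiv> Poly_Mapping.single (v, w) c"

lemma bilinear_relations_cases:
  assumes "r \<in> bilinear_relations V W"
  obtains (add1) v v' w where "v \<in> carrier V" "v' \<in> carrier V" "w \<in> carrier W"
      "r = e (v \<oplus>\<^bsub>V\<^esub> v') w 1 - e v w 1 - e v' w 1"
    | (add2) v w w' where "v \<in> carrier V" "w \<in> carrier W" "w' \<in> carrier W"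
      "r = e v (w \<oplus>\<^bsub>W\<^esub> w') 1 - e v w 1 - e v w' 1"
    | (smult1) c v w where "v \<in> carrier V" "w \<in> carrier W" "r = e (c \<odot>\<^bsub>V\<^esub> v) w 1 - e v w c"
    | (smult2) c v w where "v \<in> carrier V" "w \<in> carrier W" "r = e v (c \<odot>\<^bsub>W\<^esub> w) 1 - e v w c"
  using assms unfolding bilinear_relations_def Let_def
  apply (elim UnE CollectE exE conjE)
     apply (rule add1; assumption)
    apply (rule add2; assumption)
   apply (rule smult1; assumption)
  apply (rule smult2; assumption)
  done

lemma e_closed: "v \<in> carrier V \<Longrightarrow> w \<in> carrier W \<Longrightarrow> e v w c \<in> carrier FM"
  by (rule F.single_closed) simp

lemma bilinear_relations_closed: "bilinear_relations V W \<subseteq> carrier FM"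
proof
  fix r assume "r \<in> bilinear_relations V W"
  then show "r \<in> carrier FM"
    by (cases rule: bilinear_relations_cases) (simp_all add: F.diff_closed e_closed)
qed

sublocale T: kquot FM "bilinear_span V W"
  unfolding bilinear_span_def
  by (intro kquot.intro kquot_axioms.intro F.kspace_axioms F.lin_span_submodule bilinear_relations_closed)

lemma tensor_kspace: "kspace (tensor_product V W)"
  unfolding tensor_product_def by (rule T.quot_kspace)

lemma pure_tensor_closed:
  "v \<in> carrier V \<Longrightarrow> w \<in> carrier W \<Longrightarrow> pure_tensor V W v w \<in> carrier (tensor_product V W)"
  unfolding pure_tensor_def tensor_product_def by (rule T.coset_closed[OF e_closed])

text \<open>The value is recorded at every formal combination p and not merely at pure tensors,
  because the brackets of the adjoint superalgebra are evaluated at such combinations.\<close>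

lemma tensor_product_lift:
  assumes B: "kspace B"
    and closed: "\<And>v w. v \<in> carrier V \<Longrightarrow> w \<in> carrier W \<Longrightarrow> f v w \<in> carrier B"
    and f: "\<And>v. v \<in> carrier V \<Longrightarrow> f v \<in> linmap W B" "\<And>w. w \<in> carrier W \<Longrightarrow> (\<lambda>v. f v w) \<in> linmap V B"
  shows "\<exists>g\<in>linmap (tensor_product V W) B. \<forall>p\<in>carrier FM.
           g (bilinear_span V W +>\<^bsub>FM\<^esub> p) = lin_ext B (\<lambda>(v, w). f v w) p"
proof -
  interpret B: kspace B by fact
  define h where "h = lin_ext B (\<lambda>(v, w). f v w)"
  have fc: "(\<lambda>(v, w). f v w) \<in> carrier V \<times> carrier W \<rightarrow> carrier B" using closed by auto
  have lin: "h \<in> linmap FM B" unfolding h_def by (rule F.lin_ext_linmap[OF B fc])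
  have he: "h (e v w c) = c \<odot>\<^bsub>B\<^esub> f v w" if "v \<in> carrier V" "w \<in> carrier W" for v w c
    unfolding h_def using closed[OF that] by (subst B.lin_ext_single) auto
  have hd: "h (p - q) = h p \<ominus>\<^bsub>B\<^esub> h q" if "p \<in> carrier FM" "q \<in> carrier FM" for p q
    unfolding h_def by (rule F.lin_ext_diff[OF B fc that])
  have rel: "h r = \<zero>\<^bsub>B\<^esub>" if "r \<in> bilinear_relations V W" for r
    using that
  proof (cases rule: bilinear_relations_cases)
    case (add1 v v' w)
    then show ?thesis
      using linmapD(2)[OF f(2)[OF add1(3)] add1(1,2)]
      by (simp add: hd F.diff_closed e_closed he closed B.add_diff_diff)
  next
    case (add2 v w w')
    then show ?thesis
      using linmapD(2)[OF f(1)[OF add2(1)] add2(2,3)]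
      by (simp add: hd F.diff_closed e_closed he closed B.add_diff_diff)
  next
    case (smult1 c v w)
    then show ?thesis
      using linmapD(3)[OF f(2)[OF smult1(2)] smult1(1)]
      by (simp add: hd F.diff_closed e_closed he closed B.M.minus_eq B.M.r_neg)
  next
    case (smult2 c v w)
    then show ?thesis
      using linmapD(3)[OF f(1)[OF smult2(1)] smult2(2)]
      by (simp add: hd F.diff_closed e_closed he closed B.M.minus_eq B.M.r_neg)
  qed
  have "h p = \<zero>\<^bsub>B\<^esub>" if "p \<in> bilinear_span V W" for p
    using that linmap_lin_span_zero[OF F.kspace_axioms B lin bilinear_relations_closed rel]
    unfolding bilinear_span_def by blast
  from T.quot_lift[OF B lin this] show ?thesis
    unfolding tensor_product_def h_def .
qed

end

section \<open>The adjoint Lie superalgebra\<close>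

sublocale superalgebra \<subseteq> kspace A
  by (intro kspace.intro module_axioms)

context superalgebra
begin

lemma grade_subset: "grade A i \<subseteq> carrier A"
  by (rule submoduleE(1)[OF grade_submodule])

lemma grade_closed: "x \<in> grade A i \<Longrightarrow> x \<in> carrier A"
  using grade_subset by blast

lemma grade_ops:
  "\<zero> \<in> grade A i"
  "x \<in> grade A i \<Longrightarrow> y \<in> grade A i \<Longrightarrow> x \<oplus> y \<in> grade A i"
  "x \<in> grade A i \<Longrightarrow> y \<in> grade A i \<Longrightarrow> x \<ominus> y \<in> grade A i"
  "x \<in> grade A i \<Longrightarrow> c \<odot> x \<in> grade A i"
  using submoduleE[OF grade_submodule[of i]] submodule_zero[OF grade_submodule[of i]]
  by (simp_all add: M.minus_eq)

lemma grade_mults: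
  "a \<in> grade A 1 \<Longrightarrow> b \<in> grade A 1 \<Longrightarrow> a \<otimes> b \<in> grade A 0"
  "a \<in> grade A 1 \<Longrightarrow> x \<in> grade A 0 \<Longrightarrow> a \<otimes> x \<in> grade A 1"
  "x \<in> grade A 0 \<Longrightarrow> a \<in> grade A 1 \<Longrightarrow> x \<otimes> a \<in> grade A 1"
  "x \<in> grade A 0 \<Longrightarrow> y \<in> grade A 0 \<Longrightarrow> x \<otimes> y \<in> grade A 0"
  using grade_mult[of a 1 b 1] grade_mult[of a 1 x 0] grade_mult[of x 0 a 1] grade_mult[of x 0 y 0]
  by simp_all

lemma odd_part_simps:
  "carrier (odd_part A) = grade A 1" "x \<oplus>\<^bsub>odd_part A\<^esub> y = x \<oplus> y" "c \<odot>\<^bsub>odd_part A\<^esub> x = c \<odot> x"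
  by (simp_all add: odd_part_def)

lemma odd_part_kspace: "kspace (odd_part A)"
  unfolding odd_part_def kspace_def
  by (rule submodule.submodule_is_module[OF grade_submodule module_axioms])

sublocale O: tensor_prod "odd_part A" "odd_part A"
  by (intro tensor_prod.intro odd_part_kspace)

abbreviation "E \<equiv> adjoint_even A"
abbreviation "pt \<equiv> pure_tensor (odd_part A) (odd_part A)"

lemma odd_square_kspace: "kspace (odd_square A)"
  unfolding odd_square_def by (rule O.tensor_kspace)

lemma pt_closed: "a \<in> grade A 1 \<Longrightarrow> b \<in> grade A 1 \<Longrightarrow> pt a b \<in> carrier (odd_square A)"
  unfolding odd_square_def by (rule O.pure_tensor_closed) (simp_all add: odd_part_simps)

lemma adjoint_relations_cases:
  assumes "r \<in> adjoint_relations A"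
  obtains (comm) a b where "a \<in> grade A 1" "b \<in> grade A 1" "r = pt a b \<ominus>\<^bsub>odd_square A\<^esub> pt b a"
    | (bal) a b x where "a \<in> grade A 1" "b \<in> grade A 1" "x \<in> grade A 0"
      "r = pt (a \<otimes> x) b \<ominus>\<^bsub>odd_square A\<^esub> pt a (b \<otimes> x)"
  using assms unfolding adjoint_relations_def Let_def by blast

lemma adjoint_relations_closed: "adjoint_relations A \<subseteq> carrier (odd_square A)"
proof
  interpret S: kspace "odd_square A" by (rule odd_square_kspace)
  fix r assume "r \<in> adjoint_relations A"
  then show "r \<in> carrier (odd_square A)"
    by (cases rule: adjoint_relations_cases) (simp_all add: S.M.minus_closed pt_closed grade_mults)
qed

sublocale AE: kquot "odd_square A" "adjoint_span A"
  unfolding adjoint_span_def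
  by (intro kquot.intro kquot_axioms.intro odd_square_kspace
      kspace.lin_span_submodule[OF odd_square_kspace] adjoint_relations_closed)

lemma adjoint_even_kspace: "kspace E"
  unfolding adjoint_even_def by (rule AE.quot_kspace)

lemma odot_closed: "a \<in> grade A 1 \<Longrightarrow> b \<in> grade A 1 \<Longrightarrow> odot A a b \<in> carrier E"
  unfolding odot_def adjoint_even_def by (rule AE.coset_closed[OF pt_closed])

text \<open>An even element is a nonempty coset of nonempty cosets, so the choice in
  \<open>adjoint_rep\<close> picks a genuine member, and at both levels a coset is determined by any
  of its members.\<close>

lemma adjoint_rep:
  assumes "\<alpha> \<in> carrier E"
  shows "adjoint_rep \<alpha> \<in> carrier O.FM"
    and "\<alpha>
        = adjoint_span A +>\<^bsub>odd_square A\<^esub> (bilinear_span (odd_part A) (odd_part A) +>\<^bsub>O.FM\<^esub> adjoint_rep \<alpha>)"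
proof -
  have a: "\<alpha> \<in> carrier AE.Q" using assms by (simp add: adjoint_even_def)
  obtain C where C: "C \<in> \<alpha>" using AE.quot_nonempty[OF a] by blast
  have CQ: "C \<in> carrier O.T.Q"
    using AE.coset_rep(1)[OF a C] by (simp add: odd_square_def tensor_product_def)
  obtain p where "p \<in> C" using O.T.quot_nonempty[OF CQ] by blast
  then have "p \<in> \<Union>\<alpha>" using C by blast
  then have "adjoint_rep \<alpha> \<in> \<Union>\<alpha>" unfolding adjoint_rep_def by (rule someI)
  then obtain D where D: "D \<in> \<alpha>" "adjoint_rep \<alpha> \<in> D" by blast
  have DQ: "D \<in> carrier O.T.Q"
    using AE.coset_rep(1)[OF a D(1)] by (simp add: odd_square_def tensor_product_def)
  show "adjoint_rep \<alpha> \<in> carrier O.FM" by (rule O.T.coset_rep(1)[OF DQ D(2)])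
  show "\<alpha>
      = adjoint_span A +>\<^bsub>odd_square A\<^esub> (bilinear_span (odd_part A) (odd_part A) +>\<^bsub>O.FM\<^esub> adjoint_rep \<alpha>)"
    using AE.coset_rep(2)[OF a D(1)] O.T.coset_rep(2)[OF DQ D(2)] by simp
qed

lemma adjoint_rep_keys:
  "\<alpha> \<in> carrier E \<Longrightarrow> Poly_Mapping.keys (adjoint_rep \<alpha>) \<subseteq> grade A 1 \<times> grade A 1"
  using adjoint_rep(1)[of \<alpha>] unfolding O.F.fs_carrier by (simp add: odd_part_simps)

text \<open>Universal property of the even part. The second conjunct is the decisive one: the lift
  can be read off from the representative that the brackets use.\<close>

lemma adjoint_even_lift:
  assumes B: "kspace B"
    and closed: "\<And>a b. a \<in> grade A 1 \<Longrightarrow> b \<in> grade A 1 \<Longrightarrow> f a b \<in> carrier B"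
    and lin: "\<And>a. a \<in> grade A 1 \<Longrightarrow> f a \<in> linmap (odd_part A) B"
    and comm: "\<And>a b. a \<in> grade A 1 \<Longrightarrow> b \<in> grade A 1 \<Longrightarrow> f a b = f b a"
    and bal: "\<And>a b x. a \<in> grade A 1 \<Longrightarrow> b \<in> grade A 1 \<Longrightarrow> x \<in> grade A 0 \<Longrightarrow> f (a \<otimes> x) b = f a (b \<otimes> x)"
  shows "\<exists>g\<in>linmap E B. (\<forall>a\<in>grade A 1. \<forall>b\<in>grade A 1. g (odot A a b) = f a b) \<and>
           (\<forall>\<alpha>\<in>carrier E. g \<alpha> = lin_ext B (\<lambda>(a, b). f a b) (adjoint_rep \<alpha>))"
proof -
  interpret B: kspace B by fact
  interpret S: kspace "odd_square A" by (rule odd_square_kspace)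
  \<comment> \<open>Symmetry of f turns linearity in the second argument into linearity in the
    first.\<close>
  have "(\<lambda>a. f a b) \<in> linmap (odd_part A) B" if b: "b \<in> grade A 1" for b
  proof (rule linmapI)
    note l = linmapD[OF lin[OF b], unfolded odd_part_simps]
    fix x c assume x: "x \<in> carrier (odd_part A)"
    then have x': "x \<in> grade A 1" by (simp add: odd_part_simps)
    show "f x b \<in> carrier B" by (rule closed[OF x' b])
    show "f (c \<odot>\<^bsub>odd_part A\<^esub> x) b = c \<odot>\<^bsub>B\<^esub> f x b"
      using comm[OF x' b] comm[OF grade_ops(4)[OF x', of c] b] l(3)[OF x', of c] by (simp add: odd_part_simps)
    fix y assume "y \<in> carrier (odd_part A)"
    then have y': "y \<in> grade A 1" by (simp add: odd_part_simps)
    show "f (x \<oplus>\<^bsub>odd_part A\<^esub> y) b = f x b \<oplus>\<^bsub>B\<^esub> f y b"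
      using comm[OF x' b] comm[OF y' b] comm[OF grade_ops(2)[OF x' y'] b] l(2)[OF x' y'] by (simp add: odd_part_simps)
  qed
  then obtain h where h: "h \<in> linmap (odd_square A) B"
    "\<And>p. p \<in> carrier O.FM \<Longrightarrow> h (bilinear_span (odd_part A) (odd_part A) +>\<^bsub>O.FM\<^esub> p)
        = lin_ext B (\<lambda>(a, b). f a b) p"
    using O.tensor_product_lift[OF B, of f] closed lin unfolding odd_square_def odd_part_simps(1) by blast
  have hpt: "h (pt a b) = f a b" if ab: "a \<in> grade A 1" "b \<in> grade A 1" for a b
    using h(2)[OF O.e_closed[of a b 1]] B.lin_ext_single[of "\<lambda>(a, b). f a b" "(a, b)" 1] closed[OF ab] ab
    by (simp add: pure_tensor_def odd_part_simps)
  have rel: "h r = \<zero>\<^bsub>B\<^esub>" if "r \<in> adjoint_relations A" for r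
    using that
  proof (cases rule: adjoint_relations_cases)
    case (comm a b)
    then show ?thesis
      using linmap_minus[OF odd_square_kspace B h(1) pt_closed pt_closed, of a b b a] closed[of b a] assms(4)[of a b]
      by (simp add: hpt B.M.minus_eq B.M.r_neg)
  next
    case (bal a b x)
    then show ?thesis
      using linmap_minus[OF odd_square_kspace B h(1) pt_closed pt_closed, of "a \<otimes> x" b a "b \<otimes> x"]
        closed[of a "b \<otimes> x"] assms(5)[of a b x]
      by (simp add: hpt B.M.minus_eq B.M.r_neg grade_mults)
  qed
  have "h C = \<zero>\<^bsub>B\<^esub>" if "C \<in> adjoint_span A" for C
    using that linmap_lin_span_zero[OF odd_square_kspace B h(1) adjoint_relations_closed rel]
    unfolding adjoint_span_def by blast
  from AE.quot_lift[OF B h(1) this] obtain g where g: "g \<in> linmap E B"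
    "\<And>C. C \<in> carrier (odd_square A) \<Longrightarrow> g (adjoint_span A +>\<^bsub>odd_square A\<^esub> C) = h C"
    unfolding adjoint_even_def by blast
  have "g (odot A a b) = f a b" if "a \<in> grade A 1" "b \<in> grade A 1" for a b
    unfolding odot_def g(2)[OF pt_closed[OF that]] by (rule hpt[OF that])
  moreover have "g \<alpha> = lin_ext B (\<lambda>(a, b). f a b) (adjoint_rep \<alpha>)" if a: "\<alpha> \<in> carrier E" for \<alpha>
  proof -
    have "bilinear_span (odd_part A) (odd_part A) +>\<^bsub>O.FM\<^esub> adjoint_rep \<alpha> \<in> carrier (odd_square A)"
      unfolding odd_square_def tensor_product_def by (rule O.T.coset_closed[OF adjoint_rep(1)[OF a]])
    from g(2)[OF this] show ?thesis
      using adjoint_rep(2)[OF a] h(2)[OF adjoint_rep(1)[OF a]] by simp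
  qed
  ultimately show ?thesis using g(1) by blast
qed

lemma adjoint_simps:
  "carrier (adjoint A) = carrier E \<times> grade A 1"
  "(\<alpha>, a) \<otimes>\<^bsub>adjoint A\<^esub> (\<beta>, b) = (bracket_even_even A \<alpha> \<beta> \<oplus>\<^bsub>E\<^esub> odot A a b,
     bracket_even_odd A \<alpha> b \<ominus> bracket_even_odd A \<beta> a)"
  "\<zero>\<^bsub>adjoint A\<^esub> = (\<zero>\<^bsub>E\<^esub>, \<zero>)"
  "(\<alpha>, a) \<oplus>\<^bsub>adjoint A\<^esub> (\<beta>, b) = (\<alpha> \<oplus>\<^bsub>E\<^esub> \<beta>, a \<oplus> b)"
  "c \<odot>\<^bsub>adjoint A\<^esub> (\<alpha>, a) = (c \<odot>\<^bsub>E\<^esub> \<alpha>, c \<odot> a)"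
  "grade (adjoint A) i = (if i = 0 then carrier E \<times> {\<zero>} else {\<zero>\<^bsub>E\<^esub>} \<times> grade A 1)"
  by (simp_all add: adjoint_def Let_def)

text \<open>The tensor algebra is formed over this vector space; the bracket enters only through the
  generators of the ideal.\<close>

lemma adjoint_kspace: "kspace (adjoint A)"
proof (rule kspaceI)
  interpret E: kspace E by (rule adjoint_even_kspace)
  show "abelian_group (adjoint A)"
  proof (rule abelian_groupI)
    fix x assume "x \<in> carrier (adjoint A)"
    then obtain \<alpha> a where x: "x = (\<alpha>, a)" "\<alpha> \<in> carrier E" "a \<in> grade A 1" by (auto simp: adjoint_simps)
    have "\<ominus> a \<in> grade A 1" using grade_ops(4)[OF x(3), of "-1"] grade_closed[OF x(3)] by (simp add: sm_neg_one)
    then show "\<exists>y\<in>carrier (adjoint A). y \<oplus>\<^bsub>adjoint A\<^esub> x = \<zero>\<^bsub>adjoint A\<^esub>"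
      using x grade_closed[OF x(3)]
      by (intro bexI[of _ "(\<ominus>\<^bsub>E\<^esub> \<alpha>, \<ominus> a)"]) (simp_all add: adjoint_simps E.M.l_neg M.l_neg)
  qed (auto simp: adjoint_simps grade_ops grade_closed E.M.a_ac M.a_ac)
  interpret E: kspace E by (rule adjoint_even_kspace)
  show "c \<odot>\<^bsub>adjoint A\<^esub> x \<in> carrier (adjoint A)" if "x \<in> carrier (adjoint A)" for c x
    using that by (auto simp: adjoint_simps grade_ops)
  show "(c + d) \<odot>\<^bsub>adjoint A\<^esub> x = c \<odot>\<^bsub>adjoint A\<^esub> x \<oplus>\<^bsub>adjoint A\<^esub> d \<odot>\<^bsub>adjoint A\<^esub> x"
    if "x \<in> carrier (adjoint A)" for c d x
    using that by (auto simp: adjoint_simps E.sm_add_left sm_add_left grade_closed)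
  show "c \<odot>\<^bsub>adjoint A\<^esub> (x \<oplus>\<^bsub>adjoint A\<^esub> y) = c \<odot>\<^bsub>adjoint A\<^esub> x \<oplus>\<^bsub>adjoint A\<^esub> c \<odot>\<^bsub>adjoint A\<^esub> y"
    if "x \<in> carrier (adjoint A)" "y \<in> carrier (adjoint A)" for c x y
    using that by (auto simp: adjoint_simps E.sm_add_right sm_add_right grade_closed)
  show "c \<odot>\<^bsub>adjoint A\<^esub> (d \<odot>\<^bsub>adjoint A\<^esub> x) = (c * d) \<odot>\<^bsub>adjoint A\<^esub> x" if "x \<in> carrier (adjoint A)" for c d x
    using that by (auto simp: adjoint_simps E.sm_assoc sm_assoc grade_closed)
  show "1 \<odot>\<^bsub>adjoint A\<^esub> x = x" if "x \<in> carrier (adjoint A)" for x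
    using that by (auto simp: adjoint_simps grade_closed)
qed

lemma bracket_even_odd_closed:
  assumes "\<alpha> \<in> carrier E" "c \<in> grade A 1"
  shows "bracket_even_odd A \<alpha> c \<in> grade A 1"
  unfolding bracket_even_odd_def
  using adjoint_rep_keys[OF assms(1)] assms(2)
  by (intro lin_ext_in_submodule[OF grade_submodule]) (auto simp: grade_ops grade_mults subset_iff)

lemma bracket_even_even_closed:
  assumes "\<alpha> \<in> carrier E" "\<beta> \<in> carrier E"
  shows "bracket_even_even A \<alpha> \<beta> \<in> carrier E"
proof -
  interpret E: kspace E by (rule adjoint_even_kspace)
  show ?thesis
    unfolding bracket_even_even_def Let_def
    using adjoint_rep_keys[OF assms(1)] adjoint_rep_keys[OF assms(2)]
    by (auto intro!: E.lin_ext_closed E.M.a_closed E.sm_closed odot_closed simp: subset_iff grade_mults)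
qed

lemma grade_adjoint_closed: "x \<in> grade (adjoint A) i \<Longrightarrow> x \<in> carrier (adjoint A)"
proof -
  interpret E: kspace E by (rule adjoint_even_kspace)
  show "x \<in> grade (adjoint A) i \<Longrightarrow> x \<in> carrier (adjoint A)"
    by (auto simp: adjoint_simps grade_ops split: if_splits)
qed

lemma adjoint_mult_closed:
  assumes "x \<in> carrier (adjoint A)" "y \<in> carrier (adjoint A)"
  shows "x \<otimes>\<^bsub>adjoint A\<^esub> y \<in> carrier (adjoint A)"
proof -
  interpret E: kspace E by (rule adjoint_even_kspace)
  show ?thesis using assms
    by (auto simp: adjoint_simps bracket_even_even_closed bracket_even_odd_closed odot_closed grade_ops)
qed

end

section \<open>Identities in associative rings\<close>

text \<open>To be read with u, v, p the images of ax, bx, ab. The two sides differ by the commutator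
  of x with ab - ba, which is twice the commutator of x with p and hence zero.\<close>

lemma (in ring) balanced_anticommutator:
  assumes carr: "a \<in> carrier R" "b \<in> carrier R" "x \<in> carrier R" "p \<in> carrier R" "u \<in> carrier R" "v \<in> carrier R"
    and u: "u \<oplus> u = a \<otimes> x \<oplus> x \<otimes> a" and v: "v \<oplus> v = b \<otimes> x \<oplus> x \<otimes> b"
    and p: "p \<oplus> p = a \<otimes> b \<ominus> b \<otimes> a" and xp: "x \<otimes> p = p \<otimes> x"
  shows "(u \<otimes> b \<oplus> b \<otimes> u) \<oplus> (u \<otimes> b \<oplus> b \<otimes> u) = (a \<otimes> v \<oplus> v \<otimes> a) \<oplus> (a \<otimes> v \<oplus> v \<otimes> a)"
proof -
  have "(u \<otimes> b \<oplus> b \<otimes> u) \<oplus> (u \<otimes> b \<oplus> b \<otimes> u) = (u \<oplus> u) \<otimes> b \<oplus> b \<otimes> (u \<oplus> u)"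
    using carr by algebra
  also have "\<dots> = (a \<otimes> (b \<otimes> x \<oplus> x \<otimes> b) \<oplus> (b \<otimes> x \<oplus> x \<otimes> b) \<otimes> a)
      \<oplus> (x \<otimes> (a \<otimes> b \<ominus> b \<otimes> a) \<ominus> (a \<otimes> b \<ominus> b \<otimes> a) \<otimes> x)"
    unfolding u using carr(1-3) by algebra
  also have "x \<otimes> (a \<otimes> b \<ominus> b \<otimes> a) \<ominus> (a \<otimes> b \<ominus> b \<otimes> a) \<otimes> x
      = (x \<otimes> p \<ominus> p \<otimes> x) \<oplus> (x \<otimes> p \<ominus> p \<otimes> x)"
    unfolding p[symmetric] using carr(3,4) by algebra
  also have "\<dots> = \<zero>" unfolding xp using carr(3,4) by algebra
  also have "(a \<otimes> (b \<otimes> x \<oplus> x \<otimes> b) \<oplus> (b \<otimes> x \<oplus> x \<otimes> b) \<otimes> a) \<oplus> \<zero>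
      = (a \<otimes> v \<oplus> v \<otimes> a) \<oplus> (a \<otimes> v \<oplus> v \<otimes> a)"
    unfolding v[symmetric] using carr(1,2,6) by algebra
  finally show ?thesis .
qed

text \<open>To be read with y, z the images of bc, ac, with u, v those of a(bc), b(ac), and s half
  the anticommutator of a and b. The images u and v carry two halvings and s only one, whence the
  multiplicity 4 on the left against 2 on the right.\<close>

lemma (in ring) anticommutator_bracket:
  assumes carr: "a \<in> carrier R" "b \<in> carrier R" "c \<in> carrier R" "s \<in> carrier R"
      "y \<in> carrier R" "z \<in> carrier R" "u \<in> carrier R" "v \<in> carrier R"
    and y: "y \<oplus> y = b \<otimes> c \<ominus> c \<otimes> b" and z: "z \<oplus> z = a \<otimes> c \<ominus> c \<otimes> a"
    and u: "u \<oplus> u = a \<otimes> y \<oplus> y \<otimes> a" and v: "v \<oplus> v = b \<otimes> z \<oplus> z \<otimes> b"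
    and s: "s \<oplus> s = a \<otimes> b \<oplus> b \<otimes> a"
  shows "((u \<oplus> v) \<oplus> (u \<oplus> v)) \<oplus> ((u \<oplus> v) \<oplus> (u \<oplus> v)) = (s \<otimes> c \<ominus> c \<otimes> s) \<oplus> (s \<otimes> c \<ominus> c \<otimes> s)"
proof -
  have "((u \<oplus> v) \<oplus> (u \<oplus> v)) \<oplus> ((u \<oplus> v) \<oplus> (u \<oplus> v))
      = (u \<oplus> u) \<oplus> (u \<oplus> u) \<oplus> ((v \<oplus> v) \<oplus> (v \<oplus> v))"
    using carr by algebra
  also have "\<dots> = a \<otimes> (y \<oplus> y) \<oplus> (y \<oplus> y) \<otimes> a \<oplus> (b \<otimes> (z \<oplus> z) \<oplus> (z \<oplus> z) \<otimes> b)"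
    unfolding u v using carr by algebra
  also have "\<dots> = (a \<otimes> b \<oplus> b \<otimes> a) \<otimes> c \<ominus> c \<otimes> (a \<otimes> b \<oplus> b \<otimes> a)"
    unfolding y z using carr(1-3) by algebra
  also have "\<dots> = (s \<otimes> c \<ominus> c \<otimes> s) \<oplus> (s \<otimes> c \<ominus> c \<otimes> s)"
    unfolding s[symmetric] using carr(3,4) by algebra
  finally show ?thesis .
qed

text \<open>The commutator with s is applied to cd + dc by the Leibniz rule. Passing to u, v and
  then to m, n halves twice, while t is halved once, so 2 stands against 4.\<close>

lemma (in ring) anticommutator_derivation:
  assumes carr: "s \<in> carrier R" "c \<in> carrier R" "d \<in> carrier R" "t \<in> carrier R"
      "u \<in> carrier R" "v \<in> carrier R" "m \<in> carrier R" "n \<in> carrier R"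
    and t: "t \<oplus> t = c \<otimes> d \<oplus> d \<otimes> c"
    and u: "u \<oplus> u = s \<otimes> c \<ominus> c \<otimes> s" and v: "v \<oplus> v = s \<otimes> d \<ominus> d \<otimes> s"
    and m: "m \<oplus> m = u \<otimes> d \<oplus> d \<otimes> u" and n: "n \<oplus> n = v \<otimes> c \<oplus> c \<otimes> v"
  shows "(s \<otimes> t \<ominus> t \<otimes> s) \<oplus> (s \<otimes> t \<ominus> t \<otimes> s) = ((m \<oplus> n) \<oplus> (m \<oplus> n)) \<oplus> ((m \<oplus> n) \<oplus> (m \<oplus> n))"
proof -
  have "(s \<otimes> t \<ominus> t \<otimes> s) \<oplus> (s \<otimes> t \<ominus> t \<otimes> s) = s \<otimes> (t \<oplus> t) \<ominus> (t \<oplus> t) \<otimes> s"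
    using carr(1,4) by algebra
  also have "\<dots> = (s \<otimes> c \<ominus> c \<otimes> s) \<otimes> d \<oplus> d \<otimes> (s \<otimes> c \<ominus> c \<otimes> s)
      \<oplus> ((s \<otimes> d \<ominus> d \<otimes> s) \<otimes> c \<oplus> c \<otimes> (s \<otimes> d \<ominus> d \<otimes> s))"
    unfolding t using carr(1-3) by algebra
  also have "\<dots> = (u \<otimes> d \<oplus> d \<otimes> u) \<oplus> (u \<otimes> d \<oplus> d \<otimes> u) \<oplus> ((v \<otimes> c \<oplus> c \<otimes> v) \<oplus> (v \<otimes> c \<oplus> c \<otimes> v))"
    unfolding u[symmetric] v[symmetric] using carr(2,3,5,6) by algebra
  also have "\<dots> = ((m \<oplus> n) \<oplus> (m \<oplus> n)) \<oplus> ((m \<oplus> n) \<oplus> (m \<oplus> n))"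
    unfolding m[symmetric] n[symmetric] using carr(7,8) by algebra
  finally show ?thesis .
qed

text \<open>Lets \<open>linmap_lin_ext\<close> extend the bracket identities from pairs to their
  combinations, in either argument.\<close>

lemma (in assoc_alg) half_commutator_linmap:
  assumes y: "y \<in> carrier M"
  shows "(\<lambda>z. (1/2) \<odot> (z \<otimes> y \<ominus> y \<otimes> z)) \<in> linmap M M"
    and "(\<lambda>z. (1/2) \<odot> (y \<otimes> z \<ominus> z \<otimes> y)) \<in> linmap M M"
proof -
  have add: "(p \<oplus> q) \<ominus> (r \<oplus> s) = (p \<ominus> r) \<oplus> (q \<ominus> s)"
    if "p \<in> carrier M" "q \<in> carrier M" "r \<in> carrier M" "s \<in> carrier M" for p q r s
    using that by (simp add: M.minus_eq M.minus_add M.a_ac)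
  have scale: "(1/2) \<odot> (c \<odot> p \<ominus> c \<odot> q) = c \<odot> ((1/2) \<odot> (p \<ominus> q))"
    if "p \<in> carrier M" "q \<in> carrier M" for c p q
    using that by (simp add: sm_diff_right[symmetric] sm_assoc mult.commute)
  show "(\<lambda>z. (1/2) \<odot> (z \<otimes> y \<ominus> y \<otimes> z)) \<in> linmap M M"
    by (rule linmapI) (use y in \<open>simp_all add: l_distr r_distr add sm_add_right[symmetric]
       sm_mult_left sm_mult_right scale\<close>)
  show "(\<lambda>z. (1/2) \<odot> (y \<otimes> z \<ominus> z \<otimes> y)) \<in> linmap M M"
    by (rule linmapI) (use y in \<open>simp_all add: l_distr r_distr add sm_add_right[symmetric]
       sm_mult_left sm_mult_right scale\<close>)
qed

section \<open>The map from the adjoint Lie superalgebra\<close>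

lemma (in lie_antialgebra) supercommute_cases:
  "x \<in> grade A 0 \<Longrightarrow> y \<in> grade A 0 \<Longrightarrow> x \<otimes> y = y \<otimes> x"
  "a \<in> grade A 1 \<Longrightarrow> b \<in> grade A 1 \<Longrightarrow> a \<otimes> b = \<ominus> (b \<otimes> a)"
  using supercommute[of x 0 y 0] supercommute[of a 1 b 1]
  by (simp_all add: koszul_sign_def mult_closed grade_closed sm_neg_one)

text \<open>The last three assumptions are the defining relations of the enveloping algebra, imposed
  on j in an arbitrary associative algebra. The computations thus happen away from cosets of tensors
  and are later applied to the canonical map \<open>uemb\<close>.\<close>

locale antialgebra_map = lie_antialgebra A + B: assoc_alg B
  for A :: "('k::field, 'a, 'm) superalgebra_scheme" (structure)
    and B :: "('k, 'b, 'n) module_scheme" +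
  fixes j :: "'a \<Rightarrow> 'b"
  assumes two: "(2::'k) \<noteq> 0"
    and j_linmap: "j \<in> linmap A B"
    and j_odd_odd: "\<lbrakk>a \<in> grade A 1; b \<in> grade A 1\<rbrakk> \<Longrightarrow>
          (1/2) \<odot>\<^bsub>B\<^esub> (j a \<otimes>\<^bsub>B\<^esub> j b \<ominus>\<^bsub>B\<^esub> j b \<otimes>\<^bsub>B\<^esub> j a) = j (a \<otimes> b)"
    and j_odd_even: "\<lbrakk>a \<in> grade A 1; x \<in> grade A 0\<rbrakk> \<Longrightarrow>
          (1/2) \<odot>\<^bsub>B\<^esub> (j a \<otimes>\<^bsub>B\<^esub> j x \<oplus>\<^bsub>B\<^esub> j x \<otimes>\<^bsub>B\<^esub> j a) = j (a \<otimes> x)"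
    and j_even_even: "\<lbrakk>x \<in> grade A 0; y \<in> grade A 0\<rbrakk> \<Longrightarrow> j x \<otimes>\<^bsub>B\<^esub> j y = j (x \<otimes> y)"
begin

definition anticomm :: "'a \<Rightarrow> 'a \<Rightarrow> 'b" where
  "anticomm a b = (1/2) \<odot>\<^bsub>B\<^esub> (j a \<otimes>\<^bsub>B\<^esub> j b \<oplus>\<^bsub>B\<^esub> j b \<otimes>\<^bsub>B\<^esub> j a)"

lemma j_closed: "x \<in> carrier A \<Longrightarrow> j x \<in> carrier B"
  by (rule linmapD(1)[OF j_linmap])

lemma j_grade_closed: "x \<in> grade A i \<Longrightarrow> j x \<in> carrier B"
  by (rule j_closed[OF grade_closed])

lemma anticomm_closed: "a \<in> grade A 1 \<Longrightarrow> b \<in> grade A 1 \<Longrightarrow> anticomm a b \<in> carrier B"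
  by (simp add: anticomm_def j_grade_closed)

lemma anticomm_commute: "a \<in> grade A 1 \<Longrightarrow> b \<in> grade A 1 \<Longrightarrow> anticomm a b = anticomm b a"
  by (simp add: anticomm_def j_grade_closed B.M.a_comm)

text \<open>This and the next two lemmas put the relations into the scalar-free form that the ring
  identities take as hypotheses.\<close>

lemma double_anticomm:
  "a \<in> grade A 1 \<Longrightarrow> b \<in> grade A 1 \<Longrightarrow>
    anticomm a b \<oplus>\<^bsub>B\<^esub> anticomm a b = j a \<otimes>\<^bsub>B\<^esub> j b \<oplus>\<^bsub>B\<^esub> j b \<otimes>\<^bsub>B\<^esub> j a"
  unfolding anticomm_def by (rule B.half_double[OF two]) (simp add: j_grade_closed)

lemma double_j_odd_odd:
  "a \<in> grade A 1 \<Longrightarrow> b \<in> grade A 1 \<Longrightarrow>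
    j (a \<otimes> b) \<oplus>\<^bsub>B\<^esub> j (a \<otimes> b) = j a \<otimes>\<^bsub>B\<^esub> j b \<ominus>\<^bsub>B\<^esub> j b \<otimes>\<^bsub>B\<^esub> j a"
  unfolding j_odd_odd[symmetric] by (rule B.half_double[OF two]) (simp add: j_grade_closed)

lemma double_j_odd_even:
  "a \<in> grade A 1 \<Longrightarrow> x \<in> grade A 0 \<Longrightarrow>
    j (a \<otimes> x) \<oplus>\<^bsub>B\<^esub> j (a \<otimes> x) = j a \<otimes>\<^bsub>B\<^esub> j x \<oplus>\<^bsub>B\<^esub> j x \<otimes>\<^bsub>B\<^esub> j a"
  unfolding j_odd_even[symmetric] by (rule B.half_double[OF two]) (simp add: j_grade_closed)

lemma anticomm_balanced:
  assumes a: "a \<in> grade A 1" and b: "b \<in> grade A 1" and x: "x \<in> grade A 0"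
  shows "anticomm (a \<otimes> x) b = anticomm a (b \<otimes> x)"
proof -
  note ax = grade_mults(2)[OF a x] and bx = grade_mults(2)[OF b x] and ab = grade_mults(1)[OF a b]
  \<comment> \<open>Both products are images of the product of x and ab in A, which are even and
    therefore commute there.\<close>
  have "j x \<otimes>\<^bsub>B\<^esub> j (a \<otimes> b) = j (a \<otimes> b) \<otimes>\<^bsub>B\<^esub> j x"
    using j_even_even[OF x ab] j_even_even[OF ab x] supercommute_cases(1)[OF x ab] by simp
  from B.balanced_anticommutator[OF j_grade_closed[OF a] j_grade_closed[OF b] j_grade_closed[OF x] j_grade_closed[OF ab]
      j_grade_closed[OF ax] j_grade_closed[OF bx] double_j_odd_even[OF a x] double_j_odd_even[OF b x]
      double_j_odd_odd[OF a b] this]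
  have "anticomm (a \<otimes> x) b \<oplus>\<^bsub>B\<^esub> anticomm (a \<otimes> x) b \<oplus>\<^bsub>B\<^esub> (anticomm (a \<otimes> x) b \<oplus>\<^bsub>B\<^esub> anticomm (a \<otimes> x) b)
    = anticomm a (b \<otimes> x) \<oplus>\<^bsub>B\<^esub> anticomm a (b \<otimes> x) \<oplus>\<^bsub>B\<^esub> (anticomm a (b \<otimes> x) \<oplus>\<^bsub>B\<^esub> anticomm a (b \<otimes> x))"
    by (simp only: double_anticomm[OF ax b] double_anticomm[OF a bx])
  \<comment> \<open>Both sides carry a factor 4, so \<open>double_cancel\<close> is used
    twice.\<close>
  then show ?thesis
    using anticomm_closed[OF ax b] anticomm_closed[OF a bx]
    by (meson B.double_cancel[OF two] B.M.a_closed)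
qed

lemma anticomm_linmap:
  assumes a: "a \<in> grade A 1"
  shows "anticomm a \<in> linmap (odd_part A) B"
proof (rule linmapI; unfold odd_part_simps)
  fix x c assume x: "x \<in> grade A 1"
  show "anticomm a x \<in> carrier B" by (rule anticomm_closed[OF a x])
  show "anticomm a (c \<odot> x) = c \<odot>\<^bsub>B\<^esub> anticomm a x"
    using j_grade_closed[OF a] j_grade_closed[OF x]
    by (simp add: anticomm_def linmapD(3)[OF j_linmap grade_closed[OF x]] B.sm_mult_left B.sm_mult_right
        B.sm_add_right B.sm_assoc mult.commute)
  fix y assume y: "y \<in> grade A 1"
  show "anticomm a (x \<oplus> y) = anticomm a x \<oplus>\<^bsub>B\<^esub> anticomm a y"
    using j_grade_closed[OF a] j_grade_closed[OF x] j_grade_closed[OF y]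
    by (simp add: anticomm_def linmapD(2)[OF j_linmap grade_closed[OF x] grade_closed[OF y]]
        B.l_distr B.r_distr B.sm_add_right[symmetric] B.M.a_ac)
qed

lemma anticomm_add_left:
  "a \<in> grade A 1 \<Longrightarrow> b \<in> grade A 1 \<Longrightarrow> c \<in> grade A 1 \<Longrightarrow>
    anticomm (a \<oplus> b) c = anticomm a c \<oplus>\<^bsub>B\<^esub> anticomm b c"
  using linmapD(2)[OF anticomm_linmap, of c a b] anticomm_commute[of _ c]
  by (simp add: odd_part_simps grade_ops)

text \<open>The relation between an even and an odd generator, for the single class
  \<open>odot A a b\<close> and c.\<close>

lemma bracket_even_odd_pure:
  assumes a: "a \<in> grade A 1" and b: "b \<in> grade A 1" and c: "c \<in> grade A 1"
  shows "j (a \<otimes> (b \<otimes> c) \<oplus> b \<otimes> (a \<otimes> c))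
    = (1/2) \<odot>\<^bsub>B\<^esub> (anticomm a b \<otimes>\<^bsub>B\<^esub> j c \<ominus>\<^bsub>B\<^esub> j c \<otimes>\<^bsub>B\<^esub> anticomm a b)"
proof -
  let ?s = "anticomm a b"
  note bc = grade_mults(1)[OF b c] and ac = grade_mults(1)[OF a c]
  note u = grade_mults(2)[OF a bc] and v = grade_mults(2)[OF b ac]
  note s = anticomm_closed[OF a b]
  define w where "w = j (a \<otimes> (b \<otimes> c)) \<oplus>\<^bsub>B\<^esub> j (b \<otimes> (a \<otimes> c))"
  have wc: "w \<in> carrier B" unfolding w_def by (intro B.M.a_closed j_grade_closed[OF u] j_grade_closed[OF v])
  have k: "?s \<otimes>\<^bsub>B\<^esub> j c \<ominus>\<^bsub>B\<^esub> j c \<otimes>\<^bsub>B\<^esub> ?s \<in> carrier B" using s j_grade_closed[OF c] by simp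
  have "w \<oplus>\<^bsub>B\<^esub> w \<oplus>\<^bsub>B\<^esub> (w \<oplus>\<^bsub>B\<^esub> w) = ?s \<otimes>\<^bsub>B\<^esub> j c \<ominus>\<^bsub>B\<^esub> j c \<otimes>\<^bsub>B\<^esub> ?s \<oplus>\<^bsub>B\<^esub> (?s \<otimes>\<^bsub>B\<^esub> j c \<ominus>\<^bsub>B\<^esub> j c \<otimes>\<^bsub>B\<^esub> ?s)"
    unfolding w_def
    by (rule B.anticommutator_bracket[OF j_grade_closed[OF a] j_grade_closed[OF b] j_grade_closed[OF c] s j_grade_closed[OF bc]
      j_grade_closed[OF ac] j_grade_closed[OF u] j_grade_closed[OF v] double_j_odd_odd[OF b c] double_j_odd_odd[OF a c]
      double_j_odd_even[OF a bc] double_j_odd_even[OF b ac] double_anticomm[OF a b]])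
  then have "?s \<otimes>\<^bsub>B\<^esub> j c \<ominus>\<^bsub>B\<^esub> j c \<otimes>\<^bsub>B\<^esub> ?s = w \<oplus>\<^bsub>B\<^esub> w"
    by (rule B.double_cancel[OF two B.M.a_closed[OF wc wc] k, symmetric])
  then have "(1/2) \<odot>\<^bsub>B\<^esub> (?s \<otimes>\<^bsub>B\<^esub> j c \<ominus>\<^bsub>B\<^esub> j c \<otimes>\<^bsub>B\<^esub> ?s) = w"
    using wc two by (simp add: B.double B.sm_assoc)
  then show ?thesis
    using linmapD(2)[OF j_linmap grade_closed[OF u] grade_closed[OF v]] by (simp add: w_def)
qed

text \<open>The Leibniz rule produces a(bc) and b(ac) paired with d, and a(bd) and b(ad) paired with
  c, once each; the bracket formula has a(bc) with d and b(ad) with c, twice each. By (LA3) the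
  exchange costs c(ab) paired with d on one side and d(ab) paired with c on the other, and balancing
  identifies these two.\<close>

lemma bracket_even_even_pure:
  assumes a: "a \<in> grade A 1" and b: "b \<in> grade A 1" and c: "c \<in> grade A 1" and d: "d \<in> grade A 1"
  shows "2 \<odot>\<^bsub>B\<^esub> anticomm (a \<otimes> (b \<otimes> c)) d \<oplus>\<^bsub>B\<^esub> 2 \<odot>\<^bsub>B\<^esub> anticomm (b \<otimes> (a \<otimes> d)) c
    = (1/2) \<odot>\<^bsub>B\<^esub> (anticomm a b \<otimes>\<^bsub>B\<^esub> anticomm c d \<ominus>\<^bsub>B\<^esub> anticomm c d \<otimes>\<^bsub>B\<^esub> anticomm a b)"
proof -
  let ?s = "anticomm a b" and ?t = "anticomm c d"
  note ab = grade_mults(1)[OF a b]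
  note bc = grade_mults(1)[OF b c] and ac = grade_mults(1)[OF a c]
  note bd = grade_mults(1)[OF b d] and ad = grade_mults(1)[OF a d]
  note abc = grade_mults(2)[OF a bc] and bac = grade_mults(2)[OF b ac] and cab = grade_mults(2)[OF c ab]
  note abd = grade_mults(2)[OF a bd] and bad = grade_mults(2)[OF b ad] and dab = grade_mults(2)[OF d ab]
  note s = anticomm_closed[OF a b] and t = anticomm_closed[OF c d]
  define u where "u = a \<otimes> (b \<otimes> c) \<oplus> b \<otimes> (a \<otimes> c)"
  define v where "v = a \<otimes> (b \<otimes> d) \<oplus> b \<otimes> (a \<otimes> d)"
  have u: "u \<in> grade A 1" unfolding u_def by (rule grade_ops(2)[OF abc bac])
  have v: "v \<in> grade A 1" unfolding v_def by (rule grade_ops(2)[OF abd bad])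
  have ju: "j u \<oplus>\<^bsub>B\<^esub> j u = ?s \<otimes>\<^bsub>B\<^esub> j c \<ominus>\<^bsub>B\<^esub> j c \<otimes>\<^bsub>B\<^esub> ?s"
    unfolding u_def bracket_even_odd_pure[OF a b c] using s j_grade_closed[OF c] by (intro B.half_double[OF two]) simp
  have jv: "j v \<oplus>\<^bsub>B\<^esub> j v = ?s \<otimes>\<^bsub>B\<^esub> j d \<ominus>\<^bsub>B\<^esub> j d \<otimes>\<^bsub>B\<^esub> ?s"
    unfolding v_def bracket_even_odd_pure[OF a b d] using s j_grade_closed[OF d] by (intro B.half_double[OF two]) simp
  define w where "w = anticomm u d \<oplus>\<^bsub>B\<^esub> anticomm v c"
  have wc: "w \<in> carrier B" unfolding w_def by (intro B.M.a_closed anticomm_closed u v c d)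
  have k: "?s \<otimes>\<^bsub>B\<^esub> ?t \<ominus>\<^bsub>B\<^esub> ?t \<otimes>\<^bsub>B\<^esub> ?s \<in> carrier B" using s t by simp
  have "?s \<otimes>\<^bsub>B\<^esub> ?t \<ominus>\<^bsub>B\<^esub> ?t \<otimes>\<^bsub>B\<^esub> ?s \<oplus>\<^bsub>B\<^esub> (?s \<otimes>\<^bsub>B\<^esub> ?t \<ominus>\<^bsub>B\<^esub> ?t \<otimes>\<^bsub>B\<^esub> ?s) = w \<oplus>\<^bsub>B\<^esub> w \<oplus>\<^bsub>B\<^esub> (w \<oplus>\<^bsub>B\<^esub> w)"
    unfolding w_def
    by (rule B.anticommutator_derivation[OF s j_grade_closed[OF c] j_grade_closed[OF d] t j_grade_closed[OF u] j_grade_closed[OF v]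
      anticomm_closed[OF u d] anticomm_closed[OF v c] double_anticomm[OF c d] ju jv
      double_anticomm[OF u d] double_anticomm[OF v c]])
  then have "?s \<otimes>\<^bsub>B\<^esub> ?t \<ominus>\<^bsub>B\<^esub> ?t \<otimes>\<^bsub>B\<^esub> ?s = w \<oplus>\<^bsub>B\<^esub> w"
    by (rule B.double_cancel[OF two k B.M.a_closed[OF wc wc]])
  then have 1: "(1/2) \<odot>\<^bsub>B\<^esub> (?s \<otimes>\<^bsub>B\<^esub> ?t \<ominus>\<^bsub>B\<^esub> ?t \<otimes>\<^bsub>B\<^esub> ?s) = w"
    using wc two by (simp add: B.double B.sm_assoc)
  \<comment> \<open>This is (LA3) after the inner product of r and p is reversed, which changes its
    sign because both are odd.\<close>
  have jac: "p \<otimes> (q \<otimes> r) = q \<otimes> (p \<otimes> r) \<ominus> r \<otimes> (p \<otimes> q)"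
    if p: "p \<in> grade A 1" and q: "q \<in> grade A 1" and r: "r \<in> grade A 1" for p q r
  proof -
    note cl = grade_closed[OF grade_mults(2)[OF p grade_mults(1)[OF q r]]]
      grade_closed[OF grade_mults(2)[OF q grade_mults(1)[OF p r]]]
      grade_closed[OF grade_mults(2)[OF r grade_mults(1)[OF p q]]]
    have "q \<otimes> (r \<otimes> p) = \<ominus> (q \<otimes> (p \<otimes> r))"
      using supercommute_cases(2)[OF r p] mult_smult_right[of q "p \<otimes> r" "-1"] cl(2)
        grade_closed[OF q] grade_closed[OF grade_mults(1)[OF p r]] by (simp add: sm_neg_one)
    then have "p \<otimes> (q \<otimes> r) \<oplus> \<ominus> (q \<otimes> (p \<otimes> r)) \<oplus> r \<otimes> (p \<otimes> q) = \<zero>"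
      using LA3[OF p q r] by simp
    then have "p \<otimes> (q \<otimes> r) \<ominus> (q \<otimes> (p \<otimes> r) \<ominus> r \<otimes> (p \<otimes> q)) = \<zero>"
      using cl by (simp add: M.minus_eq M.minus_add M.a_assoc)
    then show ?thesis by (rule diff_eq_zero[rotated 2]) (use cl in simp_all)
  qed
  have e1: "anticomm (b \<otimes> (a \<otimes> c)) d = anticomm (a \<otimes> (b \<otimes> c)) d \<oplus>\<^bsub>B\<^esub> anticomm (c \<otimes> (a \<otimes> b)) d"
  proof -
    have "a \<otimes> (b \<otimes> c) \<oplus> c \<otimes> (a \<otimes> b) = b \<otimes> (a \<otimes> c)"
      using jac[OF a b c] grade_closed[OF abc] grade_closed[OF bac] grade_closed[OF cab]
      by (simp add: M.minus_eq M.a_assoc M.l_neg)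
    then show ?thesis using anticomm_add_left[OF abc cab d] by simp
  qed
  have e2: "anticomm (b \<otimes> (a \<otimes> d)) c = anticomm (a \<otimes> (b \<otimes> d)) c \<oplus>\<^bsub>B\<^esub> anticomm (d \<otimes> (a \<otimes> b)) c"
  proof -
    have "a \<otimes> (b \<otimes> d) \<oplus> d \<otimes> (a \<otimes> b) = b \<otimes> (a \<otimes> d)"
      using jac[OF a b d] grade_closed[OF abd] grade_closed[OF bad] grade_closed[OF dab]
      by (simp add: M.minus_eq M.a_assoc M.l_neg)
    then show ?thesis using anticomm_add_left[OF abd dab c] by simp
  qed
  \<comment> \<open>The even element ab moves from one argument to the other by balancing; symmetry
    restores the order.\<close>
  have e3: "anticomm (d \<otimes> (a \<otimes> b)) c = anticomm (c \<otimes> (a \<otimes> b)) d"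
    using anticomm_balanced[OF d c ab] anticomm_commute[OF d cab] by simp
  note cl = anticomm_closed[OF abc d] anticomm_closed[OF cab d] anticomm_closed[OF abd c]
  have "w = anticomm (a \<otimes> (b \<otimes> c)) d \<oplus>\<^bsub>B\<^esub> anticomm (b \<otimes> (a \<otimes> c)) d
      \<oplus>\<^bsub>B\<^esub> (anticomm (a \<otimes> (b \<otimes> d)) c \<oplus>\<^bsub>B\<^esub> anticomm (b \<otimes> (a \<otimes> d)) c)"
    unfolding w_def u_def v_def anticomm_add_left[OF abc bac d] anticomm_add_left[OF abd bad c] ..
  also have "\<dots> = (anticomm (a \<otimes> (b \<otimes> c)) d \<oplus>\<^bsub>B\<^esub> anticomm (a \<otimes> (b \<otimes> c)) d)
      \<oplus>\<^bsub>B\<^esub> (anticomm (b \<otimes> (a \<otimes> d)) c \<oplus>\<^bsub>B\<^esub> anticomm (b \<otimes> (a \<otimes> d)) c)"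
    unfolding e1 e2 e3 using cl by (simp add: B.M.a_ac)
  also have "\<dots> = 2 \<odot>\<^bsub>B\<^esub> anticomm (a \<otimes> (b \<otimes> c)) d \<oplus>\<^bsub>B\<^esub> 2 \<odot>\<^bsub>B\<^esub> anticomm (b \<otimes> (a \<otimes> d)) c"
    unfolding B.double[OF anticomm_closed[OF abc d]] B.double[OF anticomm_closed[OF bad c]] ..
  finally show ?thesis unfolding 1 by (rule sym)
qed

end

lemma (in superalgebra) lie_relations_closed:
  "lie_relations (adjoint A) \<subseteq> carrier (tensor_algebra (adjoint A))"
proof -
  interpret G: tensor_alg "adjoint A" by (rule tensor_alg.intro[OF adjoint_kspace])
  interpret T: assoc_alg G.TA by (rule G.tensor_assoc_alg)
  note \<iota>c = linmapD(1)[OF G.tensor_emb_linmap]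
  show ?thesis
    unfolding lie_relations_def Let_def
    by (auto intro!: T.M.minus_closed T.sm_closed T.m_closed \<iota>c adjoint_mult_closed dest!: grade_adjoint_closed)
qed

lemma (in superalgebra) lie_enveloping_adjoint_assoc_alg: "assoc_alg (lie_enveloping (adjoint A))"
proof -
  interpret G: tensor_alg "adjoint A" by (rule tensor_alg.intro[OF adjoint_kspace])
  show ?thesis
    unfolding lie_enveloping_def
    by (rule aquot.quot_assoc_alg[OF G.genideal_aquot[OF lie_relations_closed]])
qed

section \<open>The induced homomorphism from the enveloping algebra of the adjoint
  superalgebra\<close>

context antialgebra_map
begin

text \<open>The second conjunct says that the map satisfies the relations presenting the enveloping
  algebra of the adjoint superalgebra, with the Koszul signs of all parities.\<close>

lemma adjoint_map:
  "\<exists>\<phi>\<in>linmap (adjoint A) B. (\<forall>a\<in>grade A 1. \<phi> (\<zero>\<^bsub>E\<^esub>, a) = j a) \<and>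
     (\<forall>i k. \<forall>x\<in>grade (adjoint A) i. \<forall>y\<in>grade (adjoint A) k.
        (1/2) \<odot>\<^bsub>B\<^esub> (\<phi> x \<otimes>\<^bsub>B\<^esub> \<phi> y \<ominus>\<^bsub>B\<^esub> koszul_sign i k \<odot>\<^bsub>B\<^esub> (\<phi> y \<otimes>\<^bsub>B\<^esub> \<phi> x)) = \<phi> (x \<otimes>\<^bsub>adjoint A\<^esub> y))"
proof -
  interpret E: kspace E by (rule adjoint_even_kspace)
  note Bk = B.kspace_axioms
  let ?s = "\<lambda>(a, b). anticomm a b"
  obtain g where g: "g \<in> linmap E B"
    and g_odot: "\<And>a b. a \<in> grade A 1 \<Longrightarrow> b \<in> grade A 1 \<Longrightarrow> g (odot A a b) = anticomm a b"
    and g_rep: "\<And>\<alpha>. \<alpha> \<in> carrier E \<Longrightarrow> g \<alpha> = lin_ext B ?s (adjoint_rep \<alpha>)"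
    using adjoint_even_lift[OF Bk anticomm_closed anticomm_linmap anticomm_commute anticomm_balanced] by blast
  note gc = linmapD(1)[OF g]
  have keys: "?s \<in> Poly_Mapping.keys (adjoint_rep \<alpha>) \<rightarrow> carrier B" if "\<alpha> \<in> carrier E" for \<alpha>
    using adjoint_rep_keys[OF that] by (auto intro!: anticomm_closed)
  have even_odd: "j (bracket_even_odd A \<alpha> c) = (1/2) \<odot>\<^bsub>B\<^esub> (g \<alpha> \<otimes>\<^bsub>B\<^esub> j c \<ominus>\<^bsub>B\<^esub> j c \<otimes>\<^bsub>B\<^esub> g \<alpha>)"
    if \<alpha>: "\<alpha> \<in> carrier E" and c: "c \<in> grade A 1" for \<alpha> c
  proof -
    let ?L = "\<lambda>z. (1/2) \<odot>\<^bsub>B\<^esub> (z \<otimes>\<^bsub>B\<^esub> j c \<ominus>\<^bsub>B\<^esub> j c \<otimes>\<^bsub>B\<^esub> z)"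
    let ?F = "\<lambda>(a, b). a \<otimes> (b \<otimes> c) \<oplus> b \<otimes> (a \<otimes> c)"
    let ?p = "adjoint_rep \<alpha>"
    note k = adjoint_rep_keys[OF \<alpha>]
    have L: "?L \<in> linmap B B" by (rule B.half_commutator_linmap(1)[OF j_grade_closed[OF c]])
    have F: "?F \<in> Poly_Mapping.keys ?p \<rightarrow> carrier A"
      using k c by (auto simp: subset_iff grade_ops grade_mults intro!: grade_closed[of _ 1])
    have "j (bracket_even_odd A \<alpha> c) = lin_ext B (\<lambda>x. j (?F x)) ?p"
      unfolding bracket_even_odd_def by (rule linmap_lin_ext[OF kspace_axioms Bk j_linmap F])
    \<comment> \<open>Term by term this is the identity for one pair. The half-commutator with j c
      is linear, so it can then be taken out of the combination, leaving g at the even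
      element.\<close>
    also have "\<dots> = lin_ext B (\<lambda>x. ?L (?s x)) ?p"
    proof (rule B.lin_ext_cong)
      show "(\<lambda>x. ?L (?s x)) \<in> Poly_Mapping.keys ?p \<rightarrow> carrier B"
        using linmapD(1)[OF L] keys[OF \<alpha>] by (simp add: Pi_iff)
      fix x assume "x \<in> Poly_Mapping.keys ?p"
      then obtain a b where "x = (a, b)" "a \<in> grade A 1" "b \<in> grade A 1" using k by blast
      then show "j (?F x) = ?L (?s x)" using bracket_even_odd_pure[of a b c] c by simp
    qed
    also have "\<dots> = ?L (lin_ext B ?s ?p)" by (rule linmap_lin_ext[OF Bk Bk L keys[OF \<alpha>], symmetric])
    finally show ?thesis unfolding g_rep[OF \<alpha>] .
  qed
  have even_even: "g (bracket_even_even A \<alpha> \<beta>) = (1/2) \<odot>\<^bsub>B\<^esub> (g \<alpha> \<otimes>\<^bsub>B\<^esub> g \<beta> \<ominus>\<^bsub>B\<^esub> g \<beta> \<otimes>\<^bsub>B\<^esub> g \<alpha>)"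
    if \<alpha>: "\<alpha> \<in> carrier E" and \<beta>: "\<beta> \<in> carrier E" for \<alpha> \<beta>
  proof -
    let ?p = "adjoint_rep \<alpha>" and ?q = "adjoint_rep \<beta>"
    let ?G = "\<lambda>a b. \<lambda>(c, d). 2 \<odot>\<^bsub>E\<^esub> odot A (a \<otimes> (b \<otimes> c)) d \<oplus>\<^bsub>E\<^esub> 2 \<odot>\<^bsub>E\<^esub> odot A (b \<otimes> (a \<otimes> d)) c"
    let ?L = "\<lambda>z. (1/2) \<odot>\<^bsub>B\<^esub> (z \<otimes>\<^bsub>B\<^esub> g \<beta> \<ominus>\<^bsub>B\<^esub> g \<beta> \<otimes>\<^bsub>B\<^esub> z)"
    note kp = adjoint_rep_keys[OF \<alpha>] and kq = adjoint_rep_keys[OF \<beta>]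
    have L: "?L \<in> linmap B B" by (rule B.half_commutator_linmap(1)[OF gc[OF \<beta>]])
    have G: "?G a b \<in> Poly_Mapping.keys ?q \<rightarrow> carrier E" if "a \<in> grade A 1" "b \<in> grade A 1" for a b
      using kq that by (auto simp: subset_iff grade_mults intro!: E.M.a_closed E.sm_closed odot_closed)
    \<comment> \<open>One argument at a time: with a single pair (a, b) in the first slot, ?K
      absorbs the combination in the second; afterwards ?L does the same for the first.\<close>
    have inner: "g (lin_ext E (?G a b) ?q) = ?L (anticomm a b)"
      if a: "a \<in> grade A 1" and b: "b \<in> grade A 1" for a b
    proof -
      let ?K = "\<lambda>z. (1/2) \<odot>\<^bsub>B\<^esub> (anticomm a b \<otimes>\<^bsub>B\<^esub> z \<ominus>\<^bsub>B\<^esub> z \<otimes>\<^bsub>B\<^esub> anticomm a b)"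
      have K: "?K \<in> linmap B B" by (rule B.half_commutator_linmap(2)[OF anticomm_closed[OF a b]])
      have "g (lin_ext E (?G a b) ?q) = lin_ext B (\<lambda>x. g (?G a b x)) ?q"
        by (rule linmap_lin_ext[OF E.kspace_axioms Bk g G[OF a b]])
      also have "\<dots> = lin_ext B (\<lambda>x. ?K (?s x)) ?q"
      proof (rule B.lin_ext_cong)
        show "(\<lambda>x. ?K (?s x)) \<in> Poly_Mapping.keys ?q \<rightarrow> carrier B"
          using linmapD(1)[OF K] keys[OF \<beta>] by (simp add: Pi_iff)
        fix x assume "x \<in> Poly_Mapping.keys ?q"
        then obtain c d where x: "x = (c, d)" "c \<in> grade A 1" "d \<in> grade A 1" using kq by blast
        have o: "a \<otimes> (b \<otimes> c) \<in> grade A 1" "b \<otimes> (a \<otimes> d) \<in> grade A 1"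
          using a b x by (simp_all add: grade_mults)
        note oc = odot_closed[OF o(1) x(3)] odot_closed[OF o(2) x(2)]
        have "g (?G a b x) = 2 \<odot>\<^bsub>B\<^esub> anticomm (a \<otimes> (b \<otimes> c)) d \<oplus>\<^bsub>B\<^esub> 2 \<odot>\<^bsub>B\<^esub> anticomm (b \<otimes> (a \<otimes> d)) c"
          using linmapD(2)[OF g E.sm_closed[OF oc(1), of 2] E.sm_closed[OF oc(2), of 2]]
            linmapD(3)[OF g oc(1), of 2] linmapD(3)[OF g oc(2), of 2] g_odot[OF o(1) x(3)] g_odot[OF o(2) x(2)]
          by (simp add: x(1))
        then show "g (?G a b x) = ?K (?s x)"
          using bracket_even_even_pure[OF a b x(2,3)] by (simp add: x(1))
      qed
      also have "\<dots> = ?K (lin_ext B ?s ?q)" by (rule linmap_lin_ext[OF Bk Bk K keys[OF \<beta>], symmetric])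
      finally show ?thesis unfolding g_rep[OF \<beta>] .
    qed
    have G': "(\<lambda>(a, b). lin_ext E (?G a b) ?q) \<in> Poly_Mapping.keys ?p \<rightarrow> carrier E"
    proof (rule funcsetI)
      fix x assume "x \<in> Poly_Mapping.keys ?p"
      then obtain a b where x: "x = (a, b)" "a \<in> grade A 1" "b \<in> grade A 1" using kp by blast
      show "(\<lambda>(a, b). lin_ext E (?G a b) ?q) x \<in> carrier E"
        unfolding x(1) split by (rule E.lin_ext_closed[OF G[OF x(2,3)]])
    qed
    have "g (bracket_even_even A \<alpha> \<beta>) = lin_ext B (\<lambda>x. g ((\<lambda>(a, b). lin_ext E (?G a b) ?q) x)) ?p"
      unfolding bracket_even_even_def Let_def by (rule linmap_lin_ext[OF E.kspace_axioms Bk g G'])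
    also have "\<dots> = lin_ext B (\<lambda>x. ?L (?s x)) ?p"
    proof (rule B.lin_ext_cong)
      show "(\<lambda>x. ?L (?s x)) \<in> Poly_Mapping.keys ?p \<rightarrow> carrier B"
        using linmapD(1)[OF L] keys[OF \<alpha>] by (simp add: Pi_iff)
      fix x assume "x \<in> Poly_Mapping.keys ?p"
      then obtain a b where x: "x = (a, b)" "a \<in> grade A 1" "b \<in> grade A 1" using kp by blast
      show "g ((\<lambda>(a, b). lin_ext E (?G a b) ?q) x) = ?L (?s x)"
        using inner[OF x(2,3)] by (simp only: x(1) split)
    qed
    also have "\<dots> = ?L (lin_ext B ?s ?p)" by (rule linmap_lin_ext[OF Bk Bk L keys[OF \<alpha>], symmetric])
    finally show ?thesis unfolding g_rep[OF \<alpha>] .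
  qed
  have g0: "g \<zero>\<^bsub>E\<^esub> = \<zero>\<^bsub>B\<^esub>" by (rule linmap_zero[OF E.kspace_axioms Bk g])
  have j0: "j \<zero> = \<zero>\<^bsub>B\<^esub>" by (rule linmap_zero[OF kspace_axioms Bk j_linmap])
  define \<phi> where "\<phi> = (\<lambda>(\<alpha>, a). g \<alpha> \<oplus>\<^bsub>B\<^esub> j a)"
  have "\<phi> \<in> linmap (adjoint A) B"
  proof (rule linmapI)
    fix x c assume "x \<in> carrier (adjoint A)"
    then obtain \<alpha> a where x: "x = (\<alpha>, a)" "\<alpha> \<in> carrier E" "a \<in> grade A 1" by (auto simp: adjoint_simps)
    note xc = gc[OF x(2)] j_grade_closed[OF x(3)]
    show "\<phi> x \<in> carrier B" using xc by (simp add: \<phi>_def x(1))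
    show "\<phi> (c \<odot>\<^bsub>adjoint A\<^esub> x) = c \<odot>\<^bsub>B\<^esub> \<phi> x"
      using xc linmapD(3)[OF g x(2)] linmapD(3)[OF j_linmap grade_closed[OF x(3)]]
      by (simp add: \<phi>_def x(1) adjoint_simps B.sm_add_right)
    fix y assume "y \<in> carrier (adjoint A)"
    then obtain \<beta> b where y: "y = (\<beta>, b)" "\<beta> \<in> carrier E" "b \<in> grade A 1" by (auto simp: adjoint_simps)
    note yc = gc[OF y(2)] j_grade_closed[OF y(3)]
    show "\<phi> (x \<oplus>\<^bsub>adjoint A\<^esub> y) = \<phi> x \<oplus>\<^bsub>B\<^esub> \<phi> y"
      using xc yc linmapD(2)[OF g x(2) y(2)] linmapD(2)[OF j_linmap grade_closed[OF x(3)] grade_closed[OF y(3)]]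
      by (simp add: \<phi>_def x(1) y(1) adjoint_simps B.M.a_ac)
  qed
  moreover have "\<phi> (\<zero>\<^bsub>E\<^esub>, a) = j a" if "a \<in> grade A 1" for a
    using j_grade_closed[OF that] by (simp add: \<phi>_def g0)
  moreover have "(1/2) \<odot>\<^bsub>B\<^esub> (\<phi> x \<otimes>\<^bsub>B\<^esub> \<phi> y \<ominus>\<^bsub>B\<^esub> koszul_sign i k \<odot>\<^bsub>B\<^esub> (\<phi> y \<otimes>\<^bsub>B\<^esub> \<phi> x)) = \<phi> (x \<otimes>\<^bsub>adjoint A\<^esub> y)"
    if x: "x \<in> grade (adjoint A) i" and y: "y \<in> grade (adjoint A) k" for i k x y
  proof -
    obtain \<alpha> a where xa: "x = (\<alpha>, a)" "\<alpha> \<in> carrier E" "a \<in> grade A 1" "i = 0 \<Longrightarrow> a = \<zero>" "i \<noteq> 0 \<Longrightarrow> \<alpha> = \<zero>\<^bsub>E\<^esub>"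
      using x grade_adjoint_closed[OF x] by (auto simp: adjoint_simps split: if_splits)
    obtain \<beta> b where yb: "y = (\<beta>, b)" "\<beta> \<in> carrier E" "b \<in> grade A 1" "k = 0 \<Longrightarrow> b = \<zero>" "k \<noteq> 0 \<Longrightarrow> \<beta> = \<zero>\<^bsub>E\<^esub>"
      using y grade_adjoint_closed[OF y] by (auto simp: adjoint_simps split: if_splits)
    note cl = gc[OF xa(2)] gc[OF yb(2)] j_grade_closed[OF xa(3)] j_grade_closed[OF yb(3)]
    note beo = bracket_even_odd_closed[OF xa(2) yb(3)] bracket_even_odd_closed[OF yb(2) xa(3)]
    \<comment> \<open>Expanded once for arbitrary pairs. In each of the four parity cases one
      component of each factor is zero, and a single half-commutator or half-anticommutator survives
      with the right sign.\<close>
    have prod: "\<phi> (x \<otimes>\<^bsub>adjoint A\<^esub> y) =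
        ((1/2) \<odot>\<^bsub>B\<^esub> (g \<alpha> \<otimes>\<^bsub>B\<^esub> g \<beta> \<ominus>\<^bsub>B\<^esub> g \<beta> \<otimes>\<^bsub>B\<^esub> g \<alpha>) \<oplus>\<^bsub>B\<^esub> (1/2) \<odot>\<^bsub>B\<^esub> (j a \<otimes>\<^bsub>B\<^esub> j b \<oplus>\<^bsub>B\<^esub> j b \<otimes>\<^bsub>B\<^esub> j a)) \<oplus>\<^bsub>B\<^esub>
        ((1/2) \<odot>\<^bsub>B\<^esub> (g \<alpha> \<otimes>\<^bsub>B\<^esub> j b \<ominus>\<^bsub>B\<^esub> j b \<otimes>\<^bsub>B\<^esub> g \<alpha>) \<ominus>\<^bsub>B\<^esub> (1/2) \<odot>\<^bsub>B\<^esub> (g \<beta> \<otimes>\<^bsub>B\<^esub> j a \<ominus>\<^bsub>B\<^esub> j a \<otimes>\<^bsub>B\<^esub> g \<beta>))"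
      unfolding xa(1) yb(1) adjoint_simps \<phi>_def split
        linmapD(2)[OF g bracket_even_even_closed[OF xa(2) yb(2)] odot_closed[OF xa(3) yb(3)]]
        linmap_minus[OF kspace_axioms Bk j_linmap grade_closed[OF beo(1)] grade_closed[OF beo(2)]]
        even_even[OF xa(2) yb(2)] even_odd[OF xa(2) yb(3)] even_odd[OF yb(2) xa(3)] g_odot[OF xa(3) yb(3)]
        anticomm_def ..
    consider (ee) "i = 0" "k = 0" | (eo) "i = 0" "k = 1" | (oe) "i = 1" "k = 0" | (oo) "i = 1" "k = 1"
      by (metis bit_not_one_iff)
    then show ?thesis
    proof cases
      case ee
      then show ?thesis unfolding prod using cl xa(4) yb(4)
        by (simp add: xa(1) yb(1) \<phi>_def j0 koszul_sign_def B.M.minus_eq)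
    next
      case eo
      then show ?thesis unfolding prod using cl xa(4) yb(5)
        by (simp add: xa(1) yb(1) \<phi>_def j0 g0 koszul_sign_def B.M.minus_eq)
    next
      case oe
      then show ?thesis unfolding prod using cl xa(5) yb(4)
        by (simp add: xa(1) yb(1) \<phi>_def j0 g0 koszul_sign_def B.M.minus_eq B.sm_minus_right[symmetric] B.M.minus_add B.M.a_comm)
    next
      case oo
      then show ?thesis unfolding prod using cl xa(5) yb(5)
        by (simp add: xa(1) yb(1) \<phi>_def j0 g0 koszul_sign_def B.M.minus_eq B.sm_neg_one)
    qed
  qed
  ultimately show ?thesis by blast
qed

text \<open>About the image only the odd elements are recorded, as these generate the enveloping
  algebra of the antialgebra under the spanning hypothesis.\<close>

lemma adjoint_enveloping_hom:
  "\<exists>h\<in>alg_hom (lie_enveloping (adjoint A)) B. \<forall>a\<in>grade A 1. \<exists>t\<in>carrier (lie_enveloping (adjoint A)). h t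
      = j a"
proof -
  interpret E: kspace E by (rule adjoint_even_kspace)
  interpret G: tensor_alg "adjoint A" by (rule tensor_alg.intro[OF adjoint_kspace])
  interpret T: assoc_alg G.TA by (rule G.tensor_assoc_alg)
  obtain \<phi> where \<phi>: "\<phi> \<in> linmap (adjoint A) B" "\<And>a. a \<in> grade A 1 \<Longrightarrow> \<phi> (\<zero>\<^bsub>E\<^esub>, a) = j a"
    and rel: "\<And>i k x y. x \<in> grade (adjoint A) i \<Longrightarrow> y \<in> grade (adjoint A) k \<Longrightarrow>
      (1/2) \<odot>\<^bsub>B\<^esub> (\<phi> x \<otimes>\<^bsub>B\<^esub> \<phi> y \<ominus>\<^bsub>B\<^esub> koszul_sign i k \<odot>\<^bsub>B\<^esub> (\<phi> y \<otimes>\<^bsub>B\<^esub> \<phi> x)) = \<phi> (x \<otimes>\<^bsub>adjoint A\<^esub> y)"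
    using adjoint_map by blast
  have R: "\<exists>i k x y. x \<in> grade (adjoint A) i \<and> y \<in> grade (adjoint A) k \<and>
      r = (1/2) \<odot>\<^bsub>G.TA\<^esub> (G.\<iota> x \<otimes>\<^bsub>G.TA\<^esub> G.\<iota> y \<ominus>\<^bsub>G.TA\<^esub> koszul_sign i k \<odot>\<^bsub>G.TA\<^esub> (G.\<iota> y \<otimes>\<^bsub>G.TA\<^esub> G.\<iota> x))
         \<ominus>\<^bsub>G.TA\<^esub> G.\<iota> (x \<otimes>\<^bsub>adjoint A\<^esub> y)" if "r \<in> lie_relations (adjoint A)" for r
    using that unfolding lie_relations_def Let_def by blast
  note \<iota>c = linmapD(1)[OF G.tensor_emb_linmap]
  note Rc = lie_relations_closed
  \<comment> \<open>Being multiplicative, h turns a generator of the ideal into the corresponding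
    relation between values of the map on the adjoint superalgebra, which \<open>rel\<close>
    provides.\<close>
  have kill: "h r = \<zero>\<^bsub>B\<^esub>"
    if h: "h \<in> alg_hom G.TA B" and h\<iota>: "\<And>x. x \<in> carrier (adjoint A) \<Longrightarrow> h (G.\<iota> x) = \<phi> x"
      and rR: "r \<in> lie_relations (adjoint A)" for h r
  proof -
    obtain i k x y where xy: "x \<in> grade (adjoint A) i" "y \<in> grade (adjoint A) k"
      and r: "r = (1/2) \<odot>\<^bsub>G.TA\<^esub> (G.\<iota> x \<otimes>\<^bsub>G.TA\<^esub> G.\<iota> y \<ominus>\<^bsub>G.TA\<^esub> koszul_sign i k \<odot>\<^bsub>G.TA\<^esub> (G.\<iota> y \<otimes>\<^bsub>G.TA\<^esub> G.\<iota> x))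
         \<ominus>\<^bsub>G.TA\<^esub> G.\<iota> (x \<otimes>\<^bsub>adjoint A\<^esub> y)" using R[OF rR] by blast
    note xc = grade_adjoint_closed[OF xy(1)] and yc = grade_adjoint_closed[OF xy(2)]
    note xyc = adjoint_mult_closed[OF xc yc]
    note l = alg_hom_linmap[OF h]
    note m = linmap_minus[OF T.kspace_axioms B.kspace_axioms l]
    have "h r
        = (1/2) \<odot>\<^bsub>B\<^esub> (\<phi> x \<otimes>\<^bsub>B\<^esub> \<phi> y \<ominus>\<^bsub>B\<^esub> koszul_sign i k \<odot>\<^bsub>B\<^esub> (\<phi> y \<otimes>\<^bsub>B\<^esub> \<phi> x)) \<ominus>\<^bsub>B\<^esub> \<phi> (x \<otimes>\<^bsub>adjoint A\<^esub> y)"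
      unfolding r using \<iota>c[OF xc] \<iota>c[OF yc] \<iota>c[OF xyc]
      by (simp add: m linmapD(3)[OF l] alg_homD(1)[OF h] h\<iota>[OF xc] h\<iota>[OF yc] h\<iota>[OF xyc])
    also have "\<dots> = \<zero>\<^bsub>B\<^esub>"
      unfolding rel[OF xy] using linmapD(1)[OF \<phi>(1) xyc] by (simp add: B.M.minus_eq B.M.r_neg)
    finally show ?thesis .
  qed
  have "\<forall>h\<in>alg_hom G.TA B. (\<forall>x\<in>carrier (adjoint A). h (G.\<iota> x) = \<phi> x) \<longrightarrow>
      (\<forall>r\<in>lie_relations (adjoint A). h r = \<zero>\<^bsub>B\<^esub>)"
    by (intro ballI impI, rule kill) auto
  from G.genideal_quot_lift[OF Rc B.assoc_alg_axioms \<phi>(1) this]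
  obtain h where h: "h \<in> alg_hom (lie_enveloping (adjoint A)) B"
    "\<And>x. x \<in> carrier (adjoint A) \<Longrightarrow> h (genideal G.TA (lie_relations (adjoint A)) +>\<^bsub>G.TA\<^esub> G.\<iota> x) = \<phi> x"
    unfolding lie_enveloping_def by blast
  interpret Q: aquot G.TA "genideal G.TA (lie_relations (adjoint A))" by (rule G.genideal_aquot[OF Rc])
  have "\<exists>t\<in>carrier (lie_enveloping (adjoint A)). h t = j a" if a: "a \<in> grade A 1" for a
  proof
    have c: "(\<zero>\<^bsub>E\<^esub>, a) \<in> carrier (adjoint A)" using a by (simp add: adjoint_simps)
    show "h (genideal G.TA (lie_relations (adjoint A)) +>\<^bsub>G.TA\<^esub> G.\<iota> (\<zero>\<^bsub>E\<^esub>, a)) = j a"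
      using h(2)[OF c] \<phi>(2)[OF a] by simp
    show "genideal G.TA (lie_relations (adjoint A)) +>\<^bsub>G.TA\<^esub> G.\<iota> (\<zero>\<^bsub>E\<^esub>, a) \<in> carrier (lie_enveloping (adjoint A))"
      unfolding lie_enveloping_def by (rule Q.coset_closed[OF \<iota>c[OF c]])
  qed
  with h(1) show ?thesis by blast
qed

end

section \<open>The enveloping algebra of a Lie antialgebra\<close>

text \<open>An isomorphism sends 1 + 1 to 1 + 1, which is nonzero in characteristic 0. The class
  \<open>field_char_0\<close> covers the real and the complex case at once.\<close>

lemma two_neq_zero:
  assumes "(ring_of_type_algebra :: 'k::field ring) \<simeq> (ring_of_type_algebra :: 'r::field_char_0 ring)"
  shows "(2::'k) \<noteq> 0"
proof
  assume 2: "(2::'k) = 0"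
  obtain h where h: "h \<in> ring_iso (ring_of_type_algebra :: 'k ring) (ring_of_type_algebra :: 'r ring)"
    using assms by (auto simp: is_ring_iso_def)
  have add: "h (x + y) = h x + h y" for x y using ring_iso_memE(3)[OF h, of x y] by simp
  have "h (1 + 1) = 1 + 1" using ring_iso_memE(4)[OF h] by (simp only: add) simp
  moreover have "h 0 = 0" using add[of 0 0] by simp
  ultimately show False using 2 by simp
qed

section \<open>The canonical map into the enveloping algebra and generation by odd elements\<close>

context lie_antialgebra
begin

sublocale TA: tensor_alg A
  by (rule tensor_alg.intro[OF kspace_axioms])

abbreviation "UI \<equiv> genideal TA.TA (antialgebra_relations A)"
abbreviation "UA \<equiv> antialgebra_enveloping A"

lemma antialgebra_relations_closed: "antialgebra_relations A \<subseteq> carrier TA.TA"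
proof -
  interpret T: assoc_alg TA.TA by (rule TA.tensor_assoc_alg)
  note \<iota>c = linmapD(1)[OF TA.tensor_emb_linmap]
  show ?thesis
    unfolding antialgebra_relations_def Let_def
    by (auto intro!: T.M.minus_closed T.M.a_closed T.sm_closed T.m_closed \<iota>c mult_closed dest!: grade_closed)
qed

sublocale U: aquot TA.TA UI
  by (rule TA.genideal_aquot[OF antialgebra_relations_closed])

lemma antialgebra_enveloping_assoc_alg: "assoc_alg UA"
  unfolding antialgebra_enveloping_def by (rule U.quot_assoc_alg)

abbreviation "uemb x \<equiv> UI +>\<^bsub>TA.TA\<^esub> TA.\<iota> x"

lemma coset_hom: "(+>\<^bsub>TA.TA\<^esub>) UI \<in> alg_hom TA.TA UA"
  unfolding antialgebra_enveloping_def by (rule U.coset_alg_hom)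

lemma uemb_linmap: "uemb \<in> linmap A UA"
  by (rule linmap_comp[OF TA.tensor_emb_linmap alg_hom_linmap[OF coset_hom]])

text \<open>The relations lie in \<open>UI\<close>, so their cosets vanish; expanding these cosets
  along the quotient homomorphism gives the three equations.\<close>

lemma uemb_antialgebra_map:
  assumes two: "(2::'b) \<noteq> 0"
  shows "antialgebra_map A UA uemb"
proof -
  interpret B: assoc_alg UA by (rule antialgebra_enveloping_assoc_alg)
  note l = alg_hom_linmap[OF coset_hom]
  note m = linmap_minus[OF U.kspace_axioms B.kspace_axioms l]
  note \<iota>c = linmapD(1)[OF TA.tensor_emb_linmap]
  note jc = linmapD(1)[OF uemb_linmap]
  have kill: "UI +>\<^bsub>TA.TA\<^esub> r = \<zero>\<^bsub>UA\<^esub>" if r: "r \<in> antialgebra_relations A" for r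
  proof -
    have "r \<in> UI" using ring.genideal_self[OF assoc_alg.axioms(2)[OF TA.tensor_assoc_alg] antialgebra_relations_closed] r by blast
    then have "UI +>\<^bsub>TA.TA\<^esub> r = UI" by (rule U.I.a_rcos_const)
    then show ?thesis by (simp add: antialgebra_enveloping_def quot_alg_simps)
  qed
  show ?thesis
  proof (intro antialgebra_map.intro antialgebra_map_axioms.intro lie_antialgebra_axioms
      antialgebra_enveloping_assoc_alg uemb_linmap two)
    fix a b assume ab: "a \<in> grade A 1" "b \<in> grade A 1"
    note c = grade_closed[OF ab(1)] grade_closed[OF ab(2)]
    let ?r = "(1/2) \<odot>\<^bsub>TA.TA\<^esub> (TA.\<iota> a \<otimes>\<^bsub>TA.TA\<^esub> TA.\<iota> b \<ominus>\<^bsub>TA.TA\<^esub> TA.\<iota> b \<otimes>\<^bsub>TA.TA\<^esub> TA.\<iota> a) \<ominus>\<^bsub>TA.TA\<^esub> TA.\<iota> (a \<otimes> b)"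
    have "?r \<in> antialgebra_relations A" using ab unfolding antialgebra_relations_def Let_def by blast
    from kill[OF this]
    have "(1/2) \<odot>\<^bsub>UA\<^esub> (uemb a \<otimes>\<^bsub>UA\<^esub> uemb b \<ominus>\<^bsub>UA\<^esub> uemb b \<otimes>\<^bsub>UA\<^esub> uemb a) \<ominus>\<^bsub>UA\<^esub> uemb (a \<otimes> b) = \<zero>\<^bsub>UA\<^esub>"
      using \<iota>c[OF c(1)] \<iota>c[OF c(2)] \<iota>c[OF mult_closed[OF c]]
      by (simp add: m linmapD(3)[OF l] alg_homD(1)[OF coset_hom])
    then show "(1/2) \<odot>\<^bsub>UA\<^esub> (uemb a \<otimes>\<^bsub>UA\<^esub> uemb b \<ominus>\<^bsub>UA\<^esub> uemb b \<otimes>\<^bsub>UA\<^esub> uemb a) = uemb (a \<otimes> b)"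
      by (rule B.diff_eq_zero[rotated 2]) (use jc[OF c(1)] jc[OF c(2)] jc[OF mult_closed[OF c]] in simp_all)
  next
    fix a x assume ab: "a \<in> grade A 1" "x \<in> grade A 0"
    note c = grade_closed[OF ab(1)] grade_closed[OF ab(2)]
    let ?r = "(1/2) \<odot>\<^bsub>TA.TA\<^esub> (TA.\<iota> a \<otimes>\<^bsub>TA.TA\<^esub> TA.\<iota> x \<oplus>\<^bsub>TA.TA\<^esub> TA.\<iota> x \<otimes>\<^bsub>TA.TA\<^esub> TA.\<iota> a) \<ominus>\<^bsub>TA.TA\<^esub> TA.\<iota> (a \<otimes> x)"
    have "?r \<in> antialgebra_relations A" using ab unfolding antialgebra_relations_def Let_def by blast
    from kill[OF this]
    have "(1/2) \<odot>\<^bsub>UA\<^esub> (uemb a \<otimes>\<^bsub>UA\<^esub> uemb x \<oplus>\<^bsub>UA\<^esub> uemb x \<otimes>\<^bsub>UA\<^esub> uemb a) \<ominus>\<^bsub>UA\<^esub> uemb (a \<otimes> x) = \<zero>\<^bsub>UA\<^esub>"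
      using \<iota>c[OF c(1)] \<iota>c[OF c(2)] \<iota>c[OF mult_closed[OF c]]
      by (simp add: m linmapD(2,3)[OF l] alg_homD(1)[OF coset_hom])
    then show "(1/2) \<odot>\<^bsub>UA\<^esub> (uemb a \<otimes>\<^bsub>UA\<^esub> uemb x \<oplus>\<^bsub>UA\<^esub> uemb x \<otimes>\<^bsub>UA\<^esub> uemb a) = uemb (a \<otimes> x)"
      by (rule B.diff_eq_zero[rotated 2]) (use jc[OF c(1)] jc[OF c(2)] jc[OF mult_closed[OF c]] in simp_all)
  next
    fix x y assume ab: "x \<in> grade A 0" "y \<in> grade A 0"
    note c = grade_closed[OF ab(1)] grade_closed[OF ab(2)]
    have "TA.\<iota> x \<otimes>\<^bsub>TA.TA\<^esub> TA.\<iota> y \<ominus>\<^bsub>TA.TA\<^esub> TA.\<iota> (x \<otimes> y) \<in> antialgebra_relations A"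
      using ab unfolding antialgebra_relations_def Let_def by blast
    from kill[OF this]
    have "uemb x \<otimes>\<^bsub>UA\<^esub> uemb y \<ominus>\<^bsub>UA\<^esub> uemb (x \<otimes> y) = \<zero>\<^bsub>UA\<^esub>"
      using \<iota>c[OF c(1)] \<iota>c[OF c(2)] \<iota>c[OF mult_closed[OF c]]
      by (simp add: m alg_homD(1)[OF coset_hom])
    then show "uemb x \<otimes>\<^bsub>UA\<^esub> uemb y = uemb (x \<otimes> y)"
      by (rule B.diff_eq_zero[rotated 2]) (use jc[OF c(1)] jc[OF c(2)] jc[OF mult_closed[OF c]] in simp_all)
  qed
qed

text \<open>Formulated for the image of a homomorphism, which is a subalgebra, instead of for a
  subalgebra generated by a set.\<close>

lemma enveloping_generated_by_odd:
  assumes two: "(2::'b) \<noteq> 0"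
    and span: "grade A 0 = lin_span A {a \<otimes> b | a b. a \<in> grade A 1 \<and> b \<in> grade A 1}"
    and C: "assoc_alg C" and h: "h \<in> alg_hom C UA"
    and odd: "\<And>a. a \<in> grade A 1 \<Longrightarrow> uemb a \<in> h ` carrier C"
  shows "h ` carrier C = carrier UA"
proof
  interpret B: assoc_alg UA by (rule antialgebra_enveloping_assoc_alg)
  interpret C: assoc_alg C by fact
  interpret J: antialgebra_map A UA uemb by (rule uemb_antialgebra_map[OF two])
  let ?H = "h ` carrier C"
  have sub: "submodule ?H (ring_of_type_algebra :: 'b ring) UA"
    by (rule alg_hom_image_submodule[OF C antialgebra_enveloping_assoc_alg h])
  note H = B.submoduleE[OF sub, simplified]
  note Hm = alg_hom_image_mult[OF C h]
  show "?H \<subseteq> carrier UA" by (rule H(1))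
  \<comment> \<open>Pulling the image back to A gives a subspace there, to which the minimality of
    \<open>lin_span\<close> applies once the products of odd elements are known to lie in
    it.\<close>
  have pre: "submodule {x \<in> carrier A. uemb x \<in> ?H} (ring_of_type_algebra :: 'b ring) A"
    by (rule submoduleI')
       (auto simp: linmapD(2,3)[OF uemb_linmap] H(4,5) submodule_zero[OF sub]
          linmap_zero[OF kspace_axioms B.kspace_axioms uemb_linmap])
  have "uemb (a \<otimes> b) \<in> ?H" if "a \<in> grade A 1" "b \<in> grade A 1" for a b
    unfolding J.j_odd_odd[OF that, symmetric] B.M.minus_eq
    by (intro H(4) H(5) H(3) Hm odd that)
  then have "{a \<otimes> b | a b. a \<in> grade A 1 \<and> b \<in> grade A 1} \<subseteq> {x \<in> carrier A. uemb x \<in> ?H}"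
    using mult_closed grade_closed by blast
  then have even: "uemb x \<in> ?H" if "x \<in> grade A 0" for x
    using lin_span_minimal[OF pre] that span by blast
  have emb: "uemb x \<in> ?H" if "x \<in> carrier A" for x
  proof -
    obtain x0 x1 where x: "x0 \<in> grade A 0" "x1 \<in> grade A 1" "x = x0 \<oplus> x1" using grade_sum[OF \<open>x \<in> carrier A\<close>] by blast
    show ?thesis
      unfolding x(3) linmapD(2)[OF uemb_linmap grade_closed[OF x(1)] grade_closed[OF x(2)]]
      by (rule H(5)[OF even[OF x(1)] odd[OF x(2)]])
  qed
  have "UI +>\<^bsub>TA.TA\<^esub> t \<in> ?H" if "t \<in> carrier TA.TA" for t
    using that
  proof (induction t rule: TA.tensor_algebra_induct)
    case one
    have "\<one>\<^bsub>UA\<^esub> \<in> ?H" using alg_homD(2)[OF h] C.one_closed by (metis imageI)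
    then show ?case by (simp add: alg_homD(2)[OF coset_hom])
  next
    case (emb x)
    then show ?case by (rule \<open>\<And>x. x \<in> carrier A \<Longrightarrow> uemb x \<in> ?H\<close>)
  next
    case (add s t)
    then show ?case using linmapD(2)[OF alg_hom_linmap[OF coset_hom] add(1,2)] H(5) by simp
  next
    case (smult c t)
    then show ?case using linmapD(3)[OF alg_hom_linmap[OF coset_hom] smult(1)] H(4) by simp
  next
    case (mult s t)
    then show ?case using alg_homD(1)[OF coset_hom mult(1,2)] Hm by simp
  qed
  then show "carrier UA \<subseteq> ?H"
    by (auto simp: antialgebra_enveloping_def U.quot_carrier)
qed

end

theorem theorem2:
  fixes A :: "('k::field, 'a) superalgebra"
  assumes "(ring_of_type_algebra :: 'k ring) \<simeq> (ring_of_type_algebra :: real ring) \<or>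
           (ring_of_type_algebra :: 'k ring) \<simeq> (ring_of_type_algebra :: complex ring)"
    and "lie_antialgebra A"
    and "grade A 0 = lin_span A {a \<otimes>\<^bsub>A\<^esub> b | a b. a \<in> grade A 1 \<and> b \<in> grade A 1}"
  shows "\<exists>I. ideal I (lie_enveloping (adjoint A)) \<and>
             (\<exists>h. h \<in> alg_iso (antialgebra_enveloping A) (quot_alg (lie_enveloping (adjoint A)) I))"
proof -
  interpret lie_antialgebra A by fact
  have two: "(2::'k) \<noteq> 0"
    using assms(1) two_neq_zero[where 'k='k and 'r=real] two_neq_zero[where 'k='k and 'r=complex] by blast
  \<comment> \<open>The general target B is now the enveloping algebra itself, so the resulting
    homomorphism ends where surjectivity is known.\<close>
  interpret J: antialgebra_map A UA uemb by (rule uemb_antialgebra_map[OF two])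
  obtain h where h: "h \<in> alg_hom (lie_enveloping (adjoint A)) UA"
    and odd: "\<And>a. a \<in> grade A 1 \<Longrightarrow> \<exists>t\<in>carrier (lie_enveloping (adjoint A)). h t = uemb a"
    using J.adjoint_enveloping_hom by blast
  have "uemb a \<in> h ` carrier (lie_enveloping (adjoint A))" if "a \<in> grade A 1" for a
    using odd[OF that] by (metis imageI)
  then have "h ` carrier (lie_enveloping (adjoint A)) = carrier UA"
    by (rule enveloping_generated_by_odd[OF two assms(3) lie_enveloping_adjoint_assoc_alg h])
  then show ?thesis
    by (rule alg_first_isomorphism[OF lie_enveloping_adjoint_assoc_alg antialgebra_enveloping_assoc_alg h])
qed

end
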